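(* Let $G$ be a divisible nilpotent group of finite Morley rank, and let $T$ be the torsion subgroup of $G$. Then $G$ is the central product $$G = d(T) * U_{0,1}(G) * U_{0,2}(G) * \cdots * U_{0,\mathrm{rk}(G)}(G).$$
   Context: "Definable" means definable in the ambient structure of finite Morley rank; $\mathrm{rk}$ denotes Morley rank. A group of finite Morley rank is connected if it has no proper definable subgroup of finite index. The symbol $<$ denotes proper containment of subgroups. An abelian group $A$ of finite Morley rank is indecomposable if there are no two proper definable subgroups $A_1,A_2<A$ with $A_1+A_2=A$. For a nontrivial definable abelian group $A$, a definable supplement of a subgroup $B\le A$ is a proper definable subgroup $C<A$ with $B+C=A$; the radical $J(A)$ is the (unique) maximal proper definable connected subgroup of $A$ without a definable supplement in $A$. The reduced rank of $A$ is $\bar r(A)=\mathrm{rk}(A/J(A))$. For a group $G$ of finite Morley rank and an integer $r$, $U_{0,r}(G)$ is the subgroup generated by all definable indecomposable abelian subgroups $A\le G$ with $\bar r(A)=r$ and $A/J(A)$ torsion-free. For a subset $X$ of $G$, $d(X)$ is the smallest definable subgroup of $G$ containing $X$. The notation $A_0*A_1*\cdots*A_n$ denotes an internal central product: the subgroups pairwise commute and together generate the group. *)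

theory Defs
  imports "HOL-Algebra.Coset" "HOL-Algebra.Generated_Groups" "HOL-Library.Extended_Nat" "HOL-Library.Disjoint_Sets"
begin

section \<open>First-order structures and definable sets\<close>

datatype 'f trm = Var nat | Fun 'f "'f trm list"

datatype ('f, 'r) form =
    Equal "'f trm" "'f trm"
  | Rel 'r "'f trm list"
  | Neg "('f, 'r) form"
  | Conj "('f, 'r) form" "('f, 'r) form"
  | Ex nat "('f, 'r) form"

text \<open>The universe of a structure is the whole type \<open>'a\<close>.  Symbols carry no arity: a symbol
  is interpreted on argument lists of every length, so a language with arities is obtained by letting
  the interpretation be constant on lists of the wrong length, which does not affect definability
  with parameters.\<close>

record ('f, 'r, 'a) struct =
  interp_fun :: "'f \<Rightarrow> 'a list \<Rightarrow> 'a"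
  interp_rel :: "'r \<Rightarrow> 'a list \<Rightarrow> bool"

primrec eval_trm :: "('f, 'r, 'a) struct \<Rightarrow> (nat \<Rightarrow> 'a) \<Rightarrow> 'f trm \<Rightarrow> 'a" where
  "eval_trm M e (Var i) = e i"
| "eval_trm M e (Fun f ts) = interp_fun M f (map (eval_trm M e) ts)"

primrec sat :: "('f, 'r, 'a) struct \<Rightarrow> (nat \<Rightarrow> 'a) \<Rightarrow> ('f, 'r) form \<Rightarrow> bool" where
  "sat M e (Equal s t) \<longleftrightarrow> eval_trm M e s = eval_trm M e t"
| "sat M e (Rel p ts) \<longleftrightarrow> interp_rel M p (map (eval_trm M e) ts)"
| "sat M e (Neg \<phi>) \<longleftrightarrow> \<not> sat M e \<phi>"
| "sat M e (Conj \<phi> \<psi>) \<longleftrightarrow> sat M e \<phi> \<and> sat M e \<psi>"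
| "sat M e (Ex i \<phi>) \<longleftrightarrow> (\<exists>a. sat M (e(i := a)) \<phi>)"

text \<open>Subsets of \<open>M\<^sup>n\<close> are sets of lists of length \<open>n\<close>.  In \<open>defset M n \<phi> e\<close> the variables
  below \<open>n\<close> are the free coordinates; the others are parameters, with values given by \<open>e\<close>.\<close>

definition tuple_env :: "nat \<Rightarrow> 'a list \<Rightarrow> (nat \<Rightarrow> 'a) \<Rightarrow> nat \<Rightarrow> 'a" where
  "tuple_env n xs e = (\<lambda>i. if i < n then xs ! i else e i)"

definition defset ::
  "('f, 'r, 'a) struct \<Rightarrow> nat \<Rightarrow> ('f, 'r) form \<Rightarrow> (nat \<Rightarrow> 'a) \<Rightarrow> 'a list set" where
  "defset M n \<phi> e = {xs. length xs = n \<and> sat M (tuple_env n xs e) \<phi>}"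

definition definable :: "('f, 'r, 'a) struct \<Rightarrow> nat \<Rightarrow> 'a list set \<Rightarrow> bool" where
  "definable M n X \<longleftrightarrow> (\<exists>\<phi> e. X = defset M n \<phi> e)"

definition elementary_embedding ::
  "('f, 'r, 'a) struct \<Rightarrow> ('f, 'r, 'b) struct \<Rightarrow> ('a \<Rightarrow> 'b) \<Rightarrow> bool" where
  "elementary_embedding M N h \<longleftrightarrow> (\<forall>\<phi> e. sat M e \<phi> \<longleftrightarrow> sat N (h \<circ> e) \<phi>)"

text \<open>\<open>\<Gamma>\<close> is a set of formulas in the variable \<open>0\<close>; the remaining variables name parameters
  from the finite set \<open>range e\<close>.\<close>

definition omega_saturated :: "('f, 'r, 'b) struct \<Rightarrow> bool" where
  "omega_saturated N \<longleftrightarrow>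
     (\<forall>\<Gamma> e. finite (range e) \<longrightarrow>
        (\<forall>\<Delta>. finite \<Delta> \<and> \<Delta> \<subseteq> \<Gamma> \<longrightarrow> (\<exists>a. \<forall>\<phi>\<in>\<Delta>. sat N (e(0 := a)) \<phi>)) \<longrightarrow>
        (\<exists>a. \<forall>\<phi>\<in>\<Gamma>. sat N (e(0 := a)) \<phi>))"

text \<open>\<open>extension M N h n X\<close> is the set \<open>X(N)\<close> defined in \<open>N\<close> by any definition of
  \<open>X\<close> in \<open>M\<close>.  The sets in the union are all equal, by \<open>extension_defset\<close> below.\<close>

definition extension ::
  "('f, 'r, 'a) struct \<Rightarrow> ('f, 'r, 'b) struct \<Rightarrow> ('a \<Rightarrow> 'b) \<Rightarrow> nat \<Rightarrow> 'a list set \<Rightarrow> 'b list set"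
  where
  "extension M N h n X = \<Union>{defset N n \<phi> (h \<circ> e) | \<phi> e. X = defset M n \<phi> e}"

primrec ren_trm :: "(nat \<Rightarrow> nat) \<Rightarrow> 'f trm \<Rightarrow> 'f trm" where
  "ren_trm f (Var i) = Var (f i)"
| "ren_trm f (Fun g ts) = Fun g (map (ren_trm f) ts)"

primrec ren :: "(nat \<Rightarrow> nat) \<Rightarrow> ('f, 'r) form \<Rightarrow> ('f, 'r) form" where
  "ren f (Equal s t) = Equal (ren_trm f s) (ren_trm f t)"
| "ren f (Rel p ts) = Rel p (map (ren_trm f) ts)"
| "ren f (Neg \<phi>) = Neg (ren f \<phi>)"
| "ren f (Conj \<phi> \<psi>) = Conj (ren f \<phi>) (ren f \<psi>)"
| "ren f (Ex i \<phi>) = Ex (f i) (ren f \<phi>)"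

lemma eval_ren_trm: "eval_trm M e (ren_trm f t) = eval_trm M (e \<circ> f) t"
  by (induction t) (simp_all add: o_def cong: map_cong)

lemma sat_ren:
  assumes "inj f"
  shows "sat M e (ren f \<phi>) \<longleftrightarrow> sat M (e \<circ> f) \<phi>"
proof (induction \<phi> arbitrary: e)
  case (Ex i \<phi>)
  have "e(f i := a) \<circ> f = (e \<circ> f)(i := a)" for a
    using assms by (auto simp: fun_eq_iff dest: injD)
  then show ?case by (simp only: ren.simps sat.simps Ex.IH)
qed (simp_all add: eval_ren_trm o_def)

lemma sat_exs:
  "sat M e (foldr Ex [0..<n] \<phi>) \<longleftrightarrow> (\<exists>xs. length xs = n \<and> sat M (tuple_env n xs e) \<phi>)"
proof (induction n arbitrary: \<phi>)
  case 0
  show ?case by (simp add: tuple_env_def)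
next
  case (Suc n)
  have env: "(tuple_env n xs e)(n := a) = tuple_env (Suc n) (xs @ [a]) e"
    if "length xs = n" for xs a
    using that by (auto simp: tuple_env_def fun_eq_iff nth_append)
  have "sat M e (foldr Ex [0..<Suc n] \<phi>) \<longleftrightarrow>
      (\<exists>xs. length xs = n \<and> (\<exists>a. sat M ((tuple_env n xs e)(n := a)) \<phi>))"
    by (simp add: Suc.IH)
  also have "\<dots> \<longleftrightarrow> (\<exists>xs a. length xs = n \<and> sat M (tuple_env (Suc n) (xs @ [a]) e) \<phi>)"
    using env by metis
  also have "\<dots> \<longleftrightarrow> (\<exists>xs. length xs = Suc n \<and> sat M (tuple_env (Suc n) xs e) \<phi>)"
    by (metis length_Suc_conv_rev)
  finally show ?case .
qed

lemma defset_eq_transfer: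
  assumes "elementary_embedding M N h" and "defset M n \<phi> e = defset M n \<psi> e'"
  shows "defset N n \<phi> (h \<circ> e) = defset N n \<psi> (h \<circ> e')"
proof -
  define f where "f i = (if i < n then i else n + 2 * (i - n))" for i
  define g where "g i = (if i < n then i else n + 2 * (i - n) + 1)" for i
  define d where "d i = (if even (i - n) then e (n + (i - n) div 2) else e' (n + (i - n) div 2))"
    for i
  have inj: "inj f" "inj g" unfolding f_def g_def inj_def by presburger+
  have envM: "tuple_env n xs d \<circ> f = tuple_env n xs e"
             "tuple_env n xs d \<circ> g = tuple_env n xs e'" for xs
    by (auto simp: tuple_env_def f_def g_def d_def fun_eq_iff)
  have envN: "tuple_env n xs (h \<circ> d) \<circ> f = tuple_env n xs (h \<circ> e)"
             "tuple_env n xs (h \<circ> d) \<circ> g = tuple_env n xs (h \<circ> e')" for xs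
    by (auto simp: tuple_env_def f_def g_def d_def fun_eq_iff)
  let ?\<chi> = "\<lambda>\<phi> \<psi>. foldr Ex [0..<n] (Conj \<phi> (Neg \<psi>))"
  have main: "sat M d (?\<chi> (ren f \<phi>) (ren g \<psi>)) = (\<exists>xs. xs \<in> defset M n \<phi> e - defset M n \<psi> e')"
       "sat M d (?\<chi> (ren g \<psi>) (ren f \<phi>)) = (\<exists>xs. xs \<in> defset M n \<psi> e' - defset M n \<phi> e)"
       "sat N (h \<circ> d) (?\<chi> (ren f \<phi>) (ren g \<psi>)) =
          (\<exists>xs. xs \<in> defset N n \<phi> (h \<circ> e) - defset N n \<psi> (h \<circ> e'))"
       "sat N (h \<circ> d) (?\<chi> (ren g \<psi>) (ren f \<phi>)) =
          (\<exists>xs. xs \<in> defset N n \<psi> (h \<circ> e') - defset N n \<phi> (h \<circ> e))"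
    by (auto simp: sat_exs sat_ren[OF inj(1)] sat_ren[OF inj(2)] envM envN defset_def)
  then show ?thesis
    using assms unfolding elementary_embedding_def by blast
qed

lemma extension_defset:
  assumes "elementary_embedding M N h"
  shows "extension M N h n (defset M n \<phi> e) = defset N n \<phi> (h \<circ> e)"
  using defset_eq_transfer[OF assms] unfolding extension_def by blast

section \<open>Morley rank\<close>

text \<open>Throughout, \<open>h\<close> is an elementary embedding of the ambient structure \<open>M\<close> in an
  \<open>\<omega>\<close>-saturated structure \<open>N\<close>, and the Morley rank of a set definable in \<open>M\<close> is computed
  in \<open>N\<close>, as usual; it does not depend on the choice of \<open>N\<close>.\<close>

text \<open>\<open>\<D>\<close> is the collection of sets considered as definable.\<close>

primrec rank_ge :: "'c set set \<Rightarrow> nat \<Rightarrow> 'c set \<Rightarrow> bool" where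
  "rank_ge \<D> 0 X \<longleftrightarrow> X \<noteq> {}"
| "rank_ge \<D> (Suc n) X \<longleftrightarrow>
     (\<exists>Y :: nat \<Rightarrow> 'c set. disjoint_family Y \<and> (\<forall>i. Y i \<in> \<D> \<and> Y i \<subseteq> X \<and> rank_ge \<D> n (Y i)))"

text \<open>The value \<open>\<infinity>\<close> covers all ranks that are not natural numbers.  The empty set gets the value
  \<open>0\<close>, but only nonempty sets are considered below.\<close>

definition rank_in :: "'c set set \<Rightarrow> 'c set \<Rightarrow> enat" where
  "rank_in \<D> X = Sup {enat n | n. rank_ge \<D> n X}"

definition morley_rank ::
  "('f, 'r, 'a) struct \<Rightarrow> ('f, 'r, 'b) struct \<Rightarrow> ('a \<Rightarrow> 'b) \<Rightarrow> nat \<Rightarrow> 'a list set \<Rightarrow> enat" where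
  "morley_rank M N h n X = rank_in {Y. definable N n Y} (extension M N h n X)"

text \<open>The rank of the quotient of a definable set by a definable equivalence relation, i.e. of an
  imaginary sort: a set of classes is definable when its union is.\<close>

definition extension_rel ::
  "('f, 'r, 'a) struct \<Rightarrow> ('f, 'r, 'b) struct \<Rightarrow> ('a \<Rightarrow> 'b) \<Rightarrow> nat \<Rightarrow> ('a list \<times> 'a list) set
     \<Rightarrow> ('b list \<times> 'b list) set" where
  "extension_rel M N h n E =
     {(x, y). length x = n \<and> length y = n \<and>
        x @ y \<in> extension M N h (2 * n) {u @ v | u v. (u, v) \<in> E}}"

definition morley_rank_quotient ::
  "('f, 'r, 'a) struct \<Rightarrow> ('f, 'r, 'b) struct \<Rightarrow> ('a \<Rightarrow> 'b) \<Rightarrow> nat \<Rightarrow> 'a list set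
     \<Rightarrow> ('a list \<times> 'a list) set \<Rightarrow> enat" where
  "morley_rank_quotient M N h n X E =
     (let Q = extension M N h n X // extension_rel M N h n E
      in rank_in {S. S \<subseteq> Q \<and> definable N n (\<Union>S)} Q)"

section \<open>Definable groups\<close>

text \<open>The elements of a definable group are \<open>k\<close>-tuples.  The group has finite Morley rank when
  the Morley rank of its carrier is finite; in particular this holds when the ambient structure has
  finite Morley rank.\<close>

definition definable_group :: "('f, 'r, 'a) struct \<Rightarrow> nat \<Rightarrow> 'a list monoid \<Rightarrow> bool" where
  "definable_group M k G \<longleftrightarrow> group G \<and> definable M k (carrier G) \<and>
     definable M (3 * k) {x @ y @ (x \<otimes>\<^bsub>G\<^esub> y) | x y. x \<in> carrier G \<and> y \<in> carrier G}"

definition definable_subgroup ::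
  "('f, 'r, 'a) struct \<Rightarrow> nat \<Rightarrow> 'a list monoid \<Rightarrow> 'a list set \<Rightarrow> bool" where
  "definable_subgroup M k G H \<longleftrightarrow> subgroup H G \<and> definable M k H"

definition definable_connected ::
  "('f, 'r, 'a) struct \<Rightarrow> nat \<Rightarrow> 'a list monoid \<Rightarrow> 'a list set \<Rightarrow> bool" where
  "definable_connected M k G H \<longleftrightarrow> definable_subgroup M k G H \<and>
     \<not> (\<exists>K. definable_subgroup M k G K \<and> K \<subset> H \<and> finite (rcosets\<^bsub>G\<lparr>carrier := H\<rparr>\<^esub> K))"

definition definable_abelian ::
  "('f, 'r, 'a) struct \<Rightarrow> nat \<Rightarrow> 'a list monoid \<Rightarrow> 'a list set \<Rightarrow> bool" where
  "definable_abelian M k G A \<longleftrightarrow>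
     definable_subgroup M k G A \<and> comm_group (G\<lparr>carrier := A\<rparr>)"

definition indecomposable ::
  "('f, 'r, 'a) struct \<Rightarrow> nat \<Rightarrow> 'a list monoid \<Rightarrow> 'a list set \<Rightarrow> bool" where
  "indecomposable M k G A \<longleftrightarrow>
     \<not> (\<exists>A1 A2. definable_subgroup M k G A1 \<and> A1 \<subset> A \<and>
          definable_subgroup M k G A2 \<and> A2 \<subset> A \<and> A1 <#>\<^bsub>G\<^esub> A2 = A)"

definition definable_supplement ::
  "('f, 'r, 'a) struct \<Rightarrow> nat \<Rightarrow> 'a list monoid \<Rightarrow> 'a list set \<Rightarrow> 'a list set \<Rightarrow> 'a list set
     \<Rightarrow> bool" where
  "definable_supplement M k G A B C \<longleftrightarrow>
     definable_subgroup M k G C \<and> C \<subset> A \<and> B <#>\<^bsub>G\<^esub> C = A"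

definition unsupplemented ::
  "('f, 'r, 'a) struct \<Rightarrow> nat \<Rightarrow> 'a list monoid \<Rightarrow> 'a list set \<Rightarrow> 'a list set \<Rightarrow> bool" where
  "unsupplemented M k G A B \<longleftrightarrow>
     definable_connected M k G B \<and> B \<subset> A \<and> \<not> (\<exists>C. definable_supplement M k G A B C)"

text \<open>Only meaningful for nontrivial abelian \<open>A\<close>.\<close>

definition radical ::
  "('f, 'r, 'a) struct \<Rightarrow> nat \<Rightarrow> 'a list monoid \<Rightarrow> 'a list set \<Rightarrow> 'a list set" where
  "radical M k G A =
     (THE J. unsupplemented M k G A J \<and> (\<forall>B. unsupplemented M k G A B \<and> J \<subseteq> B \<longrightarrow> B = J))"

definition radical_quotient ::
  "('f, 'r, 'a) struct \<Rightarrow> nat \<Rightarrow> 'a list monoid \<Rightarrow> 'a list set \<Rightarrow> 'a list set monoid" where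
  "radical_quotient M k G A = G\<lparr>carrier := A\<rparr> Mod radical M k G A"

definition reduced_rank ::
  "('f, 'r, 'a) struct \<Rightarrow> ('f, 'r, 'b) struct \<Rightarrow> ('a \<Rightarrow> 'b) \<Rightarrow> nat \<Rightarrow> 'a list monoid
     \<Rightarrow> 'a list set \<Rightarrow> enat" where
  "reduced_rank M N h k G A =
     morley_rank_quotient M N h k A
       {(x, y). x \<in> A \<and> y \<in> A \<and> radical M k G A #>\<^bsub>G\<^esub> x = radical M k G A #>\<^bsub>G\<^esub> y}"

definition torsion :: "('c, 'd) monoid_scheme \<Rightarrow> 'c set" where
  "torsion G = {x \<in> carrier G. \<exists>n::nat. n > 0 \<and> x [^]\<^bsub>G\<^esub> n = \<one>\<^bsub>G\<^esub>}"

definition torsion_free :: "('c, 'd) monoid_scheme \<Rightarrow> bool" where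
  "torsion_free G \<longleftrightarrow> torsion G = {\<one>\<^bsub>G\<^esub>}"

definition U0 ::
  "('f, 'r, 'a) struct \<Rightarrow> ('f, 'r, 'b) struct \<Rightarrow> ('a \<Rightarrow> 'b) \<Rightarrow> nat \<Rightarrow> 'a list monoid \<Rightarrow> nat
     \<Rightarrow> 'a list set" where
  "U0 M N h k G r = generate G (\<Union>{A. definable_abelian M k G A \<and> A \<noteq> {\<one>\<^bsub>G\<^esub>} \<and>
     indecomposable M k G A \<and> reduced_rank M N h k G A = enat r \<and>
     torsion_free (radical_quotient M k G A)})"

definition definable_hull ::
  "('f, 'r, 'a) struct \<Rightarrow> nat \<Rightarrow> 'a list monoid \<Rightarrow> 'a list set \<Rightarrow> 'a list set" where
  "definable_hull M k G X = (LEAST H. definable_subgroup M k G H \<and> X \<subseteq> H)"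

section \<open>Divisible and nilpotent groups, central products\<close>

definition divisible_group :: "('c, 'd) monoid_scheme \<Rightarrow> bool" where
  "divisible_group G \<longleftrightarrow>
     (\<forall>x \<in> carrier G. \<forall>n::nat. n > 0 \<longrightarrow> (\<exists>y \<in> carrier G. y [^]\<^bsub>G\<^esub> n = x))"

primrec lower_central :: "('c, 'd) monoid_scheme \<Rightarrow> nat \<Rightarrow> 'c set" where
  "lower_central G 0 = carrier G"
| "lower_central G (Suc n) = generate G
     {x \<otimes>\<^bsub>G\<^esub> y \<otimes>\<^bsub>G\<^esub> inv\<^bsub>G\<^esub> x \<otimes>\<^bsub>G\<^esub> inv\<^bsub>G\<^esub> y | x y. x \<in> lower_central G n \<and> y \<in> carrier G}"

definition nilpotent_group :: "('c, 'd) monoid_scheme \<Rightarrow> bool" where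
  "nilpotent_group G \<longleftrightarrow> (\<exists>n. lower_central G n = {\<one>\<^bsub>G\<^esub>})"

definition central_product :: "('c, 'd) monoid_scheme \<Rightarrow> 'i set \<Rightarrow> ('i \<Rightarrow> 'c set) \<Rightarrow> bool" where
  "central_product G I A \<longleftrightarrow>
     (\<forall>i \<in> I. subgroup (A i) G) \<and>
     (\<forall>i \<in> I. \<forall>j \<in> I. i \<noteq> j \<longrightarrow> (\<forall>x \<in> A i. \<forall>y \<in> A j. x \<otimes>\<^bsub>G\<^esub> y = y \<otimes>\<^bsub>G\<^esub> x)) \<and>
     generate G (\<Union>i \<in> I. A i) = carrier G"

end

theory Submission
  imports Defs "HOL-Algebra.Multiplicative_Group"
begin

text \<open>The proof has three independent parts, all of which rest on the descending chain condition for
  definable subgroups and on the fact that a definable subgroup of infinite index has smaller rank.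

  \<^emph>\<open>Reduction to abelian groups.\<close>  In \<open>G\<close> an element that commutes with a positive power of \<open>x\<close>
  commutes with \<open>x\<close> (\<open>commute_of_pow_commute\<close>).  This fails for divisible nilpotent groups in general;
  here it follows from the chain condition, because passing to further and further roots of an element
  must eventually stop shrinking its centralizer.  Consequently torsion elements are central, hence so
  is \<open>d(T)\<close>, and centralizers of arbitrary sets are divisible.  The double centralizer of an element is
  therefore a definable divisible abelian subgroup that contains it, and \<open>G\<close> is generated by its
  definable divisible abelian subgroups (\<open>divisible_abelian_cover\<close>).

  \<^emph>\<open>Generation.\<close>  A definable divisible abelian subgroup \<open>A\<close> that is not indecomposable is the sum of two
  smaller definable divisible ones, so by well-founded induction only indecomposable \<open>A\<close> matter.  Either
  the torsion of \<open>A\<close> has definable hull \<open>A\<close>, and then \<open>A \<le> d(T)\<close>; or every definable subgroup containing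
  this hull is divisible, which makes \<open>A/J(A)\<close> torsion-free, and then \<open>A\<close> is one of the generators of
  some \<open>U\<^sub>0\<^sub>,\<^sub>r(G)\<close> with \<open>1 \<le> r \<le> rk G\<close> (\<open>divisible_abelian_subset\<close>).

  \<^emph>\<open>Commutation.\<close>  If \<open>A\<close> is indecomposable abelian and \<open>A/J(A)\<close> is torsion-free, then \<open>J(A)\<close> contains all
  proper definable subgroups of \<open>A\<close>; this is the notion of \<open>atom\<close> below.  Suppose that two such groups
  \<open>A\<close> and \<open>B\<close> satisfy \<open>[A,B] \<le> Z\<^sub>i\<^sub>+\<^sub>1\<close> but not \<open>[A,B] \<le> Z\<^sub>i\<close>, for terms of the upper central series.
  Commutation is bilinear modulo \<open>Z\<^sub>i\<close>.  For \<open>X\<close> of maximal rank among the definable subgroups between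
  \<open>Z\<^sub>i\<close> and \<open>Z\<^sub>i\<^sub>+\<^sub>1\<close> that do not contain \<open>[A,B]\<close>, one finds \<open>a\<close> and \<open>b\<close> such that both \<open>[a,B]\<close> and
  \<open>[A,b]\<close> generate the same nontrivial group modulo \<open>X\<close>.  So a nontrivial quotient of \<open>A\<close> is definably
  isomorphic to a nontrivial quotient of \<open>B\<close>, whence \<open>A/J(A)\<close> and \<open>B/J(B)\<close> have the same rank
  (\<open>atoms_commute_step\<close>, \<open>reduced_rank_cong\<close>).  For different reduced ranks the commutators thus descend
  the upper central series to \<open>1\<close>.

  Isomorphisms of quotients are represented by definable relations between the groups themselves.\<close>

section \<open>Definability in blocks of variables\<close>

text \<open>A group element is a \<open>k\<close>-tuple, so formulas are evaluated under assignments \<open>\<sigma>\<close> of tuples to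
  "block variables".  Even variables list the coordinates of the blocks \<open>\<sigma> 0, \<sigma> 1, \<dots>\<close> one after the
  other, odd variables carry the parameters \<open>e\<close>.  For \<open>k = 0\<close> there are no coordinates, and the even
  variables all have the dummy value \<open>c\<close>.\<close>

definition block_env :: "nat \<Rightarrow> 'a \<Rightarrow> (nat \<Rightarrow> 'a list) \<Rightarrow> (nat \<Rightarrow> 'a) \<Rightarrow> nat \<Rightarrow> 'a" where
  "block_env k c \<sigma> e v =
     (if odd v then e (v div 2) else if k = 0 then c else \<sigma> (v div 2 div k) ! (v div 2 mod k))"

definition block_defines ::
  "('f, 'r, 'a) struct \<Rightarrow> nat \<Rightarrow> 'a \<Rightarrow> (nat \<Rightarrow> 'a) \<Rightarrow> ('f, 'r) form \<Rightarrow> ((nat \<Rightarrow> 'a list) \<Rightarrow> bool) \<Rightarrow> bool"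
  where "block_defines L k c e \<phi> P \<longleftrightarrow>
    (\<forall>\<sigma>. (\<forall>i. length (\<sigma> i) = k) \<longrightarrow> P \<sigma> = sat L (block_env k c \<sigma> e) \<phi>)"

lemma block_definesI:
  "(\<And>\<sigma>. (\<And>i. length (\<sigma> i) = k) \<Longrightarrow> P \<sigma> = sat L (block_env k c \<sigma> e) \<phi>) \<Longrightarrow> block_defines L k c e \<phi> P"
  by (simp add: block_defines_def)

lemma block_definesD:
  "block_defines L k c e \<phi> P \<Longrightarrow> (\<And>i. length (\<sigma> i) = k) \<Longrightarrow> P \<sigma> = sat L (block_env k c \<sigma> e) \<phi>"
  by (simp add: block_defines_def)

text \<open>\<open>P\<close> and \<open>P'\<close> are defined by the same formula in \<open>M\<close> and in \<open>N\<close>, with the parameters moved by \<open>h\<close>.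
  This one notion, which is closed under the logical operations, serves to show that sets are definable
  and to transfer sentences from \<open>M\<close> to \<open>N\<close>.\<close>

definition uniform ::
  "('f, 'r, 'a) struct \<Rightarrow> ('f, 'r, 'b) struct \<Rightarrow> ('a \<Rightarrow> 'b) \<Rightarrow> nat
     \<Rightarrow> ((nat \<Rightarrow> 'a list) \<Rightarrow> bool) \<Rightarrow> ((nat \<Rightarrow> 'b list) \<Rightarrow> bool) \<Rightarrow> bool" where
  "uniform M N h k P P' \<longleftrightarrow> (\<exists>\<phi> e. block_defines M k undefined e \<phi> P \<and>
     block_defines N k (h undefined) (h \<circ> e) \<phi> P')"

text \<open>The parameters of \<open>M\<close> are written \<open>id \<circ> e\<close> so that both premises are instances of one scheme, with
  parameters \<open>q \<circ> e\<close> for a map \<open>q\<close>, and can be proved together.\<close>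

lemma uniformI:
  assumes "block_defines M k undefined (id \<circ> e) \<phi> P" "block_defines N k (h undefined) (h \<circ> e) \<phi> P'"
  shows "uniform M N h k P P'"
  using assms unfolding uniform_def by auto

lemma uniformE:
  assumes "uniform M N h k P P'"
  obtains \<phi> e where "block_defines M k undefined (id \<circ> e) \<phi> P"
    "block_defines N k (h undefined) (h \<circ> e) \<phi> P'"
  using assms unfolding uniform_def by auto

lemma uniform_cong:
  assumes "uniform M N h k P P'"
    and "\<And>\<sigma>. (\<And>i. length (\<sigma> i) = k) \<Longrightarrow> P \<sigma> = Q \<sigma>"
    and "\<And>\<sigma>. (\<And>i. length (\<sigma> i) = k) \<Longrightarrow> P' \<sigma> = Q' \<sigma>"
  shows "uniform M N h k Q Q'"
  using assms by (simp add: uniform_def block_defines_def)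

lemma uniform_not:
  assumes "uniform M N h k P P'"
  shows "uniform M N h k (\<lambda>\<sigma>. \<not> P \<sigma>) (\<lambda>\<sigma>. \<not> P' \<sigma>)"
proof -
  obtain \<phi> e where "block_defines M k undefined (id \<circ> e) \<phi> P"
    "block_defines N k (h undefined) (h \<circ> e) \<phi> P'" by (rule uniformE[OF assms])
  then show ?thesis
    by (intro uniformI[of M k e "Neg \<phi>"]) (simp_all add: block_defines_def)
qed

lemma uniform_conj:
  fixes M :: "('f, 'r, 'a) struct" and N :: "('f, 'r, 'b) struct" and h :: "'a \<Rightarrow> 'b"
  assumes "uniform M N h k P P'" and "uniform M N h k Q Q'"
  shows "uniform M N h k (\<lambda>\<sigma>. P \<sigma> \<and> Q \<sigma>) (\<lambda>\<sigma>. P' \<sigma> \<and> Q' \<sigma>)"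
proof -
  obtain \<phi> e where 1: "block_defines M k undefined (id \<circ> e) \<phi> P"
    "block_defines N k (h undefined) (h \<circ> e) \<phi> P'" by (rule uniformE[OF assms(1)])
  obtain \<psi> d where 2: "block_defines M k undefined (id \<circ> d) \<psi> Q"
    "block_defines N k (h undefined) (h \<circ> d) \<psi> Q'" by (rule uniformE[OF assms(2)])
  define f where "f v = (if odd v then 2 * v - 1 else v)" for v :: nat
  define g where "g v = (if odd v then 2 * v + 1 else v)" for v :: nat
  define m where "m p = (if even p then e (p div 2) else d (p div 2))" for p :: nat
  have inj: "inj f" "inj g"
    unfolding f_def g_def inj_def by presburger+
  have env: "block_env k c \<sigma> (q \<circ> m) \<circ> f = block_env k c \<sigma> (q \<circ> e)"
      "block_env k c \<sigma> (q \<circ> m) \<circ> g = block_env k c \<sigma> (q \<circ> d)"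
    for c \<sigma> and q :: "'a \<Rightarrow> 'z"
  proof -
    have "(block_env k c \<sigma> (q \<circ> m) \<circ> f) v = block_env k c \<sigma> (q \<circ> e) v
        \<and> (block_env k c \<sigma> (q \<circ> m) \<circ> g) v = block_env k c \<sigma> (q \<circ> d) v" for v
    proof (cases "odd v")
      case True
      then obtain p where "v = 2 * p + 1" by (rule oddE)
      then show ?thesis by (simp add: block_env_def m_def f_def g_def)
    next
      case False
      then show ?thesis by (simp add: block_env_def f_def g_def)
    qed
    then show "block_env k c \<sigma> (q \<circ> m) \<circ> f = block_env k c \<sigma> (q \<circ> e)"
      "block_env k c \<sigma> (q \<circ> m) \<circ> g = block_env k c \<sigma> (q \<circ> d)" by blast+
  qed
  have conj: "block_defines L k c (q \<circ> m) (Conj (ren f \<phi>) (ren g \<psi>)) (\<lambda>\<sigma>. R \<sigma> \<and> S \<sigma>)"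
    if "block_defines L k c (q \<circ> e) \<phi> R" "block_defines L k c (q \<circ> d) \<psi> S"
    for L :: "('f, 'r, 'z) struct" and c R S and q :: "'a \<Rightarrow> 'z"
    using that by (simp add: block_defines_def sat_ren inj env)
  show ?thesis by (rule uniformI[OF conj[OF 1(1) 2(1)] conj[OF 1(2) 2(2)]])
qed

text \<open>Injectivity is what makes a renaming of block variables compatible with bound variables.\<close>

lemma uniform_ren:
  fixes M :: "('f, 'r, 'a) struct" and N :: "('f, 'r, 'b) struct" and h :: "'a \<Rightarrow> 'b"
  assumes "uniform M N h k P P'" and "inj f"
  shows "uniform M N h k (\<lambda>\<sigma>. P (\<lambda>i. \<sigma> (f i))) (\<lambda>\<sigma>. P' (\<lambda>i. \<sigma> (f i)))"
proof -
  obtain \<phi> e where 1: "block_defines M k undefined (id \<circ> e) \<phi> P"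
    "block_defines N k (h undefined) (h \<circ> e) \<phi> P'" by (rule uniformE[OF assms(1)])
  define g where
    "g v = (if odd v \<or> k = 0 then v else 2 * (f (v div 2 div k) * k + v div 2 mod k))" for v :: nat
  have g_block: "g v div 2 div k = f (v div 2 div k)" "g v div 2 mod k = v div 2 mod k"
    if "even v" "k \<noteq> 0" for v
    using that by (auto simp: g_def)
  have g_odd: "odd (g v) = odd v" for v
    by (simp add: g_def)
  have inj: "inj g"
  proof (rule injI)
    fix v w assume eq: "g v = g w"
    have odd: "odd v = odd w" using eq g_odd by metis
    show "v = w"
    proof (cases "odd v \<or> k = 0")
      case True
      then show ?thesis using eq odd by (auto simp: g_def)
    next
      case False
      then have "v div 2 div k = w div 2 div k" "v div 2 mod k = w div 2 mod k"
        using g_block[of v] g_block[of w] eq odd by (simp_all add: inj_eq[OF assms(2)])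
      then have "v div 2 = w div 2" by (metis div_mult_mod_eq)
      then show ?thesis using odd by presburger
    qed
  qed
  have env: "block_env k c \<sigma> d \<circ> g = block_env k c (\<lambda>i. \<sigma> (f i)) d" for c \<sigma> and d :: "nat \<Rightarrow> 'z"
  proof
    fix v show "(block_env k c \<sigma> d \<circ> g) v = block_env k c (\<lambda>i. \<sigma> (f i)) d v"
    proof (cases "odd v \<or> k = 0")
      case True
      then show ?thesis by (auto simp: block_env_def g_def)
    next
      case False
      then show ?thesis using g_block g_odd by (simp add: block_env_def)
    qed
  qed
  show ?thesis
    using 1 by (intro uniformI[of M k e "ren g \<phi>"]) (simp_all add: block_defines_def sat_ren inj env)
qed

text \<open>Quantification in de Bruijn style: the bound tuple is block \<open>0\<close>, and the free blocks are shifted up.\<close>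

lemma uniform_ex:
  fixes M :: "('f, 'r, 'a) struct" and N :: "('f, 'r, 'b) struct" and h :: "'a \<Rightarrow> 'b"
  assumes "uniform M N h k (\<lambda>\<sigma>. P (\<lambda>i. \<sigma> (Suc i)) (\<sigma> 0)) (\<lambda>\<sigma>. P' (\<lambda>i. \<sigma> (Suc i)) (\<sigma> 0))"
  shows "uniform M N h k (\<lambda>\<sigma>. \<exists>x. length x = k \<and> P \<sigma> x) (\<lambda>\<sigma>. \<exists>x. length x = k \<and> P' \<sigma> x)"
proof -
  obtain \<phi> e where 1: "block_defines M k undefined (id \<circ> e) \<phi> (\<lambda>\<sigma>. P (\<lambda>i. \<sigma> (Suc i)) (\<sigma> 0))"
    "block_defines N k (h undefined) (h \<circ> e) \<phi> (\<lambda>\<sigma>. P' (\<lambda>i. \<sigma> (Suc i)) (\<sigma> 0))"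
    by (rule uniformE[OF assms])
  \<comment> \<open>Block 0 is moved to the variables below k and quantified there; then these variables are moved
    among the parameters, whose positions shift by k, and block i + 1 becomes block i.\<close>
  define g where "g v =
    (if odd v then k + v else if v div 2 < k then v div 2 else k + 2 * (v div 2 - k))" for v
  define f where
    "f v = (if v < k then 2 * v + 1 else if odd (v - k) then v + k else v - k)" for v :: nat
  have inj_f: "inj f"
  proof (rule injI)
    have odd: "odd (f v) \<longleftrightarrow> v < k \<or> odd (v - k)" for v
      by (auto simp: f_def)
    fix v w assume eq: "f v = f w"
    show "v = w"
    proof (cases "odd (f v)")
      case False
      then show ?thesis using odd[of v] odd[of w] eq by (auto simp: f_def)
    next
      case True
      then have "odd (f w)" using eq by simp
      with True have "v < k \<or> \<not> v < k \<and> odd (v - k)" "w < k \<or> \<not> w < k \<and> odd (w - k)"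
        using odd by auto
      then show ?thesis using eq by (auto simp: f_def)
    qed
  qed
  have inj_g: "inj g"
  proof (rule injI)
    have g: "g (Suc (2 * q)) = k + Suc (2 * q)"
      "g (2 * q) = (if q < k then q else k + 2 * (q - k))" for q
      by (simp_all add: g_def)
    have neq: "g (2 * p) \<noteq> g (Suc (2 * q))" for p q
    proof (cases "p < k")
      case False
      then have "g (2 * p) = k + 2 * (p - k)" using g(2) by (simp only: if_False)
      then show ?thesis unfolding g(1) by presburger
    qed (simp add: g)
    have even: "p = q" if "g (2 * p) = g (2 * q)" for p q
      using that by (simp add: g split: if_splits)
    have odd: "p = q" if "g (Suc (2 * p)) = g (Suc (2 * q))" for p q
      using that by (simp add: g)
    fix v w assume eq: "g v = g w"
    have parity: "(\<exists>q. u = 2 * q) \<or> (\<exists>q. u = Suc (2 * q))" for u :: nat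
      by (metis oddE evenE Suc_eq_plus1)
    show "v = w"
      using parity[of v] parity[of w]
    proof (elim disjE exE)
      fix p q assume "v = 2 * p" "w = Suc (2 * q)"
      then show ?thesis using eq neq[of p q] by simp
    next
      fix p q assume "v = Suc (2 * q)" "w = 2 * p"
      then show ?thesis using eq neq[of p q] by simp
    next
      fix p q assume "v = 2 * p" "w = 2 * q"
      then show ?thesis using eq even[of p q] by simp
    next
      fix p q assume "v = Suc (2 * p)" "w = Suc (2 * q)"
      then show ?thesis using eq odd[of p q] by simp
    qed
  qed
  note inj = inj_f inj_g
  have env: "tuple_env k x (block_env k c \<sigma> (\<lambda>p. d (p - k)) \<circ> f) \<circ> g
               = block_env k c (case_nat x \<sigma>) d"
    if "length x = k" for x c \<sigma> and d :: "nat \<Rightarrow> 'z"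
  proof
    fix v show "(tuple_env k x (block_env k c \<sigma> (\<lambda>p. d (p - k)) \<circ> f) \<circ> g) v
                  = block_env k c (case_nat x \<sigma>) d v"
    proof (cases "odd v")
      case True
      then have "g v = k + v" "f (k + v) = v + 2 * k" by (simp_all add: g_def f_def)
      moreover have "(v + 2 * k) div 2 - k = v div 2" by simp
      ultimately show ?thesis using True by (simp add: tuple_env_def block_env_def)
    next
      case even: False
      show ?thesis
      proof (cases "v div 2 < k")
        case True
        then show ?thesis using even by (simp add: tuple_env_def block_env_def g_def)
      next
        case False
        then have g: "g v = k + 2 * (v div 2 - k)" "f (g v) = 2 * (v div 2 - k)"
          using even by (simp_all add: g_def f_def)
        show ?thesis
        proof (cases "k = 0")
          case True
          then show ?thesis using g even by (simp add: tuple_env_def block_env_def)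
        next
          case k: False
          have "v div 2 div k = Suc ((v div 2 - k) div k)" "v div 2 mod k = (v div 2 - k) mod k"
            using False k by (simp_all add: le_div_geq le_mod_geq)
          then show ?thesis using g even k by (simp add: tuple_env_def block_env_def)
        qed
      qed
    qed
  qed
  let ?\<psi> = "ren f (foldr Ex [0..<k] (ren g \<phi>))"
  have ex: "block_defines L k c (q \<circ> (\<lambda>p. e (p - k))) ?\<psi> (\<lambda>\<sigma>. \<exists>x. length x = k \<and> R \<sigma> x)"
    if R: "block_defines L k c (q \<circ> e) \<phi> (\<lambda>\<sigma>. R (\<lambda>i. \<sigma> (Suc i)) (\<sigma> 0))"
    for L :: "('f, 'r, 'z) struct" and c R and q :: "'a \<Rightarrow> 'z"
  proof (rule block_definesI)
    fix \<sigma> :: "nat \<Rightarrow> 'z list" assume \<sigma>: "\<And>i. length (\<sigma> i) = k"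
    have shift: "q \<circ> (\<lambda>p. e (p - k)) = (\<lambda>p. (q \<circ> e) (p - k))" by (simp add: o_def)
    have "sat L (block_env k c \<sigma> (q \<circ> (\<lambda>p. e (p - k)))) ?\<psi> \<longleftrightarrow>
        (\<exists>x. length x = k \<and> sat L (block_env k c (case_nat x \<sigma>) (q \<circ> e)) \<phi>)"
      by (simp only: shift sat_ren inj sat_exs env cong: conj_cong)
    also have "\<dots> \<longleftrightarrow> (\<exists>x. length x = k \<and> R \<sigma> x)"
    proof (rule ex_cong1, rule conj_cong[OF refl])
      fix x :: "'z list" assume "length x = k"
      then have "length (case_nat x \<sigma> i) = k" for i using \<sigma> by (cases i) auto
      from block_definesD[OF R, of "case_nat x \<sigma>", OF this]
      show "sat L (block_env k c (case_nat x \<sigma>) (q \<circ> e)) \<phi> = R \<sigma> x" by simp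
    qed
    finally show "(\<exists>x. length x = k \<and> R \<sigma> x) = sat L (block_env k c \<sigma> (q \<circ> (\<lambda>p. e (p - k)))) ?\<psi>" ..
  qed
  show ?thesis by (rule uniformI[OF ex[OF 1(1)] ex[OF 1(2)]])
qed

lemma length_concat_blocks:
  assumes "\<And>i. length (\<sigma> i) = k"
  shows "length (concat (map \<sigma> is)) = length is * k"
  using assms by (induction "is") auto

lemma nth_concat_blocks:
  assumes "\<And>i. length (\<sigma> i) = k" and "v < length is * k"
  shows "concat (map \<sigma> is) ! v = \<sigma> (is ! (v div k)) ! (v mod k)"
  using assms(2)
proof (induction "is" arbitrary: v)
  case (Cons i "is")
  show ?case
  proof (cases "v < k")
    case True
    then show ?thesis by (simp add: nth_append assms(1))
  next
    case False
    moreover have "k > 0" using Cons.prems by (cases k) auto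
    ultimately have "v div k = Suc ((v - k) div k)" "v mod k = (v - k) mod k" "v - k < length is * k"
      using Cons.prems by (auto simp: le_div_geq le_mod_geq)
    then show ?thesis using False Cons.IH by (simp add: nth_append assms(1))
  qed
qed simp

lemma uniform_atom:
  fixes M :: "('f, 'r, 'a) struct" and N :: "('f, 'r, 'b) struct" and h :: "'a \<Rightarrow> 'b"
  assumes emb: "elementary_embedding M N h"
    and X: "definable M (m * k) X" and "is": "distinct is" "length is = m"
  shows "uniform M N h k (\<lambda>\<sigma>. concat (map \<sigma> is) \<in> X)
           (\<lambda>\<sigma>. concat (map \<sigma> is) \<in> extension M N h (m * k) X)"
proof -
  obtain \<phi> e where X_eq: "X = defset M (m * k) \<phi> e"
    using X unfolding definable_def by blast
  have ext: "extension M N h (m * k) X = defset N (m * k) \<phi> (h \<circ> e)"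
    unfolding X_eq by (rule extension_defset[OF emb])
  define f where
    "f v = (if v < m * k then 2 * (is ! (v div k) * k + v mod k) else 2 * v + 1)" for v
  have pos: "k > 0" "v div k < m" if "v < m * k" for v
    using that by (auto simp: less_mult_imp_div_less intro: gr0I)
  have inj: "inj f"
  proof (rule injI)
    fix v w assume eq: "f v = f w"
    have parity: "(v < m * k) = (w < m * k)"
      using arg_cong[OF eq, of even] by (simp add: f_def split: if_splits)
    show "v = w"
    proof (cases "v < m * k")
      case True
      then have w: "w < m * k"
using parity by simp
      have "is ! (v div k) * k + v mod k = is ! (w div k) * k + w mod k"
        using eq True w by (simp add: f_def)
      then have "(is ! (v div k) * k + v mod k) div k = (is ! (w div k) * k + w mod k) div k"
         "(is ! (v div k) * k + v mod k) mod k = (is ! (w div k) * k + w mod k) mod k" by simp_all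
      then have "is ! (v div k) = is ! (w div k)" "v mod k = w mod k"
        using pos(1)[OF True] by simp_all
      moreover from this(1) have "v div k = w div k"
        using pos(2)[OF True] pos(2)[OF w] "is" by (simp add: nth_eq_iff_index_eq)
      ultimately show ?thesis by (metis div_mult_mod_eq)
    next
      case False
      then have "\<not> w < m * k"
using parity by simp
      then show ?thesis using eq False by (simp add: f_def)
    qed
  qed
  have env: "block_env k c \<sigma> d \<circ> f = tuple_env (m * k) (concat (map \<sigma> is)) d"
    if "\<And>i. length (\<sigma> i) = k" for \<sigma> c and d :: "nat \<Rightarrow> 'z"
  proof
    fix v show "(block_env k c \<sigma> d \<circ> f) v = tuple_env (m * k) (concat (map \<sigma> is)) d v"
      using pos[of v] nth_concat_blocks[of \<sigma> k v "is"] that "is"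
      by (auto simp: tuple_env_def block_env_def f_def)
  qed
  show ?thesis
    by (intro uniformI[of M k e "ren f \<phi>"] block_definesI)
       (simp_all add: ext, simp_all add: X_eq defset_def sat_ren[OF inj] length_concat_blocks "is" env)
qed

text \<open>Only blocks below \<open>m\<close> are left free; all others are set to the constant tuple \<open>\<delta>\<close>, whose
  coordinates become parameters.\<close>

lemma uniform_definable:
  assumes "uniform M N h k P P'" and \<delta>: "length \<delta> = k"
  shows "definable M (m * k) {concat (map \<sigma> [0..<m]) | \<sigma>.
           P \<sigma> \<and> (\<forall>i. length (\<sigma> i) = k) \<and> (\<forall>i\<ge>m. \<sigma> i = \<delta>)}" (is "definable M _ ?X")
proof -
  obtain \<phi> e where P: "block_defines M k undefined e \<phi> P"
    using assms(1) unfolding uniform_def by blast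
  define f where "f v = (if even v \<and> v div 2 < m * k then v div 2 else m * k + v)" for v
  define d where "d v = (if odd (v - m * k) then e ((v - m * k) div 2)
      else if k = 0 then undefined else \<delta> ! ((v - m * k) div 2 mod k))" for v
  have inj: "inj f"
    unfolding f_def by (rule injI) (auto split: if_splits elim!: evenE)
  have env: "tuple_env (m * k) (concat (map \<sigma> [0..<m])) d \<circ> f = block_env k undefined \<sigma> e"
    if \<sigma>: "\<And>i. length (\<sigma> i) = k" "\<And>i. i \<ge> m \<Longrightarrow> \<sigma> i = \<delta>" for \<sigma>
  proof
    fix v show "(tuple_env (m * k) (concat (map \<sigma> [0..<m])) d \<circ> f) v = block_env k undefined \<sigma> e v"
    proof (cases "odd v")
      case True
      then show ?thesis by (simp add: tuple_env_def block_env_def f_def d_def)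
    next
      case even: False
      show ?thesis
      proof (cases "v div 2 < m * k")
        case True
        then have "k > 0" "v div 2 div k < m"
          by (auto simp: less_mult_imp_div_less intro: gr0I)
        then show ?thesis
          using even True nth_concat_blocks[of \<sigma> k "v div 2" "[0..<m]"] \<sigma>(1)
          by (simp add: tuple_env_def block_env_def f_def)
      next
        case False
        have "\<sigma> (v div 2 div k) ! (v div 2 mod k) = \<delta> ! (v div 2 mod k)" if "k > 0"
          using that False \<delta> \<sigma>(2)[of "v div 2 div k"] by (simp add: less_eq_div_iff_mult_less_eq)
        then show ?thesis
          using even False by (simp add: tuple_env_def block_env_def f_def d_def)
      qed
    qed
  qed
  have split: "\<exists>\<sigma>. xs = concat (map \<sigma> [0..<m]) \<and> (\<forall>i. length (\<sigma> i) = k) \<and>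
      (\<forall>i\<ge>m. \<sigma> i = \<delta>)" if "length xs = m * k" for xs
  proof -
    define \<sigma> where
      "\<sigma> i = (if i < m then take k (drop (i * k) xs) else \<delta>)" for i
    have len: "length (\<sigma> i) = k" for i
    proof (cases "i < m")
      case True
      then have "Suc i * k \<le> m * k" by (intro mult_right_mono) auto
      then show ?thesis using True that by (simp add: \<sigma>_def)
    qed (simp add: \<sigma>_def \<delta>)
    have "xs = concat (map \<sigma> [0..<m])"
    proof (rule nth_equalityI)
      show "length xs = length (concat (map \<sigma> [0..<m]))"
        using that length_concat_blocks[of \<sigma> k "[0..<m]"] len by simp
      fix v assume "v < length xs"
      then have v: "v < m * k" using that by simp
      then have "v div k < m" "k > 0" by (auto simp: less_mult_imp_div_less intro: gr0I)
      then show "xs ! v = concat (map \<sigma> [0..<m]) ! v"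
        using v that nth_concat_blocks[of \<sigma> k v "[0..<m]"] len
        by (simp add: \<sigma>_def mult.commute)
    qed
    then show ?thesis using len by (intro exI[of _ \<sigma>]) (simp add: \<sigma>_def)
  qed
  have sat: "concat (map \<sigma> [0..<m]) \<in> defset M (m * k) (ren f \<phi>) d \<longleftrightarrow> P \<sigma>"
    if "\<forall>i. length (\<sigma> i) = k" "\<forall>i\<ge>m. \<sigma> i = \<delta>" for \<sigma>
    using that block_definesD[OF P, of \<sigma>] env[of \<sigma>] by (simp add: defset_def sat_ren inj length_concat_blocks)
  have "?X = defset M (m * k) (ren f \<phi>) d" (is "_ = ?D")
  proof (intro equalityI subsetI)
    fix xs assume "xs \<in> ?X"
    then show "xs \<in> ?D" using sat by blast
  next
    fix xs assume xs: "xs \<in> ?D"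
    then obtain \<sigma> where "xs = concat (map \<sigma> [0..<m])" "\<forall>i. length (\<sigma> i) = k" "\<forall>i\<ge>m. \<sigma> i = \<delta>"
      using split[of xs] by (auto simp: defset_def)
    then show "xs \<in> ?X" using xs sat by blast
  qed
  then show ?thesis unfolding definable_def by blast
qed

lemma uniform_transfer:
  assumes emb: "elementary_embedding M N h" and "uniform M N h k P P'"
    and len: "\<And>i. length (\<sigma> i) = k"
  shows "P \<sigma> \<longleftrightarrow> P' (\<lambda>i. map h (\<sigma> i))"
proof -
  obtain \<phi> e where 1: "block_defines M k undefined (id \<circ> e) \<phi> P"
    "block_defines N k (h undefined) (h \<circ> e) \<phi> P'" by (rule uniformE[OF assms(2)])
  have "h \<circ> block_env k undefined \<sigma> (id \<circ> e) = block_env k (h undefined) (\<lambda>i. map h (\<sigma> i)) (h \<circ> e)"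
    by (rule ext) (auto simp: block_env_def len)
  moreover have "P \<sigma> = sat M (block_env k undefined \<sigma> (id \<circ> e)) \<phi>"
    "P' (\<lambda>i. map h (\<sigma> i)) = sat N (block_env k (h undefined) (\<lambda>i. map h (\<sigma> i)) (h \<circ> e)) \<phi>"
    by (rule block_definesD[OF 1(1)], rule len) (rule block_definesD[OF 1(2)], simp add: len)
  moreover have "sat M (block_env k undefined \<sigma> (id \<circ> e)) \<phi>
      = sat N (h \<circ> block_env k undefined \<sigma> (id \<circ> e)) \<phi>"
    using emb unfolding elementary_embedding_def by blast
  ultimately show ?thesis by (simp only:)
qed

lemma uniform_true: "uniform M N h k (\<lambda>_. True) (\<lambda>_. True)"
  by (rule uniformI[where \<phi> = "Equal (Var 0) (Var 0)" and e = "\<lambda>_. undefined"])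
    (simp_all add: block_defines_def)


lemma uniform_imp:
  assumes "uniform M N h k P P'" and "uniform M N h k Q Q'"
  shows "uniform M N h k (\<lambda>\<sigma>. P \<sigma> \<longrightarrow> Q \<sigma>) (\<lambda>\<sigma>. P' \<sigma> \<longrightarrow> Q' \<sigma>)"
  using uniform_not[OF uniform_conj[OF assms(1) uniform_not[OF assms(2)]]] by simp

lemma uniform_iff:
  assumes "uniform M N h k P P'" and "uniform M N h k Q Q'"
  shows "uniform M N h k (\<lambda>\<sigma>. P \<sigma> \<longleftrightarrow> Q \<sigma>) (\<lambda>\<sigma>. P' \<sigma> \<longleftrightarrow> Q' \<sigma>)"
  unfolding iff_conv_conj_imp by (intro uniform_conj uniform_imp assms)

lemma uniform_mem:
  assumes "elementary_embedding M N h" and "definable M k X"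
  shows "uniform M N h k (\<lambda>\<sigma>. \<sigma> i \<in> X) (\<lambda>\<sigma>. \<sigma> i \<in> extension M N h k X)"
  using uniform_atom[OF assms(1), of 1 k X "[i]"] assms(2) by simp

lemma definable_length: "definable M m X \<Longrightarrow> x \<in> X \<Longrightarrow> length x = m"
  by (auto simp: definable_def defset_def)

lemma extension_length: "x \<in> extension M N h m X \<Longrightarrow> length x = m"
  by (auto simp: extension_def defset_def)

lemma uniform_bex:
  assumes "elementary_embedding M N h" and "definable M k X"
    and "uniform M N h k (\<lambda>\<sigma>. P (\<lambda>i. \<sigma> (Suc i)) (\<sigma> 0)) (\<lambda>\<sigma>. P' (\<lambda>i. \<sigma> (Suc i)) (\<sigma> 0))"
  shows "uniform M N h k (\<lambda>\<sigma>. \<exists>x\<in>X. P \<sigma> x) (\<lambda>\<sigma>. \<exists>x\<in>extension M N h k X. P' \<sigma> x)"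
proof -
  have "uniform M N h k (\<lambda>\<sigma>. \<exists>x. length x = k \<and> (x \<in> X \<and> P \<sigma> x))
      (\<lambda>\<sigma>. \<exists>x. length x = k \<and> (x \<in> extension M N h k X \<and> P' \<sigma> x))"
    by (rule uniform_ex) (intro uniform_conj uniform_mem assms)
  then show ?thesis
    by (rule uniform_cong)
      (use definable_length[OF assms(2)] extension_length[of _ M N h k X] in blast)+
qed

lemma uniform_ball:
  assumes "elementary_embedding M N h" and "definable M k X"
    and "uniform M N h k (\<lambda>\<sigma>. P (\<lambda>i. \<sigma> (Suc i)) (\<sigma> 0)) (\<lambda>\<sigma>. P' (\<lambda>i. \<sigma> (Suc i)) (\<sigma> 0))"
  shows "uniform M N h k (\<lambda>\<sigma>. \<forall>x\<in>X. P \<sigma> x) (\<lambda>\<sigma>. \<forall>x\<in>extension M N h k X. P' \<sigma> x)"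
proof -
  have "uniform M N h k (\<lambda>\<sigma>. \<not> (\<exists>x\<in>X. \<not> P \<sigma> x)) (\<lambda>\<sigma>. \<not> (\<exists>x\<in>extension M N h k X. \<not> P' \<sigma> x))"
    by (intro uniform_not uniform_bex assms)
  then show ?thesis by simp
qed

text \<open>In this form a binary relation on tuples fits the extension operator on equivalence relations that
  underlies the rank of a quotient.\<close>

definition definable_rel :: "('f, 'r, 'a) struct \<Rightarrow> nat \<Rightarrow> ('a list \<times> 'a list) set \<Rightarrow> bool" where
  "definable_rel M k R \<longleftrightarrow> (\<forall>(x, y) \<in> R. length x = k \<and> length y = k) \<and>
     definable M (2 * k) {x @ y | x y. (x, y) \<in> R}"

lemma uniform_rel:
  assumes emb: "elementary_embedding M N h" and R: "definable_rel M k R" and "i \<noteq> j"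
  shows "uniform M N h k (\<lambda>\<sigma>. (\<sigma> i, \<sigma> j) \<in> R) (\<lambda>\<sigma>. (\<sigma> i, \<sigma> j) \<in> extension_rel M N h k R)"
proof -
  let ?X = "{x @ y | x y. (x, y) \<in> R}"
  have X: "definable M (2 * k) ?X" using R unfolding definable_rel_def by blast
  have "uniform M N h k (\<lambda>\<sigma>. \<sigma> i @ \<sigma> j \<in> ?X) (\<lambda>\<sigma>. \<sigma> i @ \<sigma> j \<in> extension M N h (2 * k) ?X)"
    using uniform_atom[OF emb X, of "[i, j]"] \<open>i \<noteq> j\<close> by simp
  moreover have "(x @ y \<in> ?X) \<longleftrightarrow> (x, y) \<in> R" if "length x = k" "length y = k" for x y
  proof
    assume "x @ y \<in> ?X"
    then obtain u v where "x @ y = u @ v" "(u, v) \<in> R" by blast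
    moreover from this have "length u = k" using R unfolding definable_rel_def by blast
    ultimately show "(x, y) \<in> R" using that by simp
  qed blast
  ultimately show ?thesis
    by (rule uniform_cong) (auto simp: extension_rel_def)
qed

lemma uniform_definable_set:
  assumes P: "uniform M N h k P P'" and \<delta>: "length \<delta> = k"
    and X: "\<And>x. x \<in> X \<longleftrightarrow> length x = k \<and> P (case_nat x (\<lambda>_. \<delta>))"
  shows "definable M k X"
proof -
  have "X = {concat (map \<sigma> [0..<1]) | \<sigma>. P \<sigma> \<and> (\<forall>i. length (\<sigma> i) = k) \<and> (\<forall>i\<ge>1. \<sigma> i = \<delta>)}"
    (is "_ = ?R")
  proof (intro equalityI subsetI)
    fix x assume "x \<in> X"
    then have "length x = k" "P (case_nat x (\<lambda>_. \<delta>))" using X[of x] by blast+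
    then show "x \<in> ?R"
      using \<delta> by (auto intro!: exI[of _ "case_nat x (\<lambda>_. \<delta>)"] split: nat.splits)
  next
    fix x assume "x \<in> ?R"
    then obtain \<sigma> where \<sigma>: "x = \<sigma> 0" "P \<sigma>" "\<forall>i. length (\<sigma> i) = k" "\<forall>i\<ge>1. \<sigma> i = \<delta>" by auto
    have "\<sigma> = case_nat (\<sigma> 0) (\<lambda>_. \<delta>)" using \<sigma>(4) by (auto simp: fun_eq_iff split: nat.splits)
    with \<sigma>(2) have "P (case_nat x (\<lambda>_. \<delta>))" unfolding \<sigma>(1) by (rule back_subst)
    then show "x \<in> X" using X[of x] \<sigma>(1,3) by blast
  qed
  then show ?thesis
    using uniform_definable[OF P \<delta>, of 1] by simp
qed

lemma uniform_definable_rel: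
  assumes P: "uniform M N h k P P'" and \<delta>: "length \<delta> = k"
    and R: "\<And>x y. (x, y) \<in> R \<longleftrightarrow>
      length x = k \<and> length y = k \<and> P (case_nat x (case_nat y (\<lambda>_. \<delta>)))"
  shows "definable_rel M k R"
proof -
  have "{x @ y | x y. (x, y) \<in> R} =
      {concat (map \<sigma> [0..<2]) | \<sigma>. P \<sigma> \<and> (\<forall>i. length (\<sigma> i) = k) \<and> (\<forall>i\<ge>2. \<sigma> i = \<delta>)}"
    (is "?L = ?R")
  proof (intro equalityI subsetI)
    fix z assume "z \<in> ?L"
    then obtain x y where z: "z = x @ y" "(x, y) \<in> R" by blast
    have "length (case_nat x (case_nat y (\<lambda>_. \<delta>)) i) = k" for i
      using z(2) R \<delta> by (auto split: nat.splits)
    moreover have "case_nat x (case_nat y (\<lambda>_. \<delta>)) i = \<delta>" if "i \<ge> 2" for i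
      using that by (auto split: nat.splits)
    moreover have "z = concat (map (case_nat x (case_nat y (\<lambda>_. \<delta>))) [0..<2])"
      using z(1) by (simp add: numeral_2_eq_2)
    ultimately show "z \<in> ?R" using z(2) R by blast
  next
    fix z assume "z \<in> ?R"
    then obtain \<sigma> where z: "z = concat (map \<sigma> [0..<2])" "P \<sigma>" "\<forall>i. length (\<sigma> i) = k" "\<forall>i\<ge>2. \<sigma> i = \<delta>"
      by blast
    have "\<sigma> = case_nat (\<sigma> 0) (case_nat (\<sigma> 1) (\<lambda>_. \<delta>))"
      using z(4) by (auto simp: fun_eq_iff split: nat.splits)
    then have "(\<sigma> 0, \<sigma> 1) \<in> R" using R[of "\<sigma> 0" "\<sigma> 1"] z(2,3) by simp
    moreover have "z = \<sigma> 0 @ \<sigma> 1" using z(1) by (simp add: numeral_2_eq_2)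
    ultimately show "z \<in> ?L" by blast
  qed
  then show ?thesis
    using uniform_definable[OF P \<delta>, of 2] R unfolding definable_rel_def by auto
qed

lemma equality_formula:
  obtains \<phi> :: "('f, 'r) form" where
    "\<And>(M :: ('f, 'r, 'a) struct) e. sat M e \<phi> \<longleftrightarrow> (\<forall>j<k. e j = e (m + j))"
    "\<And>(N :: ('f, 'r, 'b) struct) e. sat N e \<phi> \<longleftrightarrow> (\<forall>j<k. e j = e (m + j))"
proof (induction k arbitrary: thesis)
  case 0
  show ?case by (rule 0[of "Equal (Var 0) (Var 0)"]) simp_all
next
  case (Suc k)
  show ?case
  proof (rule Suc.IH)
    fix \<phi> :: "('f, 'r) form"
    assume "\<And>(M :: ('f, 'r, 'a) struct) e. sat M e \<phi> \<longleftrightarrow> (\<forall>j<k. e j = e (m + j))"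
      "\<And>(N :: ('f, 'r, 'b) struct) e. sat N e \<phi> \<longleftrightarrow> (\<forall>j<k. e j = e (m + j))"
    then show ?thesis
      by (intro Suc.prems[of "Conj \<phi> (Equal (Var k) (Var (m + k)))"]) (auto simp: less_Suc_eq)
  qed
qed

lemma definable_singleton:
  fixes M :: "('f, 'r, 'a) struct"
  assumes "length c = k"
  shows "definable M k {c}"
proof -
  obtain \<phi> :: "('f, 'r) form" where \<phi>:
    "\<And>(M :: ('f, 'r, 'a) struct) e. sat M e \<phi> \<longleftrightarrow> (\<forall>j<k. e j = e (k + j))"
    by (rule equality_formula[of k k]) (rule that, assumption+)
  have "{c} = defset M k \<phi> (\<lambda>v. c ! (v - k))"
    using assms by (auto simp: defset_def \<phi> tuple_env_def intro: nth_equalityI)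
  then show ?thesis unfolding definable_def by blast
qed

lemma definable_rel_Id:
  fixes M :: "('f, 'r, 'a) struct" and N :: "('f, 'r, 'b) struct" and h :: "'a \<Rightarrow> 'b"
  assumes "elementary_embedding M N h"
  shows "definable_rel M k {(x, x) | x. length x = k}"
    and "extension_rel M N h k {(x, x) | x. length x = k} = {(x, x) | x. length x = k}"
proof -
  obtain \<phi> :: "('f, 'r) form" where \<phi>:
    "\<And>(M :: ('f, 'r, 'a) struct) e. sat M e \<phi> \<longleftrightarrow> (\<forall>j<k. e j = e (k + j))"
    "\<And>(N :: ('f, 'r, 'b) struct) e. sat N e \<phi> \<longleftrightarrow> (\<forall>j<k. e j = e (k + j))"
    by (rule equality_formula[of k k]) (rule that, assumption+)
  have diagonal: "{x @ x | x :: 'z list. length x = k}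
      = {z. length z = 2 * k \<and> (\<forall>j<k. tuple_env (2 * k) z e j = tuple_env (2 * k) z e (k + j))}" for e
  proof (intro equalityI subsetI)
    fix z :: "'z list"
    assume "z \<in> {z. length z = 2 * k \<and> (\<forall>j<k. tuple_env (2 * k) z e j = tuple_env (2 * k) z e (k + j))}"
    then have "length z = 2 * k" and "\<forall>j<k. z ! j = z ! (k + j)"
      by (auto simp: tuple_env_def)
    then have "drop k z = take k z" by (intro nth_equalityI) auto
    then have "z = take k z @ take k z" by (metis append_take_drop_id)
    then show "z \<in> {x @ x | x. length x = k}" using \<open>length z = 2 * k\<close>
      by (auto intro!: exI[of _ "take k z"])
  qed (auto simp: tuple_env_def nth_append)
  have M: "{x @ y | x y :: 'a list. (x, y) \<in> {(x, x) | x. length x = k}}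
      = defset M (2 * k) \<phi> (\<lambda>_. undefined)"
    using diagonal[of "\<lambda>_. undefined :: 'a"] by (simp add: defset_def \<phi>)
  show "definable_rel M k {(x, x) | x. length x = k}"
    using M unfolding definable_rel_def definable_def by auto
  have "extension M N h (2 * k) {x @ y | x y :: 'a list. (x, y) \<in> {(x, x) | x. length x = k}}
      = {x @ x | x :: 'b list. length x = k}"
    using diagonal[of "h \<circ> (\<lambda>_. undefined :: 'a)"]
    by (simp only: M extension_defset[OF assms]) (simp add: defset_def \<phi>)
  then show "extension_rel M N h k {(x, x) | x. length x = k} = {(x, x) | x. length x = k}"
    unfolding extension_rel_def by auto
qed

lemma uniform_eq:
  assumes emb: "elementary_embedding M N h" and "i \<noteq> j"
  shows "uniform M N h k (\<lambda>\<sigma>. \<sigma> i = \<sigma> j) (\<lambda>\<sigma>. \<sigma> i = \<sigma> j)"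
  by (rule uniform_cong[OF uniform_rel[OF emb definable_rel_Id(1)[OF emb] \<open>i \<noteq> j\<close>]])
    (auto simp: definable_rel_Id(2)[OF emb])

lemma elementary_embedding_id: "elementary_embedding M M id"
  by (simp add: elementary_embedding_def)

section \<open>Definable relations on a group\<close>

locale group_definable =
  fixes M :: "('f, 'r, 'a) struct" and k :: nat and G :: "'a list monoid" (structure)
  assumes definable_group: "definable_group M k G"
begin

sublocale group G
  using definable_group by (simp add: definable_group_def)

lemma definable_carrier: "definable M k (carrier G)"
  using definable_group by (simp add: definable_group_def)

lemma carrier_length: "x \<in> carrier G \<Longrightarrow> length x = k"
  by (rule definable_length[OF definable_carrier])

text \<open>Truth of \<open>P\<close> matters only on tuples from the group, so that quantifiers range over the group and terms
  built from the group operations have definable graphs.  The rules below decide definability by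
  following the syntax of \<open>P\<close>; binders are in de Bruijn style, as above.\<close>

definition dfn :: "((nat \<Rightarrow> 'a list) \<Rightarrow> bool) \<Rightarrow> bool" where
  "dfn P \<longleftrightarrow> (\<exists>Q Q'. uniform M M id k Q Q' \<and> (\<forall>\<sigma>. (\<forall>i. \<sigma> i \<in> carrier G) \<longrightarrow> P \<sigma> = Q \<sigma>))"

definition dfn_term :: "((nat \<Rightarrow> 'a list) \<Rightarrow> 'a list) \<Rightarrow> bool" where
  "dfn_term t \<longleftrightarrow> (\<forall>\<sigma>. (\<forall>i. \<sigma> i \<in> carrier G) \<longrightarrow> t \<sigma> \<in> carrier G) \<and>
     dfn (\<lambda>\<sigma>. \<sigma> 0 = t (\<lambda>i. \<sigma> (Suc i)))"

lemma dfn_uniform: "uniform M M id k P P' \<Longrightarrow> dfn P"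
  unfolding dfn_def by blast

lemma dfn_cong:
  assumes "dfn P" and "\<And>\<sigma>. (\<And>i. \<sigma> i \<in> carrier G) \<Longrightarrow> P \<sigma> = Q \<sigma>"
  shows "dfn Q"
  using assms unfolding dfn_def by metis

lemma dfn_not: "dfn P \<Longrightarrow> dfn (\<lambda>\<sigma>. \<not> P \<sigma>)"
  unfolding dfn_def using uniform_not[of M M id k] by metis

lemma dfn_conj:
  assumes "dfn P" and "dfn Q"
  shows "dfn (\<lambda>\<sigma>. P \<sigma> \<and> Q \<sigma>)"
proof -
  obtain P1 P' where P: "uniform M M id k P1 P'" "\<forall>\<sigma>. (\<forall>i. \<sigma> i \<in> carrier G) \<longrightarrow> P \<sigma> = P1 \<sigma>"
    using assms(1) unfolding dfn_def by blast
  obtain Q1 Q' where Q: "uniform M M id k Q1 Q'" "\<forall>\<sigma>. (\<forall>i. \<sigma> i \<in> carrier G) \<longrightarrow> Q \<sigma> = Q1 \<sigma>"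
    using assms(2) unfolding dfn_def by blast
  show ?thesis
    by (rule dfn_cong[OF dfn_uniform[OF uniform_conj[OF P(1) Q(1)]]]) (use P(2) Q(2) in auto)
qed

lemma dfn_imp: "dfn P \<Longrightarrow> dfn Q \<Longrightarrow> dfn (\<lambda>\<sigma>. P \<sigma> \<longrightarrow> Q \<sigma>)"
  using dfn_not[OF dfn_conj[OF _ dfn_not]] by simp

lemma dfn_ren:
  assumes "dfn P" and "inj f"
  shows "dfn (\<lambda>\<sigma>. P (\<lambda>i. \<sigma> (f i)))"
proof -
  obtain P1 P' where P: "uniform M M id k P1 P'" "\<forall>\<sigma>. (\<forall>i. \<sigma> i \<in> carrier G) \<longrightarrow> P \<sigma> = P1 \<sigma>"
    using assms(1) unfolding dfn_def by blast
  show ?thesis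
    by (rule dfn_cong[OF dfn_uniform[OF uniform_ren[OF P(1) assms(2)]]]) (use P(2) in auto)
qed

lemma dfn_ex:
  assumes "dfn (\<lambda>\<sigma>. P (\<lambda>i. \<sigma> (Suc i)) (\<sigma> 0))"
  shows "dfn (\<lambda>\<sigma>. \<exists>x\<in>carrier G. P \<sigma> x)"
proof -
  obtain Q Q' where Q: "uniform M M id k Q Q'"
      "\<forall>\<sigma>. (\<forall>i. \<sigma> i \<in> carrier G) \<longrightarrow> P (\<lambda>i. \<sigma> (Suc i)) (\<sigma> 0) = Q \<sigma>"
    using assms(1) unfolding dfn_def by blast
  have "case_nat (\<sigma> 0) (\<lambda>i. \<sigma> (Suc i)) = \<sigma>" for \<sigma> :: "nat \<Rightarrow> 'a list"
    by (auto simp: fun_eq_iff split: nat.splits)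
  then have "uniform M M id k (\<lambda>\<sigma>. \<exists>x\<in>carrier G. Q (case_nat x \<sigma>))
      (\<lambda>\<sigma>. \<exists>x\<in>extension M M id k (carrier G). Q' (case_nat x \<sigma>))"
    using Q(1) by (intro uniform_bex[where P = "\<lambda>\<sigma> x. Q (case_nat x \<sigma>)" and P' = "\<lambda>\<sigma> x. Q' (case_nat x \<sigma>)"]
        elementary_embedding_id definable_carrier) simp
  then show ?thesis
  proof (rule dfn_cong[OF dfn_uniform])
    fix \<sigma> :: "nat \<Rightarrow> 'a list" assume \<sigma>: "\<And>i. \<sigma> i \<in> carrier G"
    have "Q (case_nat x \<sigma>) = P \<sigma> x" if "x \<in> carrier G" for x
      using Q(2)[rule_format, of "case_nat x \<sigma>"] that \<sigma> by (simp split: nat.splits)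
    then show "(\<exists>x\<in>carrier G. Q (case_nat x \<sigma>)) = (\<exists>x\<in>carrier G. P \<sigma> x)" by blast
  qed
qed

lemma dfn_all:
  assumes "dfn (\<lambda>\<sigma>. P (\<lambda>i. \<sigma> (Suc i)) (\<sigma> 0))"
  shows "dfn (\<lambda>\<sigma>. \<forall>x\<in>carrier G. P \<sigma> x)"
proof -
  have "dfn (\<lambda>\<sigma>. \<not> (\<exists>x\<in>carrier G. \<not> P \<sigma> x))"
    by (intro dfn_not dfn_ex assms)
  then show ?thesis by simp
qed

lemma dfn_term_closed: "dfn_term t \<Longrightarrow> (\<And>i. \<sigma> i \<in> carrier G) \<Longrightarrow> t \<sigma> \<in> carrier G"
  unfolding dfn_term_def by blast

lemma dfn_term_ren:
  assumes "dfn_term t" and "inj f"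
  shows "dfn_term (\<lambda>\<sigma>. t (\<lambda>i. \<sigma> (f i)))"
proof -
  have "dfn (\<lambda>\<sigma>. \<sigma> 0 = t (\<lambda>i. \<sigma> (Suc i)))"
    using assms(1) unfolding dfn_term_def by blast
  moreover have "inj (case_nat 0 (\<lambda>i. Suc (f i)))"
    using assms(2) by (auto simp: inj_def split: nat.splits)
  ultimately have "dfn (\<lambda>\<sigma>. \<sigma> (case_nat 0 (\<lambda>i. Suc (f i)) 0) = t (\<lambda>i. \<sigma> (case_nat 0 (\<lambda>i. Suc (f i)) (Suc i))))"
    by (rule dfn_ren)
  then show ?thesis using assms(1) unfolding dfn_term_def by simp
qed

lemma dfn_subst:
  assumes P: "dfn (\<lambda>\<sigma>. P (\<lambda>i. \<sigma> (Suc i)) (\<sigma> 0))" and t: "dfn_term t"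
  shows "dfn (\<lambda>\<sigma>. P \<sigma> (t \<sigma>))"
proof -
  have "dfn (\<lambda>\<sigma>. \<exists>x\<in>carrier G. x = t \<sigma> \<and> P \<sigma> x)"
    using t unfolding dfn_term_def by (intro dfn_ex dfn_conj P) blast
  then show ?thesis
    by (rule dfn_cong) (use dfn_term_closed[OF t] in auto)
qed

lemma dfn_var_mem: "definable M k X \<Longrightarrow> dfn (\<lambda>\<sigma>. \<sigma> i \<in> X)"
  by (rule dfn_uniform[OF uniform_mem[OF elementary_embedding_id]])

lemma dfn_mem:
  assumes "definable M k X" and "dfn_term t"
  shows "dfn (\<lambda>\<sigma>. t \<sigma> \<in> X)"
  by (rule dfn_subst[where P = "\<lambda>\<sigma> x. x \<in> X"]) (rule dfn_var_mem assms)+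

lemma dfn_eq:
  assumes s: "dfn_term s" and t: "dfn_term t"
  shows "dfn (\<lambda>\<sigma>. s \<sigma> = t \<sigma>)"
  by (rule dfn_subst[where P = "\<lambda>\<sigma> x. x = t \<sigma>", OF _ s]) (use t in \<open>simp add: dfn_term_def\<close>)

lemma dfn_term_var: "dfn_term (\<lambda>\<sigma>. \<sigma> i)"
  unfolding dfn_term_def
  by (auto intro: dfn_uniform uniform_eq elementary_embedding_id)

lemma dfn_term_const:
  assumes "c \<in> carrier G"
  shows "dfn_term (\<lambda>\<sigma>. c)"
  unfolding dfn_term_def using assms
  using dfn_var_mem[OF definable_singleton[of c k], of 0] carrier_length by auto

text \<open>The factors are first named by fresh variables, since in the graph of the multiplication the three
  block variables have to be distinct.\<close>

lemma dfn_term_mult: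
  assumes s: "dfn_term s" and t: "dfn_term t"
  shows "dfn_term (\<lambda>\<sigma>. s \<sigma> \<otimes> t \<sigma>)"
proof -
  let ?X = "{x @ y @ (x \<otimes> y) | x y. x \<in> carrier G \<and> y \<in> carrier G}"
  have X: "definable M (3 * k) ?X" using definable_group by (simp add: definable_group_def)
  have graph: "dfn (\<lambda>\<sigma>. \<sigma> 0 @ \<sigma> 1 @ \<sigma> 2 \<in> ?X)"
    using dfn_uniform[OF uniform_atom[OF elementary_embedding_id X, of "[0, 1, 2]"]] by simp
  have graph': "dfn (\<lambda>\<sigma>. \<sigma> 2 = \<sigma> 0 \<otimes> \<sigma> 1)"
  proof (rule dfn_cong[OF graph])
    fix \<sigma> :: "nat \<Rightarrow> 'a list" assume \<sigma>: "\<And>i. \<sigma> i \<in> carrier G"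
    then have "\<sigma> 0 @ \<sigma> 1 @ \<sigma> 2 = x @ y @ (x \<otimes> y) \<longleftrightarrow> \<sigma> 0 = x \<and> \<sigma> 1 = y \<and> \<sigma> 2 = x \<otimes> y"
      if "x \<in> carrier G" "y \<in> carrier G" for x y
      using that carrier_length by auto
    then show "(\<sigma> 0 @ \<sigma> 1 @ \<sigma> 2 \<in> ?X) = (\<sigma> 2 = \<sigma> 0 \<otimes> \<sigma> 1)"
      using \<sigma> by blast
  qed
  have "dfn (\<lambda>\<sigma>. \<sigma> 1 = \<sigma> 0 \<otimes> t (\<lambda>i. \<sigma> (Suc (Suc i))))"
  proof (rule dfn_subst[where P = "\<lambda>\<sigma> y. \<sigma> 1 = \<sigma> 0 \<otimes> y" and t = "\<lambda>\<sigma>. t (\<lambda>i. \<sigma> (Suc (Suc i)))"])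
    have "inj (\<lambda>i::nat. if i = 0 then 1 else if i = 1 then 0 else i)"
      by (auto simp: inj_def split: if_splits)
    from dfn_ren[OF graph' this]
    show "dfn (\<lambda>\<sigma>. \<sigma> (Suc 1) = \<sigma> (Suc 0) \<otimes> \<sigma> 0)" by (simp add: numeral_2_eq_2)
    show "dfn_term (\<lambda>\<sigma>. t (\<lambda>i. \<sigma> (Suc (Suc i))))"
      using dfn_term_ren[OF t, of "\<lambda>i. Suc (Suc i)"] by (simp add: inj_def)
  qed
  moreover have "dfn_term (\<lambda>\<sigma>. s (\<lambda>i. \<sigma> (Suc i)))"
    using dfn_term_ren[OF s, of Suc] by simp
  ultimately have "dfn (\<lambda>\<sigma>. \<sigma> 0 = s (\<lambda>i. \<sigma> (Suc i)) \<otimes> t (\<lambda>i. \<sigma> (Suc i)))"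
    by (intro dfn_subst[where P = "\<lambda>\<sigma> x. \<sigma> 0 = x \<otimes> t (\<lambda>i. \<sigma> (Suc i))" and t = "\<lambda>\<sigma>. s (\<lambda>i. \<sigma> (Suc i))"]) simp_all
  then show ?thesis
    unfolding dfn_term_def using dfn_term_closed[OF s] dfn_term_closed[OF t] by simp
qed

lemma dfn_term_inv:
  assumes s: "dfn_term s"
  shows "dfn_term (\<lambda>\<sigma>. inv (s \<sigma>))"
proof -
  have "dfn_term (\<lambda>\<sigma>. s (\<lambda>i. \<sigma> (Suc i)))"
    using dfn_term_ren[OF s, of Suc] by simp
  then have "dfn (\<lambda>\<sigma>. \<sigma> 0 \<otimes> s (\<lambda>i. \<sigma> (Suc i)) = \<one>)"
    by (intro dfn_eq dfn_term_mult dfn_term_var dfn_term_const) auto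
  then have "dfn (\<lambda>\<sigma>. \<sigma> 0 = inv (s (\<lambda>i. \<sigma> (Suc i))))"
  proof (rule dfn_cong)
    fix \<sigma> :: "nat \<Rightarrow> 'a list" assume \<sigma>: "\<And>i. \<sigma> i \<in> carrier G"
    then have "\<sigma> 0 \<in> carrier G" "s (\<lambda>i. \<sigma> (Suc i)) \<in> carrier G" using dfn_term_closed[OF s] by auto
    then show "(\<sigma> 0 \<otimes> s (\<lambda>i. \<sigma> (Suc i)) = \<one>) = (\<sigma> 0 = inv (s (\<lambda>i. \<sigma> (Suc i))))"
      by (metis inv_equality l_inv)
  qed
  then show ?thesis
    unfolding dfn_term_def using dfn_term_closed[OF s] by simp
qed

lemma dfn_term_pow: "dfn_term s \<Longrightarrow> dfn_term (\<lambda>\<sigma>. s \<sigma> [^] (m :: nat))"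
  by (induction m) (auto intro: dfn_term_const dfn_term_mult)

lemma dfn_bex:
  assumes "definable M k X" "X \<subseteq> carrier G" "dfn (\<lambda>\<sigma>. P (\<lambda>i. \<sigma> (Suc i)) (\<sigma> 0))"
  shows "dfn (\<lambda>\<sigma>. \<exists>x\<in>X. P \<sigma> x)"
proof -
  have "dfn (\<lambda>\<sigma>. \<exists>x\<in>carrier G. x \<in> X \<and> P \<sigma> x)"
    by (intro dfn_ex dfn_conj dfn_var_mem assms)
  then show ?thesis by (rule dfn_cong) (use assms(2) in blast)
qed

lemma dfn_ball:
  assumes "definable M k X" "X \<subseteq> carrier G" "dfn (\<lambda>\<sigma>. P (\<lambda>i. \<sigma> (Suc i)) (\<sigma> 0))"
  shows "dfn (\<lambda>\<sigma>. \<forall>x\<in>X. P \<sigma> x)"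
proof -
  have "dfn (\<lambda>\<sigma>. \<not> (\<exists>x\<in>X. \<not> P \<sigma> x))"
    by (intro dfn_not dfn_bex assms)
  then show ?thesis by simp
qed

lemmas dfn_intros = dfn_mem dfn_eq dfn_not dfn_conj dfn_imp dfn_ex dfn_all dfn_bex dfn_ball
  dfn_term_var dfn_term_const dfn_term_mult dfn_term_inv dfn_term_pow

lemma definableI:
  assumes "X \<subseteq> carrier G" and "dfn (\<lambda>\<sigma>. \<sigma> 0 \<in> X)"
  shows "definable M k X"
proof -
  obtain Q Q' where Q: "uniform M M id k Q Q'" "\<forall>\<sigma>. (\<forall>i. \<sigma> i \<in> carrier G) \<longrightarrow> (\<sigma> 0 \<in> X) = Q \<sigma>"
    using assms(2) unfolding dfn_def by blast
  have "uniform M M id k (\<lambda>\<sigma>. \<sigma> 0 \<in> carrier G \<and> Q \<sigma>) (\<lambda>\<sigma>. \<sigma> 0 \<in> extension M M id k (carrier G) \<and> Q' \<sigma>)"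
    by (intro uniform_conj uniform_mem elementary_embedding_id definable_carrier Q)
  then show ?thesis
  proof (rule uniform_definable_set[where \<delta> = \<one>])
    fix x show "x \<in> X \<longleftrightarrow> length x = k \<and> case_nat x (\<lambda>_. \<one>) 0 \<in> carrier G \<and> Q (case_nat x (\<lambda>_. \<one>))"
    proof (cases "x \<in> carrier G")
      case True
      then have "case_nat x (\<lambda>_. \<one>) i \<in> carrier G" for i by (simp split: nat.split)
      then have "(case_nat x (\<lambda>_. \<one>) 0 \<in> X) = Q (case_nat x (\<lambda>_. \<one>))" using Q(2) by blast
      then show ?thesis using True carrier_length[OF True] by simp
    qed (use assms(1) in auto)
  qed (simp add: carrier_length)
qed

lemma definable_relI:
  assumes "R \<subseteq> carrier G \<times> carrier G" and "dfn (\<lambda>\<sigma>. (\<sigma> 0, \<sigma> 1) \<in> R)"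
  shows "definable_rel M k R"
proof -
  obtain Q Q' where Q: "uniform M M id k Q Q'" "\<forall>\<sigma>. (\<forall>i. \<sigma> i \<in> carrier G) \<longrightarrow> ((\<sigma> 0, \<sigma> 1) \<in> R) = Q \<sigma>"
    using assms(2) unfolding dfn_def by blast
  have "uniform M M id k (\<lambda>\<sigma>. (\<sigma> 0 \<in> carrier G \<and> \<sigma> 1 \<in> carrier G) \<and> Q \<sigma>)
     (\<lambda>\<sigma>. (\<sigma> 0 \<in> extension M M id k (carrier G) \<and> \<sigma> 1 \<in> extension M M id k (carrier G)) \<and> Q' \<sigma>)"
    by (intro uniform_conj uniform_mem elementary_embedding_id definable_carrier Q)
  then show ?thesis
  proof (rule uniform_definable_rel[where \<delta> = \<one>])
    fix x y
    let ?\<sigma> = "case_nat x (case_nat y (\<lambda>_. \<one>))"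
    show "(x, y) \<in> R \<longleftrightarrow> length x = k \<and> length y = k \<and> (?\<sigma> 0 \<in> carrier G \<and> ?\<sigma> 1 \<in> carrier G) \<and> Q ?\<sigma>"
    proof (cases "x \<in> carrier G \<and> y \<in> carrier G")
      case True
      then have "?\<sigma> i \<in> carrier G" for i by (simp split: nat.split)
      then have "((?\<sigma> 0, ?\<sigma> 1) \<in> R) = Q ?\<sigma>" using Q(2) by blast
      then show ?thesis using True carrier_length by simp
    qed (use assms(1) in auto)
  qed (simp add: carrier_length)
qed

abbreviation dsub :: "'a list set \<Rightarrow> bool" where
  "dsub \<equiv> definable_subgroup M k G"

lemma dsub_subgroup: "dsub H \<Longrightarrow> subgroup H G"
  by (simp add: definable_subgroup_def)

lemma dsub_definable: "dsub H \<Longrightarrow> definable M k H"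
  by (simp add: definable_subgroup_def)

lemma dsub_subset: "dsub H \<Longrightarrow> H \<subseteq> carrier G"
  by (simp add: definable_subgroup_def subgroup.subset)

lemma dsubI:
  assumes "subgroup H G" and "dfn (\<lambda>\<sigma>. \<sigma> 0 \<in> H)"
  shows "dsub H"
  using assms definableI[of H] by (simp add: definable_subgroup_def subgroup.subset)

lemma dsub_one: "dsub {\<one>}"
proof (rule dsubI)
  show "subgroup {\<one>} G" by (rule triv_subgroup)
  have "dfn (\<lambda>\<sigma>. \<sigma> 0 = \<one>)" by (intro dfn_intros) auto
  then show "dfn (\<lambda>\<sigma>. \<sigma> 0 \<in> {\<one>})" by simp
qed

lemma dsub_carrier: "dsub (carrier G)"
  by (simp add: definable_subgroup_def definable_carrier subgroup_self)

lemma dsub_Int: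
  assumes "dsub H" "dsub K"
  shows "dsub (H \<inter> K)"
proof (rule dsubI)
  show "subgroup (H \<inter> K) G"
    using assms by (simp add: dsub_subgroup subgroups_Inter_pair)
  have "dfn (\<lambda>\<sigma>. \<sigma> 0 \<in> H \<and> \<sigma> 0 \<in> K)"
    by (intro dfn_intros dsub_definable assms)
  then show "dfn (\<lambda>\<sigma>. \<sigma> 0 \<in> H \<inter> K)" by simp
qed

end

section \<open>Morley rank of definable subsets of a group\<close>

lemma rank_ge_mono: "rank_ge \<D> m X \<Longrightarrow> X \<subseteq> Y \<Longrightarrow> rank_ge \<D> m Y"
proof (cases m)
  case (Suc m')
  moreover assume "rank_ge \<D> m X" "X \<subseteq> Y"
  ultimately show ?thesis by simp (meson subset_trans)
qed auto

text \<open>A map \<open>F\<close> on sets that preserves definability, inclusion, disjointness and nonemptiness transports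
  every tree of definable sets that witnesses a lower bound for the rank.\<close>

lemma rank_ge_image:
  assumes "rank_ge \<D> m X" and "X \<subseteq> S"
    and D: "\<And>Y. Y \<in> \<D> \<Longrightarrow> Y \<subseteq> S \<Longrightarrow> F Y \<in> \<D>'"
    and disj: "\<And>Y Z. Y \<subseteq> S \<Longrightarrow> Z \<subseteq> S \<Longrightarrow> Y \<inter> Z = {} \<Longrightarrow> F Y \<inter> F Z = {}"
    and mono: "\<And>Y Z. Y \<subseteq> Z \<Longrightarrow> Z \<subseteq> S \<Longrightarrow> F Y \<subseteq> F Z"
    and ne: "\<And>Y. Y \<subseteq> S \<Longrightarrow> Y \<noteq> {} \<Longrightarrow> F Y \<noteq> {}"
  shows "rank_ge \<D>' m (F X)"
  using assms(1,2)
proof (induction m arbitrary: X)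
  case 0
  then show ?case using ne by simp
next
  case (Suc m)
  then obtain Y :: "nat \<Rightarrow> 'a set" where Y: "disjoint_family Y"
    "\<And>i. Y i \<in> \<D>" "\<And>i. Y i \<subseteq> X" "\<And>i. rank_ge \<D> m (Y i)" by auto
  have S: "Y i \<subseteq> S" for i using Y(3) Suc.prems(2) by blast
  have "disjoint_family (\<lambda>i. F (Y i))"
    using Y(1) disj[OF S S] by (simp add: disjoint_family_on_def)
  moreover have "F (Y i) \<in> \<D>' \<and> F (Y i) \<subseteq> F X \<and> rank_ge \<D>' m (F (Y i))" for i
    using D[OF Y(2) S] mono[OF Y(3) Suc.prems(2)] Suc.IH[OF Y(4) S] by blast
  ultimately show ?case by auto
qed

lemma rank_ge_le_rank_in: "rank_ge \<D> m X \<Longrightarrow> enat m \<le> rank_in \<D> X"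
  unfolding rank_in_def by (rule Sup_upper) blast

lemma definable_extension:
  assumes "elementary_embedding M N h" and "definable M m X"
  shows "definable N m (extension M N h m X)"
  using assms(2) unfolding definable_def using extension_defset[OF assms(1)] by metis

lemma definable_rel_extension:
  assumes emb: "elementary_embedding M N h" and R: "definable_rel M k R"
  shows "definable_rel N k (extension_rel M N h k R)"
proof -
  let ?X = "{u @ v | u v. (u, v) \<in> R}"
  have "{x @ y | x y. (x, y) \<in> extension_rel M N h k R} = extension M N h (2 * k) ?X"
  proof (intro equalityI subsetI)
    fix z assume z: "z \<in> extension M N h (2 * k) ?X"
    then have "length z = 2 * k" by (rule extension_length)
    with z have "z = take k z @ drop k z" "(take k z, drop k z) \<in> extension_rel M N h k R"
      by (auto simp: extension_rel_def)
    then show "z \<in> {x @ y | x y. (x, y) \<in> extension_rel M N h k R}" by blast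
  qed (auto simp: extension_rel_def)
  moreover have "definable N (2 * k) (extension M N h (2 * k) ?X)"
    using R by (intro definable_extension[OF emb]) (simp add: definable_rel_def)
  ultimately show ?thesis
    unfolding definable_rel_def by (auto simp: extension_rel_def)
qed

lemma definable_rel_converse:
  assumes "definable_rel M k R"
  shows "definable_rel M k (R\<inverse>)"
proof (rule uniform_definable_rel)
  show "uniform M M id k (\<lambda>\<sigma>. (\<sigma> 1, \<sigma> 0) \<in> R) (\<lambda>\<sigma>. (\<sigma> 1, \<sigma> 0) \<in> extension_rel M M id k R)"
    by (rule uniform_rel[OF elementary_embedding_id assms]) simp
  show "(x, y) \<in> R\<inverse> \<longleftrightarrow> length x = k \<and> length y = k \<and>
      (case_nat x (case_nat y (\<lambda>_. replicate k undefined)) 1,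
       case_nat x (case_nat y (\<lambda>_. replicate k undefined)) 0) \<in> R" for x y
    using assms by (auto simp: definable_rel_def)
qed simp

lemma definable_Image:
  assumes "definable_rel M k R" and "definable M k X"
  shows "definable M k (R `` X)"
proof (rule uniform_definable_set)
  show "uniform M M id k (\<lambda>\<sigma>. \<exists>x\<in>X. (x, \<sigma> 0) \<in> R)
      (\<lambda>\<sigma>. \<exists>x\<in>extension M M id k X. (x, \<sigma> 0) \<in> extension_rel M M id k R)"
    by (intro uniform_bex uniform_rel elementary_embedding_id assms) simp
  show "y \<in> R `` X \<longleftrightarrow> length y = k \<and> (\<exists>x\<in>X. (x, case_nat y (\<lambda>_. replicate k undefined) 0) \<in> R)" for y
    using assms(1) by (auto simp: definable_rel_def)
qed simp

locale elementary_pair =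
  fixes M :: "('f, 'r, 'a) struct" and N :: "('f, 'r, 'b) struct" and h :: "'a \<Rightarrow> 'b" and k :: nat
  assumes emb: "elementary_embedding M N h"
begin

abbreviation ext :: "'a list set \<Rightarrow> 'b list set" where
  "ext \<equiv> extension M N h k"

abbreviation ext_rel :: "('a list \<times> 'a list) set \<Rightarrow> ('b list \<times> 'b list) set" where
  "ext_rel \<equiv> extension_rel M N h k"

definition rk_ge :: "nat \<Rightarrow> 'a list set \<Rightarrow> bool" where
  "rk_ge m X \<longleftrightarrow> rank_ge {Y. definable N k Y} m (ext X)"

lemma transfer_sentence: "uniform M N h k (\<lambda>_. P) (\<lambda>_. P') \<Longrightarrow> P \<longleftrightarrow> P'"
  using uniform_transfer[OF emb, of k "\<lambda>_. P" "\<lambda>_. P'" "\<lambda>_. replicate k undefined"] by simp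

lemma ext_mono:
  assumes "definable M k X" "definable M k Y" "X \<subseteq> Y"
  shows "ext X \<subseteq> ext Y"
proof -
  have "(\<forall>x\<in>X. x \<in> Y) \<longleftrightarrow> (\<forall>x\<in>ext X. x \<in> ext Y)"
    by (intro transfer_sentence uniform_ball uniform_mem emb assms)
  with assms(3) show ?thesis by blast
qed

lemma ext_disjoint:
  assumes "definable M k X" "definable M k Y" "X \<inter> Y = {}"
  shows "ext X \<inter> ext Y = {}"
proof -
  have "(\<forall>x\<in>X. \<not> x \<in> Y) \<longleftrightarrow> (\<forall>x\<in>ext X. \<not> x \<in> ext Y)"
    by (intro transfer_sentence uniform_ball uniform_not uniform_mem emb assms)
  with assms(3) show ?thesis by blast
qed

lemma ext_nonempty:
  assumes "definable M k X" "X \<noteq> {}"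
  shows "ext X \<noteq> {}"
proof -
  have "(\<exists>x\<in>X. True) \<longleftrightarrow> (\<exists>x\<in>ext X. True)"
    by (intro transfer_sentence uniform_bex uniform_true emb assms)
  with assms(2) show ?thesis by blast
qed

lemma ext_rel_subset:
  assumes R: "definable_rel M k R" and "definable M k X" "definable M k Y" and sub: "R \<subseteq> X \<times> Y"
  shows "ext_rel R \<subseteq> ext X \<times> ext Y"
proof -
  have "\<not> (\<exists>x. length x = k \<and> (\<exists>y. length y = k \<and> (x, y) \<in> R \<and> \<not> (x \<in> X \<and> y \<in> Y))) \<longleftrightarrow>
      \<not> (\<exists>x. length x = k \<and> (\<exists>y. length y = k \<and> (x, y) \<in> ext_rel R \<and> \<not> (x \<in> ext X \<and> y \<in> ext Y)))"
    by (intro transfer_sentence uniform_ex uniform_conj uniform_not uniform_rel uniform_mem emb assms) simp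
  moreover have "\<not> (\<exists>x. length x = k \<and> (\<exists>y. length y = k \<and> (x, y) \<in> R \<and> \<not> (x \<in> X \<and> y \<in> Y)))"
    using sub by blast
  moreover have "length x = k \<and> length y = k" if "(x, y) \<in> ext_rel R" for x y
    using that by (simp add: extension_rel_def)
  ultimately show ?thesis by (intro subrelI) blast
qed

lemma ext_rel_total:
  assumes R: "definable_rel M k R" and XY: "definable M k X" "definable M k Y"
    and "R \<subseteq> X \<times> Y" and total: "\<And>x. x \<in> X \<Longrightarrow> \<exists>y. (x, y) \<in> R" and "x \<in> ext X"
  shows "\<exists>y\<in>ext Y. (x, y) \<in> ext_rel R"
proof -
  have "(\<forall>x\<in>X. \<exists>y\<in>Y. (x, y) \<in> R) \<longleftrightarrow> (\<forall>x\<in>ext X. \<exists>y\<in>ext Y. (x, y) \<in> ext_rel R)"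
    by (intro transfer_sentence uniform_ball uniform_bex uniform_rel emb assms) simp
  moreover have "\<forall>x\<in>X. \<exists>y\<in>Y. (x, y) \<in> R" using total \<open>R \<subseteq> X \<times> Y\<close> by blast
  ultimately show ?thesis using \<open>x \<in> ext X\<close> by blast
qed

lemma ext_rel_respects:
  assumes R: "definable_rel M k R" and XY: "definable M k X" "definable M k Y"
    and E: "definable_rel M k E" and F: "definable_rel M k F"
    and "R \<subseteq> X \<times> Y"
    and resp: "\<And>x x' y y'. (x, y) \<in> R \<Longrightarrow> (x', y') \<in> R \<Longrightarrow> (x, x') \<in> E \<longleftrightarrow> (y, y') \<in> F"
    and "(x, y) \<in> ext_rel R" "(x', y') \<in> ext_rel R"
  shows "(x, x') \<in> ext_rel E \<longleftrightarrow> (y, y') \<in> ext_rel F"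
proof -
  have "(\<forall>x\<in>X. \<forall>x'\<in>X. \<forall>y\<in>Y. \<forall>y'\<in>Y. (x, y) \<in> R \<longrightarrow> (x', y') \<in> R \<longrightarrow> ((x, x') \<in> E \<longleftrightarrow> (y, y') \<in> F))
    \<longleftrightarrow> (\<forall>x\<in>ext X. \<forall>x'\<in>ext X. \<forall>y\<in>ext Y. \<forall>y'\<in>ext Y. (x, y) \<in> ext_rel R \<longrightarrow> (x', y') \<in> ext_rel R \<longrightarrow>
          ((x, x') \<in> ext_rel E \<longleftrightarrow> (y, y') \<in> ext_rel F))"
    by (intro transfer_sentence uniform_ball uniform_imp uniform_iff uniform_rel emb assms) simp_all
  moreover have "\<forall>x\<in>X. \<forall>x'\<in>X. \<forall>y\<in>Y. \<forall>y'\<in>Y. (x, y) \<in> R \<longrightarrow> (x', y') \<in> R \<longrightarrow> ((x, x') \<in> E \<longleftrightarrow> (y, y') \<in> F)"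
    using resp by blast
  moreover have "ext_rel R \<subseteq> ext X \<times> ext Y"
    by (rule ext_rel_subset) fact+
  ultimately show ?thesis using assms(8,9) by blast
qed

lemma ext_equiv:
  assumes E: "definable_rel M k E" and X: "definable M k X" and equiv: "equiv X E"
  shows "equiv (ext X) (ext_rel E)"
proof -
  have sub: "ext_rel E \<subseteq> ext X \<times> ext X"
    by (rule ext_rel_subset[OF E X X]) (use equiv in \<open>auto simp: equiv_def refl_on_def\<close>)
  have "(\<forall>x\<in>X. \<forall>y\<in>X. x = y \<longrightarrow> (x, y) \<in> E) \<longleftrightarrow> (\<forall>x\<in>ext X. \<forall>y\<in>ext X. x = y \<longrightarrow> (x, y) \<in> ext_rel E)"
    by (intro transfer_sentence uniform_ball uniform_imp uniform_eq uniform_rel emb assms) simp_all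
  moreover have "\<forall>x\<in>X. \<forall>y\<in>X. x = y \<longrightarrow> (x, y) \<in> E"
    using equiv by (auto simp: equiv_def refl_on_def)
  ultimately have refl: "(x, x) \<in> ext_rel E" if "x \<in> ext X" for x
    using that by blast
  have "(\<forall>x\<in>X. \<forall>y\<in>X. (x, y) \<in> E \<longrightarrow> (y, x) \<in> E) \<longleftrightarrow>
      (\<forall>x\<in>ext X. \<forall>y\<in>ext X. (x, y) \<in> ext_rel E \<longrightarrow> (y, x) \<in> ext_rel E)"
    by (intro transfer_sentence uniform_ball uniform_imp uniform_rel emb assms) simp_all
  moreover have "\<forall>x\<in>X. \<forall>y\<in>X. (x, y) \<in> E \<longrightarrow> (y, x) \<in> E"
    using equiv by (auto simp: equiv_def dest: symD)
  ultimately have sym: "sym (ext_rel E)"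
    using sub by (auto simp: sym_def)
  have "(\<forall>x\<in>X. \<forall>y\<in>X. \<forall>z\<in>X. (x, y) \<in> E \<longrightarrow> (y, z) \<in> E \<longrightarrow> (x, z) \<in> E) \<longleftrightarrow>
      (\<forall>x\<in>ext X. \<forall>y\<in>ext X. \<forall>z\<in>ext X. (x, y) \<in> ext_rel E \<longrightarrow> (y, z) \<in> ext_rel E \<longrightarrow> (x, z) \<in> ext_rel E)"
    by (intro transfer_sentence uniform_ball uniform_imp uniform_rel emb assms) simp_all
  moreover have "\<forall>x\<in>X. \<forall>y\<in>X. \<forall>z\<in>X. (x, y) \<in> E \<longrightarrow> (y, z) \<in> E \<longrightarrow> (x, z) \<in> E"
    using equiv by (meson equiv_def transD)
  ultimately have trans: "trans (ext_rel E)"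
    using sub unfolding trans_def by blast
  show ?thesis
    using sub refl sym trans by (auto simp: equiv_def refl_on_def)
qed

lemma ext_mem: "definable M k X \<Longrightarrow> x \<in> X \<Longrightarrow> map h x \<in> ext X"
  using uniform_transfer[OF emb uniform_mem[OF emb, of k X 0], of "\<lambda>_. x"] definable_length[of M k X x] by simp

lemma ext_rel_mem:
  assumes "definable_rel M k R" and "length x = k" "length y = k"
  shows "(map h x, map h y) \<in> ext_rel R \<longleftrightarrow> (x, y) \<in> R"
  using uniform_transfer[OF emb uniform_rel[OF emb assms(1), of 0 1], of "case_nat x (\<lambda>_. y)"] assms(2,3)
  by (simp split: nat.split)

lemma rk_ge_0: "definable M k X \<Longrightarrow> X \<noteq> {} \<Longrightarrow> rk_ge 0 X"
  by (simp add: rk_ge_def ext_nonempty)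

lemma rk_ge_mono: "rk_ge m X \<Longrightarrow> definable M k X \<Longrightarrow> definable M k Y \<Longrightarrow> X \<subseteq> Y \<Longrightarrow> rk_ge m Y"
  unfolding rk_ge_def using ext_mono rank_ge_mono by metis

lemma rk_ge_Suc:
  assumes X: "definable M k X" and "disjoint_family Y"
    and Y: "\<And>i :: nat. definable M k (Y i)" "\<And>i. Y i \<subseteq> X" "\<And>i. rk_ge m (Y i)"
  shows "rk_ge (Suc m) X"
proof -
  have "disjoint_family (\<lambda>i. ext (Y i))"
    using assms(2) ext_disjoint[OF Y(1) Y(1)] by (simp add: disjoint_family_on_def)
  then show ?thesis
    unfolding rk_ge_def using definable_extension[OF emb Y(1)] ext_mono[OF Y(1) X Y(2)] Y(3)
    by (auto simp: rk_ge_def intro!: exI[of _ "\<lambda>i. ext (Y i)"])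
qed

text \<open>The bijection is given by its graph, whose extension is again the graph of an injection; taking
  images under it transports witnesses.\<close>

lemma rk_ge_bijection:
  assumes R: "definable_rel M k R" and X: "definable M k X" and Y: "definable M k Y"
    and sub: "R \<subseteq> X \<times> Y" and total: "\<And>x. x \<in> X \<Longrightarrow> \<exists>y. (x, y) \<in> R"
    and inj: "\<And>x x' y y'. (x, y) \<in> R \<Longrightarrow> (x', y') \<in> R \<Longrightarrow> x = x' \<longleftrightarrow> y = y'"
    and "rk_ge m X"
  shows "rk_ge m Y"
proof -
  let ?Id = "{(x, x) | x :: 'a list. length x = k}"
  have R_len: "length x = k \<and> length y = k" if "(x, y) \<in> R" for x y
    using that R by (auto simp: definable_rel_def)
  have inj': "x = x'" if "(x, y) \<in> ext_rel R" "(x', y) \<in> ext_rel R" for x x' y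
  proof -
    have "(x, x') \<in> ext_rel ?Id \<longleftrightarrow> (y, y) \<in> ext_rel ?Id"
      by (rule ext_rel_respects[OF R X Y definable_rel_Id(1)[OF emb] definable_rel_Id(1)[OF emb] sub _ that])
        (use inj R_len in auto)
    moreover have "length y = k" using that by (simp add: extension_rel_def)
    ultimately show ?thesis by (auto simp: definable_rel_Id(2)[OF emb])
  qed
  have "rank_ge {Y. definable N k Y} m (ext_rel R `` ext X)"
  proof (rule rank_ge_image[where S = "ext X" and F = "\<lambda>Z. ext_rel R `` Z"])
    show "rank_ge {Y. definable N k Y} m (ext X)" using assms(7) by (simp add: rk_ge_def)
    show "ext_rel R `` Z \<in> {Y. definable N k Y}" if "Z \<in> {Y. definable N k Y}" for Z
      using that definable_Image[OF definable_rel_extension[OF emb R]] by simp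
    show "ext_rel R `` Z \<inter> ext_rel R `` Z' = {}" if "Z \<inter> Z' = {}" for Z Z'
      using that inj' by blast
    show "ext_rel R `` Z \<noteq> {}" if "Z \<subseteq> ext X" "Z \<noteq> {}" for Z
      using that ext_rel_total[OF R X Y sub total] by blast
  qed auto
  moreover have "ext_rel R `` ext X \<subseteq> ext Y"
    using ext_rel_subset[OF R X Y sub] by blast
  ultimately show ?thesis unfolding rk_ge_def by (rule rank_ge_mono)
qed

text \<open>A definable relation that induces an injection of quotients sends a set of classes to the set of
  classes of the related elements.\<close>

lemma quotient_rank_ge:
  assumes R: "definable_rel M k R" and X: "definable M k X" and Y: "definable M k Y"
    and E: "definable_rel M k E" and F: "definable_rel M k F"
    and equiv: "equiv X E" "equiv Y F"
    and sub: "R \<subseteq> X \<times> Y" and total: "\<And>x. x \<in> X \<Longrightarrow> \<exists>y. (x, y) \<in> R"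
    and resp: "\<And>x x' y y'. (x, y) \<in> R \<Longrightarrow> (x', y') \<in> R \<Longrightarrow> (x, x') \<in> E \<longleftrightarrow> (y, y') \<in> F"
    and rank: "rank_ge {S. S \<subseteq> ext X // ext_rel E \<and> definable N k (\<Union>S)} m (ext X // ext_rel E)"
  shows "rank_ge {S. S \<subseteq> ext Y // ext_rel F \<and> definable N k (\<Union>S)} m (ext Y // ext_rel F)"
proof -
  note equiv' = ext_equiv[OF E X equiv(1)] ext_equiv[OF F Y equiv(2)]
  note sub' = ext_rel_subset[OF R X Y sub]
  have resp': "(x, x') \<in> ext_rel E \<longleftrightarrow> (y, y') \<in> ext_rel F"
    if "(x, y) \<in> ext_rel R" "(x', y') \<in> ext_rel R" for x x' y y'
    by (rule ext_rel_respects[OF R X Y E F sub _ that]) (rule resp)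
  define T where "T S = (ext_rel R `` (\<Union>S)) // ext_rel F" for S
  have T_mem: "c \<in> T S \<longleftrightarrow> (\<exists>x y. x \<in> \<Union>S \<and> (x, y) \<in> ext_rel R \<and> c = ext_rel F `` {y})" for c S
    unfolding T_def quotient_def by blast
  have T_Union: "\<Union>(T S) = ext_rel F `` (ext_rel R `` (\<Union>S))" for S
    unfolding T_def quotient_def by blast
  have T_subset: "T S \<subseteq> ext Y // ext_rel F" for S
    unfolding T_def quotient_def using sub' by blast
  have "rank_ge {S. S \<subseteq> ext Y // ext_rel F \<and> definable N k (\<Union>S)} m (T (ext X // ext_rel E))"
  proof (rule rank_ge_image[where S = "ext X // ext_rel E" and F = T])
    show "rank_ge {S. S \<subseteq> ext X // ext_rel E \<and> definable N k (\<Union>S)} m (ext X // ext_rel E)" by fact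
    show "T S \<in> {S. S \<subseteq> ext Y // ext_rel F \<and> definable N k (\<Union>S)}"
      if "S \<in> {S. S \<subseteq> ext X // ext_rel E \<and> definable N k (\<Union>S)}" for S
      using that T_subset by (auto simp: T_Union intro!: definable_Image definable_rel_extension[OF emb] R F)
    show "T S \<inter> T S' = {}" if S: "S \<subseteq> ext X // ext_rel E" "S' \<subseteq> ext X // ext_rel E" "S \<inter> S' = {}" for S S'
    proof (rule ccontr)
      assume "T S \<inter> T S' \<noteq> {}"
      then obtain c where "c \<in> T S" "c \<in> T S'" by blast
      then obtain x y x' y' where 1: "x \<in> \<Union>S" "(x, y) \<in> ext_rel R" "x' \<in> \<Union>S'" "(x', y') \<in> ext_rel R"
        and "ext_rel F `` {y} = ext_rel F `` {y'}" unfolding T_mem by blast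
      moreover have "y \<in> ext Y" "y' \<in> ext Y" using 1 sub' by blast+
      ultimately have "(y, y') \<in> ext_rel F" using equiv'(2) by (simp add: eq_equiv_class_iff)
      then have E': "(x, x') \<in> ext_rel E" using resp'[OF 1(2,4)] by blast
      obtain c c' where "c \<in> S" "x \<in> c" "c' \<in> S'" "x' \<in> c'" using 1 by blast
      moreover from this have "c = c'"
        using E' S quotient_eq_iff[OF equiv'(1), of c c' x x'] by blast
      ultimately show False using S(3) by blast
    qed
    show "T S \<noteq> {}" if S: "S \<subseteq> ext X // ext_rel E" "S \<noteq> {}" for S
    proof -
      obtain c where "c \<in> S" using S(2) by blast
      moreover from this have "c \<noteq> {}" "c \<subseteq> ext X"
        using S(1) equiv'(1) in_quotient_imp_non_empty in_quotient_imp_subset by blast+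
      ultimately obtain x where "x \<in> \<Union>S" "x \<in> ext X" by blast
      moreover from this obtain y where "(x, y) \<in> ext_rel R"
        using ext_rel_total[OF R X Y sub total] by blast
      ultimately show ?thesis using T_mem by blast
    qed
    show "T S \<subseteq> T S'" if "S \<subseteq> S'" for S S'
      using that unfolding T_def quotient_def by blast
  qed auto
  then show ?thesis by (rule rank_ge_mono) (rule T_subset)
qed

lemma quotient_rank_cong:
  assumes R: "definable_rel M k R" and X: "definable M k X" and Y: "definable M k Y"
    and E: "definable_rel M k E" and F: "definable_rel M k F"
    and equiv: "equiv X E" "equiv Y F"
    and sub: "R \<subseteq> X \<times> Y" and total: "\<And>x. x \<in> X \<Longrightarrow> \<exists>y. (x, y) \<in> R"
    and onto: "\<And>y. y \<in> Y \<Longrightarrow> \<exists>x. (x, y) \<in> R"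
    and resp: "\<And>x x' y y'. (x, y) \<in> R \<Longrightarrow> (x', y') \<in> R \<Longrightarrow> (x, x') \<in> E \<longleftrightarrow> (y, y') \<in> F"
  shows "morley_rank_quotient M N h k X E = morley_rank_quotient M N h k Y F"
proof -
  have "rank_ge {S. S \<subseteq> ext X // ext_rel E \<and> definable N k (\<Union>S)} m (ext X // ext_rel E) \<longleftrightarrow>
      rank_ge {S. S \<subseteq> ext Y // ext_rel F \<and> definable N k (\<Union>S)} m (ext Y // ext_rel F)" for m
  proof
    show "rank_ge {S. S \<subseteq> ext Y // ext_rel F \<and> definable N k (\<Union>S)} m (ext Y // ext_rel F)"
      if "rank_ge {S. S \<subseteq> ext X // ext_rel E \<and> definable N k (\<Union>S)} m (ext X // ext_rel E)"
      by (rule quotient_rank_ge[OF R X Y E F equiv sub total _ that]) (simp_all add: resp)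
    show "rank_ge {S. S \<subseteq> ext X // ext_rel E \<and> definable N k (\<Union>S)} m (ext X // ext_rel E)"
      if "rank_ge {S. S \<subseteq> ext Y // ext_rel F \<and> definable N k (\<Union>S)} m (ext Y // ext_rel F)"
      by (rule quotient_rank_ge[OF definable_rel_converse[OF R] Y X F E equiv(2,1) _ _ _ that])
        (use sub onto resp in auto)
  qed
  then show ?thesis
    by (simp add: morley_rank_quotient_def Let_def rank_in_def)
qed

lemma quotient_rank_le:
  assumes X: "definable M k X" and E: "definable_rel M k E" and equiv: "equiv X E"
    and bound: "\<And>m. rk_ge m X \<Longrightarrow> m \<le> b"
  shows "morley_rank_quotient M N h k X E \<le> enat b"
proof -
  note equiv' = ext_equiv[OF E X equiv]
  let ?Q = "ext X // ext_rel E"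
  have "m \<le> b" if "rank_ge {S. S \<subseteq> ?Q \<and> definable N k (\<Union>S)} m ?Q" for m
  proof (rule bound)
    have "rank_ge {Y. definable N k Y} m (\<Union>?Q)"
    proof (rule rank_ge_image[OF that, where F = Union and S = ?Q])
      show "\<Union>Y \<inter> \<Union>Z = {}" if "Y \<subseteq> ?Q" "Z \<subseteq> ?Q" "Y \<inter> Z = {}" for Y Z
        using that quotient_disj[OF equiv'] by blast
      show "\<Union>Y \<noteq> {}" if "Y \<subseteq> ?Q" "Y \<noteq> {}" for Y
        using that in_quotient_imp_non_empty[OF equiv'] by blast
    qed auto
    then show "rk_ge m X" using Union_quotient[OF equiv'] by (simp add: rk_ge_def)
  qed
  then show ?thesis
    by (auto simp: morley_rank_quotient_def Let_def rank_in_def intro!: Sup_least)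
qed

lemma quotient_rank_infinite:
  assumes X: "definable M k X" and E: "definable_rel M k E" and equiv: "equiv X E"
    and y: "\<And>i :: nat. y i \<in> X" "\<And>i j. i \<noteq> j \<Longrightarrow> (y i, y j) \<notin> E"
  shows "enat 1 \<le> morley_rank_quotient M N h k X E"
proof -
  note equiv' = ext_equiv[OF E X equiv]
  let ?Q = "ext X // ext_rel E"
  define c where "c i = ext_rel E `` {map h (y i)}" for i
  have len: "length (y i) = k" for i using definable_length[OF X y(1)] .
  have mem: "map h (y i) \<in> ext X" for i by (rule ext_mem[OF X y(1)])
  have "c i \<noteq> c j" if "i \<noteq> j" for i j
    using that y(2) eq_equiv_class_iff[OF equiv' mem mem] ext_rel_mem[OF E len len]
    unfolding c_def by blast
  then have "disjoint_family (\<lambda>i. {c i})" by (auto simp: disjoint_family_on_def)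
  moreover have "c i \<in> ?Q" for i unfolding c_def by (rule quotientI[OF mem])
  moreover have "definable N k (c i)" for i
    unfolding c_def by (intro definable_Image definable_rel_extension[OF emb] E definable_singleton) (simp add: len)
  ultimately have "rank_ge {S. S \<subseteq> ?Q \<and> definable N k (\<Union>S)} 1 ?Q"
    by (auto intro!: exI[of _ "\<lambda>i. {c i}"])
  then show ?thesis
    unfolding morley_rank_quotient_def Let_def by (rule rank_ge_le_rank_in)
qed

end

section \<open>Chains of definable subgroups\<close>

lemma (in group) rcos_eq_iff:
  assumes "subgroup H G" "x \<in> carrier G" "y \<in> carrier G"
  shows "H #> x = H #> y \<longleftrightarrow> x \<otimes> inv y \<in> H"
  using subgroup.rcos_module[OF assms(1) is_group assms(3,2)] rcos_self[OF assms(2,1)]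
    repr_independence[OF _ assms(3,1)] by metis

lemma (in group) pow_diff:
  assumes "x \<in> carrier G" "j \<le> i"
  shows "x [^] i \<otimes> inv (x [^] j) = x [^] (i - j :: nat)"
proof -
  have "x [^] i = x [^] (i - j) \<otimes> x [^] j" using assms by (simp add: nat_pow_mult)
  then show ?thesis using assms by (simp add: m_assoc)
qed

locale group_fmr = group_definable M k G + elementary_pair M N h k
  for M :: "('f, 'r, 'a) struct" and k :: nat and G :: "'a list monoid" (structure)
    and N :: "('f, 'r, 'b) struct" and h :: "'a \<Rightarrow> 'b" +
  fixes n :: nat
  assumes finite_rank: "morley_rank M N h k (carrier G) = enat n"
begin

abbreviation "conn \<equiv> definable_connected M k G"
abbreviation "indec \<equiv> indecomposable M k G"
abbreviation "dhull \<equiv> definable_hull M k G"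
abbreviation "rad \<equiv> radical M k G"
abbreviation "rrank \<equiv> reduced_rank M N h k G"

lemma rk_ge_bound:
  assumes "definable M k X" "X \<subseteq> carrier G" "rk_ge m X"
  shows "m \<le> n"
proof -
  have "rk_ge m (carrier G)" using rk_ge_mono assms definable_carrier by blast
  then show ?thesis
    using rank_ge_le_rank_in finite_rank unfolding rk_ge_def morley_rank_def by fastforce
qed

lemma definable_rcos:
  assumes X: "definable M k X" "X \<subseteq> carrier G" and g: "g \<in> carrier G"
  shows "definable M k (X #> g)"
proof (rule definableI)
  show "X #> g \<subseteq> carrier G" using r_coset_subset_G X g by blast
  have "dfn (\<lambda>\<sigma>. \<exists>x\<in>X. \<sigma> 0 = x \<otimes> g)"
    by (intro dfn_intros X g)
  then show "dfn (\<lambda>\<sigma>. \<sigma> 0 \<in> X #> g)" by (simp add: r_coset_def)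
qed

lemma rk_ge_translate:
  assumes X: "definable M k X" "X \<subseteq> carrier G" and g: "g \<in> carrier G" and "rk_ge m X"
  shows "rk_ge m (X #> g)"
proof (rule rk_ge_bijection)
  let ?R = "{(x, x \<otimes> g) | x. x \<in> X}"
  have "dfn (\<lambda>\<sigma>. \<sigma> 0 \<in> X \<and> \<sigma> 1 = \<sigma> 0 \<otimes> g)"
    by (intro dfn_intros X g)
  then have "dfn (\<lambda>\<sigma>. (\<sigma> 0, \<sigma> 1) \<in> ?R)"
    by (rule dfn_cong) auto
  then show "definable_rel M k ?R" by (rule definable_relI[rotated]) (use X g in auto)
  show "definable M k X" by fact
  show "definable M k (X #> g)" by (rule definable_rcos) fact+
  show "?R \<subseteq> X \<times> (X #> g)" by (auto simp: r_coset_def)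
  show "\<exists>y. (x, y) \<in> ?R" if "x \<in> X" for x using that by blast
  show "x = x' \<longleftrightarrow> y = y'" if "(x, y) \<in> ?R" "(x', y') \<in> ?R" for x x' y y'
  proof -
    have "y = x \<otimes> g" "y' = x' \<otimes> g" "x \<in> carrier G" "x' \<in> carrier G" using that X(2) by auto
    then show ?thesis using g by simp
  qed
qed fact

lemma rk_ge_cosets:
  assumes X: "definable M k X" and Y: "\<And>i :: nat. dsub (Y i)" "\<And>i. g i \<in> carrier G"
    "\<And>i. Y i #> g i \<subseteq> X" "\<And>i. rk_ge m (Y i)"
    and "disjoint_family (\<lambda>i. Y i #> g i)"
  shows "rk_ge (Suc m) X"
  by (rule rk_ge_Suc[OF X assms(6)])
    (use Y dsub_definable dsub_subset definable_rcos rk_ge_translate in auto)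

lemma dsub_nonempty: "dsub H \<Longrightarrow> H \<noteq> {}"
  using dsub_subgroup subgroup.one_closed by blast

text \<open>In a strictly descending chain each \<open>H i\<close> contains a coset of \<open>H (i + j + 1)\<close> inside
  \<open>H (i + j) - H (i + j + 1)\<close>, for every \<open>j\<close>.  These cosets are disjoint, so if all members of the chain have
  rank at least \<open>m\<close>, they all have rank at least \<open>m + 1\<close>.\<close>

lemma no_descending_chain:
  fixes H :: "nat \<Rightarrow> 'a list set"
  assumes H: "\<And>i. dsub (H i)" and strict: "\<And>i. H (Suc i) \<subset> H i"
  shows False
proof -
  have anti: "H j \<subseteq> H i" if "i \<le> j" for i j
    using lift_Suc_antimono_le[of H] strict that by blast
  have "rk_ge m (H i)" for m i
  proof (induction m arbitrary: i)
    case 0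
    show ?case by (rule rk_ge_0[OF dsub_definable[OF H] dsub_nonempty[OF H]])
  next
    case (Suc m)
    have "\<forall>j. \<exists>g. g \<in> H (i + j) - H (Suc (i + j))" using strict by blast
    then obtain g where g: "\<And>j. g j \<in> H (i + j)" "\<And>j. g j \<notin> H (Suc (i + j))" by (metis DiffE)
    have sub: "H (Suc (i + j)) #> g j \<subseteq> H (i + j)" for j
      using anti[of "i + j" "Suc (i + j)"] g(1)[of j]
        subgroup.m_closed[OF dsub_subgroup[OF H[of "i + j"]]] by (auto simp: r_coset_def)
    have notin: "x \<notin> H (Suc (i + j))" if "x \<in> H (Suc (i + j)) #> g j" for x j
    proof
      assume x: "x \<in> H (Suc (i + j))"
      obtain y where y: "y \<in> H (Suc (i + j))" "x = y \<otimes> g j"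
        using \<open>x \<in> H (Suc (i + j)) #> g j\<close> by (auto simp: r_coset_def)
      note S = dsub_subgroup[OF H[of "Suc (i + j)"]]
      have "g j \<in> carrier G" "y \<in> carrier G"
        using g(1) y(1) dsub_subset[OF H] by blast+
      then have "g j = inv y \<otimes> x" using y(2) by (simp add: m_assoc[symmetric])
      then show False
        using g(2)[of j] subgroup.m_closed[OF S subgroup.m_inv_closed[OF S y(1)] x] by simp
    qed
    show ?case
    proof (rule rk_ge_cosets[where Y = "\<lambda>j. H (Suc (i + j))" and g = g])
      show "H (Suc (i + j)) #> g j \<subseteq> H i" for j
        using sub[of j] anti[of i "i + j"] by simp
      show "g j \<in> carrier G" for j using g(1) dsub_subset[OF H] by blast
      have "(H (Suc (i + j)) #> g j) \<inter> (H (Suc (i + l)) #> g l) = {}" if "j < l" for j l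
        using notin[of _ j] sub[of l] anti[of "Suc (i + j)" "i + l"] that by fastforce
      then show "disjoint_family (\<lambda>j. H (Suc (i + j)) #> g j)"
        unfolding disjoint_family_on_def by (metis Int_commute linorder_neqE_nat)
    qed (use H Suc.IH dsub_definable in auto)
  qed
  then have "Suc n \<le> n"
    using rk_ge_bound[OF dsub_definable[OF H] dsub_subset[OF H]] by blast
  then show False by simp
qed

lemma wf_dsub: "wf {(H, K). dsub H \<and> dsub K \<and> H \<subset> K}"
  unfolding wf_iff_no_infinite_down_chain
proof
  assume "\<exists>f. \<forall>i. (f (Suc i), f i) \<in> {(H, K). dsub H \<and> dsub K \<and> H \<subset> K}"
  then obtain f where "\<And>i. dsub (f i)" "\<And>i. f (Suc i) \<subset> f i" by blast
  then show False by (rule no_descending_chain)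
qed

lemma minimal_dsub:
  assumes "dsub H" "P H"
  obtains K where "dsub K" "P K" "\<And>L. dsub L \<Longrightarrow> P L \<Longrightarrow> L \<subseteq> K \<Longrightarrow> L = K"
proof -
  have "H \<in> {H. dsub H \<and> P H}" using assms by simp
  from wfE_min[OF wf_dsub this] obtain K where "K \<in> {H. dsub H \<and> P H}"
    and "\<And>L. (L, K) \<in> {(H, K). dsub H \<and> dsub K \<and> H \<subset> K} \<Longrightarrow> L \<notin> {H. dsub H \<and> P H}" by blast
  then show ?thesis by (intro that[of K]) blast+
qed

lemma definable_hull_least:
  assumes "X \<subseteq> carrier G"
  shows "dsub (dhull X)" and "X \<subseteq> dhull X"
    and "\<And>H. dsub H \<Longrightarrow> X \<subseteq> H \<Longrightarrow> dhull X \<subseteq> H"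
proof -
  obtain K where K: "dsub K" "X \<subseteq> K" "\<And>L. dsub L \<Longrightarrow> X \<subseteq> L \<Longrightarrow> L \<subseteq> K \<Longrightarrow> L = K"
    using minimal_dsub[OF dsub_carrier, of "\<lambda>H. X \<subseteq> H"] assms by blast
  have least: "K \<subseteq> H" if "dsub H" "X \<subseteq> H" for H
    using K(3)[OF dsub_Int[OF K(1) that(1)]] K(2) that(2) by blast
  have "dhull X = K"
    unfolding definable_hull_def by (rule Least_equality) (use K least in auto)
  then show "dsub (dhull X)" "X \<subseteq> dhull X"
    "\<And>H. dsub H \<Longrightarrow> X \<subseteq> H \<Longrightarrow> dhull X \<subseteq> H"
    using K least by auto
qed

text \<open>A sequence of representatives of distinct cosets is the form in which infinite index is both proved
  and used below.\<close>

definition infinite_index :: "'a list set \<Rightarrow> 'a list set \<Rightarrow> bool" where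
  "infinite_index K H \<longleftrightarrow>
     (\<exists>y :: nat \<Rightarrow> 'a list. (\<forall>i. y i \<in> H) \<and> (\<forall>i j. i \<noteq> j \<longrightarrow> y i \<otimes> inv (y j) \<notin> K))"

lemma rk_ge_infinite_index:
  assumes H: "dsub H" and K: "dsub K" and "K \<subseteq> H" and "infinite_index K H" and "rk_ge m K"
  shows "rk_ge (Suc m) H"
proof -
  obtain y :: "nat \<Rightarrow> 'a list" where y: "\<And>i. y i \<in> H" "\<And>i j. i \<noteq> j \<Longrightarrow> y i \<otimes> inv (y j) \<notin> K"
    using assms(4) unfolding infinite_index_def by blast
  have carr: "y i \<in> carrier G" for i using y(1) dsub_subset[OF H] by blast
  show ?thesis
  proof (rule rk_ge_cosets[where Y = "\<lambda>_ :: nat. K" and g = y])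
    show "K #> y i \<subseteq> H" for i
      using assms(3) y(1) subgroup.m_closed[OF dsub_subgroup[OF H]] by (auto simp: r_coset_def)
    have "(K #> y i) \<inter> (K #> y j) = {}" if "i \<noteq> j" for i j
    proof (rule ccontr)
      assume "(K #> y i) \<inter> (K #> y j) \<noteq> {}"
      then obtain z where "z \<in> K #> y i" "z \<in> K #> y j" by blast
      then have "K #> y i = K #> y j"
        using repr_independence[OF _ carr dsub_subgroup[OF K]] by blast
      then show False using rcos_eq_iff[OF dsub_subgroup[OF K] carr carr] y(2) that by blast
    qed
    then show "disjoint_family (\<lambda>i. K #> y i)" by (simp add: disjoint_family_on_def)
  qed (use assms carr dsub_definable in auto)
qed

lemma finite_rcosets_iff:
  assumes H: "subgroup H G" and K: "subgroup K G" and "K \<subseteq> H"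
  shows "finite (rcosets\<^bsub>G\<lparr>carrier := H\<rparr>\<^esub> K) \<longleftrightarrow> \<not> infinite_index K H"
proof -
  have cosets: "rcosets\<^bsub>G\<lparr>carrier := H\<rparr>\<^esub> K = (\<lambda>a. K #> a) ` H"
    by (auto simp: RCOSETS_def r_coset_def)
  have carr: "x \<in> carrier G" if "x \<in> H" for x using that subgroup.subset[OF H] by blast
  show ?thesis
  proof
    assume fin: "finite (rcosets\<^bsub>G\<lparr>carrier := H\<rparr>\<^esub> K)"
    show "\<not> infinite_index K H"
    proof
      assume "infinite_index K H"
      then obtain y where y: "\<And>i :: nat. y i \<in> H" "\<And>i j. i \<noteq> j \<Longrightarrow> y i \<otimes> inv (y j) \<notin> K"
        unfolding infinite_index_def by blast
      have "inj (\<lambda>i. K #> y i)"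
        by (rule injI) (use y rcos_eq_iff[OF K carr carr] in metis)
      moreover have "range (\<lambda>i. K #> y i) \<subseteq> (\<lambda>a. K #> a) ` H" using y(1) by blast
      ultimately show False
        using fin unfolding cosets using finite_subset range_inj_infinite by blast
    qed
  next
    assume fin: "\<not> infinite_index K H"
    show "finite (rcosets\<^bsub>G\<lparr>carrier := H\<rparr>\<^esub> K)"
    proof (rule ccontr)
      assume "infinite (rcosets\<^bsub>G\<lparr>carrier := H\<rparr>\<^esub> K)"
      then obtain f :: "nat \<Rightarrow> 'a list set" where f: "inj f" "range f \<subseteq> (\<lambda>a. K #> a) ` H"
        unfolding cosets using infinite_countable_subset by blast
      then have "\<forall>i. \<exists>a\<in>H. f i = K #> a" by blast
      then obtain y where y: "\<And>i. y i \<in> H" "\<And>i. f i = K #> y i" by metis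
      have "y i \<otimes> inv (y j) \<notin> K" if "i \<noteq> j" for i j
        using that f(1) y rcos_eq_iff[OF K carr[OF y(1)] carr[OF y(1)]] by (metis injD)
      then show False using fin y(1) unfolding infinite_index_def by blast
    qed
  qed
qed

lemma connected_iff:
  "conn H \<longleftrightarrow> dsub H \<and> (\<forall>K. dsub K \<longrightarrow> K \<subset> H \<longrightarrow> infinite_index K H)"
  unfolding definable_connected_def using finite_rcosets_iff[of H] dsub_subgroup
  by (metis psubset_imp_subset)

lemma infinite_index_mono: "infinite_index K H \<Longrightarrow> H \<subseteq> H' \<Longrightarrow> infinite_index K H'"
  unfolding infinite_index_def by blast

section \<open>Definable abelian subgroups\<close>

definition abelian :: "'a list set \<Rightarrow> bool" where
  "abelian A \<longleftrightarrow> dsub A \<and> (\<forall>x\<in>A. \<forall>y\<in>A. x \<otimes> y = y \<otimes> x)"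

lemma definable_abelian_iff: "definable_abelian M k G A \<longleftrightarrow> abelian A"
proof
  assume "definable_abelian M k G A"
  then have "dsub A" and "comm_group (G\<lparr>carrier := A\<rparr>)" by (auto simp: definable_abelian_def)
  then show "abelian A"
    using comm_monoid.m_comm[OF comm_group.axioms(1), of "G\<lparr>carrier := A\<rparr>"] by (auto simp: abelian_def)
next
  assume A: "abelian A"
  then have "group (G\<lparr>carrier := A\<rparr>)"
    using subgroup.subgroup_is_group dsub_subgroup unfolding abelian_def by blast
  then have "comm_group (G\<lparr>carrier := A\<rparr>)"
    by (rule group.group_comm_groupI) (use A in \<open>auto simp: abelian_def\<close>)
  then show "definable_abelian M k G A"
    using A by (simp add: definable_abelian_def abelian_def)
qed

lemma abelian_dsub: "abelian A \<Longrightarrow> dsub A"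
  by (simp add: abelian_def)

lemma abelian_subset: "abelian A \<Longrightarrow> dsub B \<Longrightarrow> B \<subseteq> A \<Longrightarrow> abelian B"
  unfolding abelian_def by blast

lemma dsub_pow: "dsub H \<Longrightarrow> x \<in> H \<Longrightarrow> x [^] (m :: nat) \<in> H"
proof (induction m)
  case 0
  then show ?case using subgroup.one_closed[OF dsub_subgroup] by simp
next
  case (Suc m)
  then show ?case using subgroup.m_closed[OF dsub_subgroup] by simp
qed

lemma dsub_pow_image:
  assumes A: "abelian A"
  shows "dsub ((\<lambda>x. x [^] (m :: nat)) ` A)"
proof (rule dsubI)
  note S = dsub_subgroup[OF abelian_dsub[OF A]]
  note carr = subgroup.mem_carrier[OF S]
  show "subgroup ((\<lambda>x. x [^] m) ` A) G"
  proof
    show "(\<lambda>x. x [^] m) ` A \<subseteq> carrier G" using carr by auto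
    show "\<one> \<in> (\<lambda>x. x [^] m) ` A"
      using subgroup.one_closed[OF S] by (metis image_eqI nat_pow_one)
    show "x \<otimes> y \<in> (\<lambda>x. x [^] m) ` A" if "x \<in> (\<lambda>x. x [^] m) ` A" "y \<in> (\<lambda>x. x [^] m) ` A" for x y
    proof -
      from that obtain a b where ab: "a \<in> A" "b \<in> A" "x = a [^] m" "y = b [^] m" by blast
      then have "x \<otimes> y = (a \<otimes> b) [^] m"
        using pow_mult_distrib carr A unfolding abelian_def by metis
      then show ?thesis using subgroup.m_closed[OF S ab(1,2)] by blast
    qed
    show "inv x \<in> (\<lambda>x. x [^] m) ` A" if "x \<in> (\<lambda>x. x [^] m) ` A" for x
    proof -
      obtain a where "a \<in> A" "x = a [^] m" using \<open>x \<in> (\<lambda>x. x [^] m) ` A\<close> by blast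
      then have "inv x = (inv a) [^] m" "inv a \<in> A"
        using nat_pow_inv carr subgroup.m_inv_closed[OF S] by auto
      then show ?thesis by blast
    qed
  qed
  have "dfn (\<lambda>\<sigma>. \<exists>x\<in>A. \<sigma> 0 = x [^] m)"
    by (intro dfn_intros dsub_definable dsub_subset abelian_dsub A)
  then show "dfn (\<lambda>\<sigma>. \<sigma> 0 \<in> (\<lambda>x. x [^] m) ` A)" by (simp add: image_def)
qed

lemma dsub_set_mult:
  assumes B: "dsub B" and C: "dsub C" and comm: "\<And>b c. b \<in> B \<Longrightarrow> c \<in> C \<Longrightarrow> b \<otimes> c = c \<otimes> b"
  shows "dsub (B <#> C)"
proof (rule dsubI)
  note S = dsub_subgroup[OF B] dsub_subgroup[OF C]
  have carr: "b \<in> carrier G" "c \<in> carrier G" if "b \<in> B" "c \<in> C" for b c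
    using that dsub_subset[OF B] dsub_subset[OF C] by blast+
  show "subgroup (B <#> C) G"
  proof
    show "B <#> C \<subseteq> carrier G"
      by (rule set_mult_closed) (simp_all add: dsub_subset B C)
    show "\<one> \<in> B <#> C"
      using S[THEN subgroup.one_closed] unfolding set_mult_def by (auto intro!: bexI[of _ \<one>])
    show "x \<otimes> y \<in> B <#> C" if "x \<in> B <#> C" "y \<in> B <#> C" for x y
    proof -
      from that obtain b c b' c' where x: "b \<in> B" "c \<in> C" "x = b \<otimes> c"
        and y: "b' \<in> B" "c' \<in> C" "y = b' \<otimes> c'" unfolding set_mult_def by blast
      note cl = carr[OF x(1,2)] carr[OF y(1,2)]
      have "x \<otimes> y = b \<otimes> (c \<otimes> b') \<otimes> c'" using cl x(3) y(3) by (simp add: m_assoc)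
      also have "\<dots> = b \<otimes> (b' \<otimes> c) \<otimes> c'" using comm[OF y(1) x(2)] by simp
      also have "\<dots> = (b \<otimes> b') \<otimes> (c \<otimes> c')" using cl by (simp add: m_assoc)
      finally show ?thesis
        using subgroup.m_closed[OF S(1) x(1) y(1)] subgroup.m_closed[OF S(2) x(2) y(2)]
        unfolding set_mult_def by blast
    qed
    show "inv x \<in> B <#> C" if "x \<in> B <#> C" for x
    proof -
      from that obtain b c where x: "b \<in> B" "c \<in> C" "x = b \<otimes> c" unfolding set_mult_def by blast
      have "inv x = inv b \<otimes> inv c"
        using carr[OF x(1,2)] x(3) comm[OF x(1,2)] by (simp add: inv_mult_group)
      then show ?thesis
        using subgroup.m_inv_closed[OF S(1) x(1)] subgroup.m_inv_closed[OF S(2) x(2)]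
        unfolding set_mult_def by blast
    qed
  qed
  have "dfn (\<lambda>\<sigma>. \<exists>b\<in>B. \<exists>c\<in>C. \<sigma> 0 = b \<otimes> c)"
    by (intro dfn_intros dsub_definable dsub_subset B C)
  then show "dfn (\<lambda>\<sigma>. \<sigma> 0 \<in> B <#> C)" by (simp add: set_mult_def)
qed

lemma set_mult_in_dsub: "dsub A \<Longrightarrow> B \<subseteq> A \<Longrightarrow> C \<subseteq> A \<Longrightarrow> B <#> C \<subseteq> A"
  by (auto simp: set_mult_def) (meson dsub_subgroup subgroup.m_closed subsetD)

lemma subset_set_mult:
  assumes "dsub B" "dsub C"
  shows "B \<subseteq> B <#> C" "C \<subseteq> B <#> C"
proof -
  have "b \<otimes> \<one> \<in> B <#> C" "\<one> \<otimes> c \<in> B <#> C" if "b \<in> B" "c \<in> C" for b c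
    using that assms subgroup.one_closed[OF dsub_subgroup] unfolding set_mult_def by blast+
  then show "B \<subseteq> B <#> C" "C \<subseteq> B <#> C"
    using dsub_subset[OF assms(1)] dsub_subset[OF assms(2)] dsub_nonempty assms
    by (metis ex_in_conv r_one subset_iff, metis ex_in_conv l_one subset_iff)
qed

definition divisible_set :: "'a list set \<Rightarrow> bool" where
  "divisible_set A \<longleftrightarrow> (\<forall>x\<in>A. \<forall>m>0. \<exists>y\<in>A. y [^] (m :: nat) = x)"

lemma pow_image_subset: "dsub A \<Longrightarrow> (\<lambda>x. x [^] (m :: nat)) ` A \<subseteq> A"
  using dsub_pow by blast

text \<open>Among the definable subgroups of \<open>m\<close>-th powers, \<open>m > 0\<close>, a minimal one admits all roots.\<close>

lemma divisible_part:
  assumes A: "abelian A"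
  obtains m :: nat where "m > 0" "divisible_set ((\<lambda>x. x [^] m) ` A)"
proof -
  have "dsub ((\<lambda>x. x [^] (1 :: nat)) ` A)" by (rule dsub_pow_image[OF A])
  from minimal_dsub[OF this, of "\<lambda>H. \<exists>m > 0. H = (\<lambda>x. x [^] (m :: nat)) ` A"]
  obtain m :: nat where m: "m > 0"
    "\<And>L. dsub L \<Longrightarrow> \<exists>m > 0. L = (\<lambda>x. x [^] (m :: nat)) ` A \<Longrightarrow> L \<subseteq> (\<lambda>x. x [^] m) ` A
      \<Longrightarrow> L = (\<lambda>x. x [^] m) ` A" by (metis zero_less_one)
  have carr: "x \<in> carrier G" if "x \<in> A" for x using that dsub_subset[OF abelian_dsub[OF A]] by blast
  have "divisible_set ((\<lambda>x. x [^] m) ` A)"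
    unfolding divisible_set_def
  proof (intro ballI allI impI)
    fix x and l :: nat assume x: "x \<in> (\<lambda>x. x [^] m) ` A" and l: "l > 0"
    have "(\<lambda>x. x [^] (m * l)) ` A \<subseteq> (\<lambda>x. x [^] m) ` A"
    proof (rule image_subsetI)
      fix a assume "a \<in> A"
      moreover from this have "a [^] (m * l) = (a [^] l) [^] m"
        using carr by (simp add: nat_pow_pow mult.commute)
      ultimately show "a [^] (m * l) \<in> (\<lambda>x. x [^] m) ` A"
        using dsub_pow[OF abelian_dsub[OF A]] by blast
    qed
    then have "(\<lambda>x. x [^] (m * l)) ` A = (\<lambda>x. x [^] m) ` A"
      using m l by (intro m(2) dsub_pow_image A) (auto intro!: exI[of _ "m * l"])
    then obtain a where "a \<in> A" "x = a [^] (m * l)" using x by blast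
    then have "(a [^] m) [^] l = x" using carr by (simp add: nat_pow_pow)
    then show "\<exists>y\<in>(\<lambda>x. x [^] m) ` A. y [^] l = x" using \<open>a \<in> A\<close> by blast
  qed
  then show ?thesis by (rule that[OF m(1)])
qed

lemma pow_mem_if_finite_index:
  assumes H: "dsub H" and K: "dsub K" and fin: "\<not> infinite_index K H" and x: "x \<in> H"
  obtains m :: nat where "m > 0" "x [^] m \<in> K"
proof -
  have carr: "x \<in> carrier G" using x dsub_subset[OF H] by blast
  have "\<exists>i j :: nat. i \<noteq> j \<and> x [^] i \<otimes> inv (x [^] j) \<in> K"
    using fin dsub_pow[OF H x] unfolding infinite_index_def by blast
  then obtain i j :: nat where ij: "i \<noteq> j" "x [^] i \<otimes> inv (x [^] j) \<in> K" by blast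
  have diff: "x [^] (i - j) \<in> K" if "j < i" "x [^] i \<otimes> inv (x [^] j) \<in> K" for i j :: nat
    using that pow_diff[OF carr, of j i] by simp
  have "x [^] j \<otimes> inv (x [^] i) \<in> K"
    using subgroup.m_inv_closed[OF dsub_subgroup[OF K] ij(2)] carr by (simp add: inv_mult_group)
  then show ?thesis
    using ij diff[of i j] diff[of j i] that[of "i - j"] that[of "j - i"]
    by (metis linorder_neqE_nat zero_less_diff)
qed

lemma divisible_connected:
  assumes B: "dsub B" and "divisible_set B" and fa: "abelian B"
  shows "conn B"
  unfolding connected_iff
proof (intro conjI allI impI B)
  fix K assume K: "dsub K" "K \<subset> B"
  show "infinite_index K B"
  proof (rule ccontr)
    assume fin: "\<not> infinite_index K B"
    then have "finite (rcosets\<^bsub>G\<lparr>carrier := B\<rparr>\<^esub> K)"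
      using finite_rcosets_iff[of B K] K B dsub_subgroup by blast
    \<comment> \<open>The order of the finite group B/K kills B/K, but B is divisible.\<close>
    moreover interpret B: comm_group "G\<lparr>carrier := B\<rparr>"
      using fa definable_abelian_iff unfolding definable_abelian_def by blast
    have sub: "subgroup K (G\<lparr>carrier := B\<rparr>)"
      using subgroup_incl[OF dsub_subgroup[OF K(1)] dsub_subgroup[OF B]] K(2) by blast
    then interpret normal K "G\<lparr>carrier := B\<rparr>" using B.normal_iff_subgroup by simp
    let ?Q = "G\<lparr>carrier := B\<rparr> Mod K"
    interpret Q: group ?Q by (rule factorgroup_is_group)
    have fin: "finite (carrier ?Q)" using calculation by (simp add: FactGroup_def)
    have "x \<in> K" if "x \<in> B" for x
    proof -
      have "order ?Q > 0" using fin Q.order_gt_0_iff_finite by blast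
      then obtain y where y: "y \<in> B" "y [^] order ?Q = x"
        using assms(2) \<open>x \<in> B\<close> unfolding divisible_set_def by blast
      have "(K #>\<^bsub>G\<lparr>carrier := B\<rparr>\<^esub> y) [^]\<^bsub>?Q\<^esub> order ?Q = \<one>\<^bsub>?Q\<^esub>"
        by (rule Q.pow_order_eq_1) (use y(1) in \<open>auto simp: carrier_FactGroup\<close>)
      then have "K #>\<^bsub>G\<lparr>carrier := B\<rparr>\<^esub> x = K"
        using FactGroup_pow[of y "order ?Q"] y by (simp add: nat_pow_consistent[symmetric])
      then show ?thesis using B.rcos_self[OF _ sub, of x] that by auto
    qed
    then show False using K(2) by blast
  qed
qed

section \<open>Radicals of indecomposable abelian groups\<close>

lemma connected_dsub: "conn H \<Longrightarrow> dsub H"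
  by (simp add: connected_iff)

lemma connected_set_mult:
  assumes B: "conn B" and C: "conn C"
    and comm: "\<And>b c. b \<in> B \<Longrightarrow> c \<in> C \<Longrightarrow> b \<otimes> c = c \<otimes> b"
  shows "conn (B <#> C)"
  unfolding connected_iff
proof (intro conjI allI impI)
  note BC = connected_dsub[OF B] connected_dsub[OF C]
  show P: "dsub (B <#> C)" by (rule dsub_set_mult[OF BC comm])
  fix K assume K: "dsub K" "K \<subset> B <#> C"
  show "infinite_index K (B <#> C)"
  proof (rule ccontr)
    assume fin: "\<not> infinite_index K (B <#> C)"
    have absorb: "H \<subseteq> K" if H: "conn H" "H \<subseteq> B <#> C" for H
    proof (rule ccontr)
      assume "\<not> H \<subseteq> K"
      then have "infinite_index (K \<inter> H) H"
        using H(1) dsub_Int[OF K(1) connected_dsub[OF H(1)]] unfolding connected_iff by blast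
      then obtain y :: "nat \<Rightarrow> 'a list" where y: "\<And>i. y i \<in> H" "\<And>i j. i \<noteq> j \<Longrightarrow> y i \<otimes> inv (y j) \<notin> K \<inter> H"
        unfolding infinite_index_def by blast
      note S = dsub_subgroup[OF connected_dsub[OF H(1)]]
      have "y i \<otimes> inv (y j) \<in> H" for i j
        using y(1) subgroup.m_closed[OF S] subgroup.m_inv_closed[OF S] by blast
      then have "infinite_index K H" using y unfolding infinite_index_def by blast
      then show False using fin infinite_index_mono H(2) by blast
    qed
    have "B <#> C \<subseteq> K"
      by (rule set_mult_in_dsub[OF K(1)]) (use absorb B C subset_set_mult[OF BC] in blast)+
    then show False using K(2) by blast
  qed
qed

lemma connected_one: "conn {\<one>}"
  unfolding connected_iff using dsub_one dsub_nonempty by blast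

lemma indecomposable_set_mult:
  assumes "abelian A" "indec A" "dsub B" "B \<subset> A" "dsub C" "C \<subset> A"
  shows "B <#> C \<subset> A"
proof -
  have "B <#> C \<subseteq> A" using assms set_mult_in_dsub abelian_dsub by blast
  moreover have "B <#> C \<noteq> A" using assms unfolding indecomposable_def by blast
  ultimately show ?thesis by blast
qed

text \<open>Take \<open>J\<close> connected and proper of maximal rank.  For another such \<open>C\<close> the product \<open>CJ\<close> is proper, by
  indecomposability, and connected, so \<open>J\<close> has finite index in it by maximality and equals it by
  connectedness.\<close>

lemma greatest_connected_subgroup:
  assumes A: "abelian A" and ind: "indec A" and "A \<noteq> {\<one>}"
  obtains J where "conn J" "J \<subset> A"
    "\<And>C. conn C \<Longrightarrow> C \<subset> A \<Longrightarrow> C \<subseteq> J"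
proof -
  let ?P = "\<lambda>(J, m). conn J \<and> J \<subset> A \<and> rk_ge m J"
  have carr: "C \<subseteq> carrier G" if "C \<subset> A" for C
    using that dsub_subset[OF abelian_dsub[OF A]] by blast
  have "\<one> \<in> A" using subgroup.one_closed[OF dsub_subgroup[OF abelian_dsub[OF A]]] .
  then have "?P ({\<one>}, 0)"
    using connected_one assms(3) rk_ge_0[OF dsub_definable[OF dsub_one]] by auto
  moreover have "\<forall>p. ?P p \<longrightarrow> snd p < Suc n"
    using rk_ge_bound[OF dsub_definable[OF connected_dsub]] carr by (auto simp: less_Suc_eq_le)
  ultimately obtain p where p: "?P p" "\<And>q. ?P q \<Longrightarrow> snd q \<le> snd p"
    using ex_has_greatest_nat[of ?P "({\<one>}, 0)" snd "Suc n"] by blast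
  obtain J m where "p = (J, m)" by (cases p)
  with p have J: "conn J" "J \<subset> A" "rk_ge m J"
    and max: "\<And>C l. conn C \<Longrightarrow> C \<subset> A \<Longrightarrow> rk_ge l C \<Longrightarrow> l \<le> m" by force+
  have "C \<subseteq> J" if C: "conn C" "C \<subset> A" for C
  proof -
    note CJ = connected_dsub[OF C(1)] connected_dsub[OF J(1)]
    note proper = indecomposable_set_mult[OF A ind CJ(1) C(2) CJ(2) J(2)]
    have conn: "conn (C <#> J)"
      by (rule connected_set_mult[OF C(1) J(1)]) (use A C(2) J(2) in \<open>auto simp: abelian_def\<close>)
    have "J = C <#> J"
    proof (rule ccontr)
      assume "J \<noteq> C <#> J"
      then have "infinite_index J (C <#> J)"
        using conn subset_set_mult(2)[OF CJ] CJ(2) unfolding connected_iff by blast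
      then have "rk_ge (Suc m) (C <#> J)"
        using rk_ge_infinite_index[OF connected_dsub[OF conn] CJ(2) subset_set_mult(2)[OF CJ]] J(3) by blast
      then show False using max[OF conn proper] by fastforce
    qed
    then show ?thesis using subset_set_mult(1)[OF CJ] by simp
  qed
  then show ?thesis using that J(1,2) by blast
qed

text \<open>No proper definable subgroup of an indecomposable group has a definable supplement.\<close>

lemma radical_eqI:
  assumes A: "abelian A" and ind: "indec A"
    and J: "conn J" "J \<subset> A"
    and great: "\<And>C. conn C \<Longrightarrow> C \<subset> A \<Longrightarrow> C \<subseteq> J"
  shows "rad A = J"
proof -
  have unsup: "unsupplemented M k G A B \<longleftrightarrow> conn B \<and> B \<subset> A" for B
    using ind connected_dsub[of B]
    unfolding unsupplemented_def definable_supplement_def indecomposable_def by blast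
  show ?thesis
    unfolding radical_def
  proof (rule the_equality)
    show "unsupplemented M k G A J \<and> (\<forall>B. unsupplemented M k G A B \<and> J \<subseteq> B \<longrightarrow> B = J)"
      using J great unsup by blast
    show "J' = J" if "unsupplemented M k G A J' \<and> (\<forall>B. unsupplemented M k G A B \<and> J' \<subseteq> B \<longrightarrow> B = J')" for J'
      using that J great unsup by blast
  qed
qed

text \<open>The situation of an indecomposable abelian group \<open>A\<close> with radical \<open>J\<close> and torsion-free \<open>A/J\<close>, reduced
  to the two properties that are used: \<open>A/J\<close> is torsion-free, and \<open>J\<close> is the greatest proper definable
  subgroup, so that every nontrivial definable quotient of \<open>A\<close> maps onto \<open>A/J\<close>.\<close>

definition atom :: "'a list set \<Rightarrow> 'a list set \<Rightarrow> bool" where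
  "atom A J \<longleftrightarrow> abelian A \<and> dsub J \<and> J \<subset> A \<and> (\<forall>C. dsub C \<longrightarrow> C \<subset> A \<longrightarrow> C \<subseteq> J) \<and>
     (\<forall>a\<in>A. \<forall>m > 0. a [^] (m :: nat) \<in> J \<longrightarrow> a \<in> J)"

lemma atomD:
  assumes "atom A J"
  shows "abelian A" "dsub A" "dsub J" "J \<subset> A" "\<And>C. dsub C \<Longrightarrow> C \<subset> A \<Longrightarrow> C \<subseteq> J"
    "\<And>a m. a \<in> A \<Longrightarrow> (m :: nat) > 0 \<Longrightarrow> a [^] m \<in> J \<Longrightarrow> a \<in> J"
  using assms unfolding atom_def abelian_def by blast+

lemma torsion_free_quotient_iff:
  assumes A: "abelian A" and J: "dsub J" "J \<subseteq> A"
  shows "torsion_free (G\<lparr>carrier := A\<rparr> Mod J) \<longleftrightarrow>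
    (\<forall>a\<in>A. \<forall>m > 0. a [^] (m :: nat) \<in> J \<longrightarrow> a \<in> J)"
proof -
  interpret A: comm_group "G\<lparr>carrier := A\<rparr>"
    using A definable_abelian_iff unfolding definable_abelian_def by blast
  have sub: "subgroup J (G\<lparr>carrier := A\<rparr>)"
    using subgroup_incl[OF dsub_subgroup[OF J(1)] dsub_subgroup[OF abelian_dsub[OF A]] J(2)] .
  then interpret J: normal J "G\<lparr>carrier := A\<rparr>" using A.normal_iff_subgroup by simp
  have coset_eq: "J #>\<^bsub>G\<lparr>carrier := A\<rparr>\<^esub> a = J \<longleftrightarrow> a \<in> J" if "a \<in> A" for a
    using A.coset_join1[OF _ _ sub, of a] A.coset_join2[OF _ sub, of a] that J.subset by auto
  have pow: "(J #>\<^bsub>G\<lparr>carrier := A\<rparr>\<^esub> a) [^]\<^bsub>G\<lparr>carrier := A\<rparr> Mod J\<^esub> m = J \<longleftrightarrow> a [^] m \<in> J"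
    if "a \<in> A" for a and m :: nat
    using J.FactGroup_pow[of a m] that coset_eq[of "a [^] m"] dsub_pow[OF abelian_dsub[OF A] that]
    by (simp add: nat_pow_consistent[symmetric])
  have "torsion (G\<lparr>carrier := A\<rparr> Mod J) =
      {J #>\<^bsub>G\<lparr>carrier := A\<rparr>\<^esub> a | a. a \<in> A \<and> (\<exists>m > 0. a [^] (m :: nat) \<in> J)}"
    unfolding torsion_def using pow by (auto simp: carrier_FactGroup)
  also have "\<dots> = {J} \<longleftrightarrow> (\<forall>a\<in>A. \<forall>m > 0. a [^] (m :: nat) \<in> J \<longrightarrow> a \<in> J)"
  proof -
    have "\<one> \<in> A" "\<one> [^] (1 :: nat) \<in> J" "J #>\<^bsub>G\<lparr>carrier := A\<rparr>\<^esub> \<one> = J"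
      using subgroup.one_closed[OF dsub_subgroup[OF J(1)]] J(2) coset_eq[of \<one>] by auto
    then have "J \<in> {J #>\<^bsub>G\<lparr>carrier := A\<rparr>\<^esub> a | a. a \<in> A \<and> (\<exists>m > 0. a [^] (m :: nat) \<in> J)}"
      using zero_less_one by blast
    moreover have "{f a | a. Q a} = {c} \<longleftrightarrow> (\<forall>a. Q a \<longrightarrow> f a = c)" if "c \<in> {f a | a. Q a}"
      for f :: "'a list \<Rightarrow> 'a list set" and Q c
      using that by auto
    ultimately have "{J #>\<^bsub>G\<lparr>carrier := A\<rparr>\<^esub> a | a. a \<in> A \<and> (\<exists>m > 0. a [^] (m :: nat) \<in> J)} = {J} \<longleftrightarrow>
        (\<forall>a. a \<in> A \<and> (\<exists>m > 0. a [^] (m :: nat) \<in> J) \<longrightarrow> J #>\<^bsub>G\<lparr>carrier := A\<rparr>\<^esub> a = J)"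
      by blast
    also have "\<dots> \<longleftrightarrow> (\<forall>a. a \<in> A \<and> (\<exists>m > 0. a [^] (m :: nat) \<in> J) \<longrightarrow> a \<in> J)"
      by (intro all_cong1 imp_cong refl coset_eq) blast
    finally show ?thesis by auto
  qed
  finally show ?thesis by (simp add: torsion_free_def)
qed

text \<open>Given a proper definable \<open>C\<close>, choose a definable \<open>D \<le> C\<close> minimal with \<open>C/D\<close> a torsion group.  A
  definable subgroup of finite index in \<open>D\<close> has the same property, so \<open>D\<close> is connected and lies in the
  radical.  As \<open>A\<close> is torsion-free modulo the radical, \<open>C\<close> lies there too.\<close>

lemma atom_radical:
  assumes A: "abelian A" and "A \<noteq> {\<one>}" and ind: "indec A"
    and tf: "torsion_free (radical_quotient M k G A)"
  shows "atom A (rad A)"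
proof -
  obtain J where J: "conn J" "J \<subset> A"
    "\<And>C. conn C \<Longrightarrow> C \<subset> A \<Longrightarrow> C \<subseteq> J"
    using greatest_connected_subgroup[OF A ind assms(2)] by blast
  have rad: "rad A = J" by (rule radical_eqI[OF A ind J])
  have root: "a \<in> J" if "a \<in> A" "m > 0" "a [^] (m :: nat) \<in> J" for a m
    using tf torsion_free_quotient_iff[OF A connected_dsub[OF J(1)]] J(2) that
    unfolding radical_quotient_def rad by blast
  have "C \<subseteq> J" if C: "dsub C" "C \<subset> A" for C
  proof -
    define P where "P D \<longleftrightarrow> D \<subseteq> C \<and> (\<forall>c\<in>C. \<exists>m > 0. c [^] (m :: nat) \<in> D)" for D
    have carr: "c \<in> carrier G" if "c \<in> C" for c using that dsub_subset[OF C(1)] by blast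
    have "P C" using carr unfolding P_def by (auto intro!: exI[of _ "1 :: nat"])
    with C(1) have "\<exists>D. dsub D \<and> P D \<and> (\<forall>L. dsub L \<longrightarrow> P L \<longrightarrow> L \<subseteq> D \<longrightarrow> L = D)"
      by (rule minimal_dsub) (intro exI conjI allI impI)
    then obtain D where
      D: "dsub D" "P D" "\<forall>L. dsub L \<longrightarrow> P L \<longrightarrow> L \<subseteq> D \<longrightarrow> L = D"
      by (elim exE conjE) (rule that)
    have "conn D"
      unfolding connected_iff
    proof (intro conjI allI impI D(1))
      fix K assume K: "dsub K" "K \<subset> D"
      show "infinite_index K D"
      proof (rule ccontr)
        assume fin: "\<not> infinite_index K D"
        have "\<exists>m > 0. c [^] (m :: nat) \<in> K" if c: "c \<in> C" for c
        proof -
          obtain m :: nat where m: "m > 0" "c [^] m \<in> D" using D(2) c unfolding P_def by blast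
          obtain l :: nat where l: "l > 0" "(c [^] m) [^] l \<in> K"
            by (rule pow_mem_if_finite_index[OF D(1) K(1) fin m(2)])
          then show ?thesis
            using m(1) carr[OF that] by (auto simp: nat_pow_pow intro!: exI[of _ "m * l"])
        qed
        then have "P K" using K(2) D(2) unfolding P_def by blast
        then show False using D(3) K by blast
      qed
    qed
    moreover have "D \<subseteq> C" using D(2) unfolding P_def by blast
    ultimately have "D \<subseteq> J" using J(3) C(2) by blast
    then show ?thesis using D(2) root C(2) unfolding P_def by blast
  qed
  then show ?thesis
    unfolding atom_def rad using A J(2) connected_dsub[OF J(1)] root by blast
qed

section \<open>Reduced ranks\<close>

abbreviation coset_rel :: "'a list set \<Rightarrow> 'a list set \<Rightarrow> ('a list \<times> 'a list) set" where
  "coset_rel A J \<equiv> {(x, y). x \<in> A \<and> y \<in> A \<and> J #> x = J #> y}"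

lemma coset_rel_iff:
  assumes "dsub A" "dsub J"
  shows "(x, y) \<in> coset_rel A J \<longleftrightarrow> x \<in> A \<and> y \<in> A \<and> x \<otimes> inv y \<in> J"
  using rcos_eq_iff[OF dsub_subgroup[OF assms(2)]] dsub_subset[OF assms(1)] by blast

lemma definable_coset_rel:
  assumes "dsub A" "dsub J"
  shows "definable_rel M k (coset_rel A J)"
proof (rule definable_relI)
  show "coset_rel A J \<subseteq> carrier G \<times> carrier G" using dsub_subset[OF assms(1)] by blast
  have "dfn (\<lambda>\<sigma>. \<sigma> 0 \<in> A \<and> \<sigma> 1 \<in> A \<and> \<sigma> 0 \<otimes> inv (\<sigma> 1) \<in> J)"
    by (intro dfn_intros dsub_definable assms)
  then show "dfn (\<lambda>\<sigma>. (\<sigma> 0, \<sigma> 1) \<in> coset_rel A J)"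
    by (simp only: coset_rel_iff[OF assms])
qed

lemma equiv_coset_rel: "equiv A (coset_rel A J)"
  by (auto simp: equiv_def refl_on_def sym_def trans_def)

text \<open>The powers of an element outside the radical lie in distinct cosets, so the quotient has positive
  rank.\<close>

lemma reduced_rank_atom:
  assumes at: "atom A (rad A)"
  obtains r where "1 \<le> r" "r \<le> n" "rrank A = enat r"
proof -
  let ?J = "rad A"
  note A = atomD[OF at]
  note rel = definable_coset_rel[OF A(2,3)]
  obtain a where a: "a \<in> A" "a \<notin> ?J" using A(4) by blast
  have carr: "a \<in> carrier G" using a(1) dsub_subset[OF A(2)] by blast
  have diff: "a [^] i \<otimes> inv (a [^] j) \<notin> ?J" if "j < i" for i j :: nat
    using pow_diff[OF carr, of j i] A(6)[OF a(1), of "i - j"] a(2) that by auto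
  have "(a [^] i, a [^] j) \<notin> coset_rel A ?J" if "i \<noteq> j" for i j :: nat
  proof (cases "j < i")
    case True
    then show ?thesis using diff coset_rel_iff[OF A(2,3)] by simp
  next
    case False
    then have "(a [^] j, a [^] i) \<notin> coset_rel A ?J"
      using that diff[of i j] coset_rel_iff[OF A(2,3)] by simp
    then show ?thesis by auto
  qed
  then have "enat 1 \<le> rrank A"
    unfolding reduced_rank_def using dsub_pow[OF A(2) a(1)]
    by (intro quotient_rank_infinite[where y = "\<lambda>i. a [^] i"] dsub_definable A rel equiv_coset_rel) auto
  moreover have "rrank A \<le> enat n"
    unfolding reduced_rank_def
    by (intro quotient_rank_le dsub_definable A rel equiv_coset_rel)
      (use rk_ge_bound[OF dsub_definable[OF A(2)] dsub_subset[OF A(2)]] in blast)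
  ultimately show ?thesis
    using that by (cases "rrank A") auto
qed

text \<open>\<open>R\<close> is a definable subgroup of \<open>A \<times> B\<close> that, as in Goursat's lemma, is the graph of an isomorphism
  between quotients of \<open>A\<close> and \<open>B\<close> by subgroups of the radicals.  It matches the radicals themselves,
  because these are the greatest proper definable subgroups.\<close>

lemma reduced_rank_cong:
  assumes A: "atom A (rad A)" and B: "atom B (rad B)"
    and R: "R \<subseteq> A \<times> B" "dfn (\<lambda>\<sigma>. (\<sigma> 0, \<sigma> 1) \<in> R)"
    and one: "(\<one>, \<one>) \<in> R"
    and diff: "\<And>a b a' b'. (a, b) \<in> R \<Longrightarrow> (a', b') \<in> R \<Longrightarrow> (a \<otimes> inv a', b \<otimes> inv b') \<in> R"
    and total: "\<And>a. a \<in> A \<Longrightarrow> \<exists>b. (a, b) \<in> R" and onto: "\<And>b. b \<in> B \<Longrightarrow> \<exists>a. (a, b) \<in> R"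
    and left: "\<And>a. (a, \<one>) \<in> R \<Longrightarrow> a \<in> rad A"
    and right: "\<And>b. (\<one>, b) \<in> R \<Longrightarrow> b \<in> rad B"
  shows "rrank A = rrank B"
proof -
  \<comment> \<open>R carries the greatest proper definable subgroup of A into that of B: its image is a definable
    subgroup of B, and were it all of B, then A would be the product of its radical and of the
    kernel of R, which also lies in the radical.\<close>
  have radical_image: "b \<in> J'"
    if A: "atom A J" and B: "atom B J'" and R: "R \<subseteq> A \<times> B" "dfn (\<lambda>\<sigma>. (\<sigma> 0, \<sigma> 1) \<in> R)"
      and one: "(\<one>, \<one>) \<in> R"
      and diff: "\<And>a b a' b'. (a, b) \<in> R \<Longrightarrow> (a', b') \<in> R \<Longrightarrow> (a \<otimes> inv a', b \<otimes> inv b') \<in> R"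
      and total: "\<And>a. a \<in> A \<Longrightarrow> \<exists>b. (a, b) \<in> R" and left: "\<And>a. (a, \<one>) \<in> R \<Longrightarrow> a \<in> J"
      and ab: "(a, b) \<in> R" "a \<in> J"
    for A B J J' R a b
  proof -
    note A = atomD[OF A] and B = atomD[OF B]
    note SA = dsub_subgroup[OF A(2)] and SB = dsub_subgroup[OF B(2)] and SJ = dsub_subgroup[OF A(3)]
    define I where "I = {b. \<exists>a\<in>J. (a, b) \<in> R}"
    have "I \<subseteq> B" using R(1) by (auto simp: I_def)
    have "dsub I"
    proof (rule dsubI)
      show "subgroup I G"
      proof (rule subgroupI)
        show "I \<subseteq> carrier G" using \<open>I \<subseteq> B\<close> dsub_subset[OF B(2)] by blast
        have "\<one> \<in> I" using one subgroup.one_closed[OF SJ] by (auto simp: I_def)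
        then show "I \<noteq> {}" by blast
        have quot: "x \<otimes> inv y \<in> I" if "x \<in> I" "y \<in> I" for x y
        proof -
          obtain a a' where "a \<in> J" "(a, x) \<in> R" "a' \<in> J" "(a', y) \<in> R"
            using \<open>x \<in> I\<close> \<open>y \<in> I\<close> by (auto simp: I_def)
          then have "a \<otimes> inv a' \<in> J" "(a \<otimes> inv a', x \<otimes> inv y) \<in> R"
            using diff subgroup.m_closed[OF SJ] subgroup.m_inv_closed[OF SJ] by blast+
          then show ?thesis unfolding I_def by blast
        qed
        have carr: "x \<in> carrier G" if "x \<in> I" for x
          using that \<open>I \<subseteq> carrier G\<close> by blast
        show inv: "inv x \<in> I" if "x \<in> I" for x
          using quot[OF \<open>\<one> \<in> I\<close> that] carr[OF that] by simp
        show "x \<otimes> y \<in> I" if "x \<in> I" "y \<in> I" for x y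
          using quot[OF that(1) inv[OF that(2)]] carr[OF that(2)] by simp
      qed
      have "dfn (\<lambda>\<sigma>. (\<sigma> 1, \<sigma> 0) \<in> R)"
        using dfn_ren[OF R(2), of "\<lambda>i. if i = 0 then 1 else if i = 1 then 0 else i"]
        by (simp add: inj_def split: if_splits)
      then have "dfn (\<lambda>\<sigma>. \<exists>a\<in>J. (a, \<sigma> 0) \<in> R)"
        using dfn_ren[OF R(2), of id]
        by (intro dfn_bex dsub_definable A(3) dsub_subset) simp
      then show "dfn (\<lambda>\<sigma>. \<sigma> 0 \<in> I)" by (simp add: I_def)
    qed
    moreover have "I \<noteq> B"
    proof
      assume "I = B"
      have "x \<in> J" if x: "x \<in> A" for x
      proof -
        obtain y where y: "(x, y) \<in> R" using total[OF x] by blast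
        then have "y \<in> I" using R(1) \<open>I = B\<close> by blast
        then obtain x' where x': "x' \<in> J" "(x', y) \<in> R" by (auto simp: I_def)
        have carr: "x \<in> carrier G" "x' \<in> carrier G" "y \<in> carrier G"
          using y x x' R(1) dsub_subset[OF A(2)] dsub_subset[OF A(3)] dsub_subset[OF B(2)] by blast+
        have "x \<otimes> inv x' \<in> J" using left diff[OF y x'(2)] carr by simp
        then have "x \<otimes> inv x' \<otimes> x' \<in> J" by (rule subgroup.m_closed[OF SJ _ x'(1)])
        then show ?thesis using carr by (simp add: m_assoc)
      qed
      then show False using A(4) by blast
    qed
    ultimately have "I \<subseteq> J'" using B(5) \<open>I \<subseteq> B\<close> by blast
    then show ?thesis using ab by (auto simp: I_def)
  qed
  have dfn_conv: "dfn (\<lambda>\<sigma>. (\<sigma> 0, \<sigma> 1) \<in> R\<inverse>)"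
    using dfn_ren[OF R(2), of "\<lambda>i. if i = 0 then 1 else if i = 1 then 0 else i"]
    by (simp add: inj_def split: if_splits)
  have match: "a \<in> rad A \<longleftrightarrow> b \<in> rad B" if "(a, b) \<in> R" for a b
  proof
    show "b \<in> rad B" if "a \<in> rad A"
      by (rule radical_image[OF A B R one diff total left \<open>(a, b) \<in> R\<close> that])
    show "a \<in> rad A" if "b \<in> rad B"
      by (rule radical_image[OF B A _ dfn_conv _ _ _ _ _ that])
        (use R(1) one diff onto right \<open>(a, b) \<in> R\<close> in auto)
  qed
  note a = atomD[OF A] and b = atomD[OF B]
  show ?thesis
    unfolding reduced_rank_def
  proof (rule quotient_rank_cong[where R = R])
    show "definable_rel M k R"
      by (rule definable_relI[OF _ R(2)]) (use R(1) dsub_subset[OF a(2)] dsub_subset[OF b(2)] in blast)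
    show "(x, x') \<in> coset_rel A (rad A) \<longleftrightarrow> (y, y') \<in> coset_rel B (rad B)"
      if "(x, y) \<in> R" "(x', y') \<in> R" for x x' y y'
      unfolding coset_rel_iff[OF a(2,3)] coset_rel_iff[OF b(2,3)]
      using match[OF diff[OF that]] that R(1) by blast
  qed (use a b dsub_definable definable_coset_rel equiv_coset_rel R(1) total onto in auto)
qed

section \<open>Divisible abelian subgroups\<close>

text \<open>The \<open>m\<close>-th powers in the hull form a definable subgroup that still contains the torsion of \<open>A\<close>.\<close>

lemma torsion_hull_divisible:
  assumes A: "abelian A" and "divisible_set A"
  shows "divisible_set (dhull (torsion G \<inter> A))"
    and "dhull (torsion G \<inter> A) \<subseteq> A"
proof -
  let ?B = "dhull (torsion G \<inter> A)"
  have carr: "torsion G \<inter> A \<subseteq> carrier G" by (auto simp: torsion_def)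
  note B = definable_hull_least[OF carr]
  show BA: "?B \<subseteq> A" by (rule B(3)[OF abelian_dsub[OF A]]) simp
  have abel: "abelian ?B" by (rule abelian_subset[OF A B(1) BA])
  have "(\<lambda>x. x [^] m) ` ?B = ?B" if "m > 0" for m :: nat
  proof
    show "(\<lambda>x. x [^] m) ` ?B \<subseteq> ?B" by (rule pow_image_subset[OF B(1)])
    have "torsion G \<inter> A \<subseteq> (\<lambda>x. x [^] m) ` ?B"
    proof
      fix x assume x: "x \<in> torsion G \<inter> A"
      then obtain y where y: "y \<in> A" "y [^] m = x"
        using assms(2) \<open>m > 0\<close> unfolding divisible_set_def by blast
      have "y \<in> carrier G" using y(1) dsub_subset[OF abelian_dsub[OF A]] by blast
      moreover obtain l :: nat where "l > 0" "x [^] l = \<one>" using x by (auto simp: torsion_def)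
      ultimately have "y [^] (m * l) = \<one>" "m * l > 0"
        using y(2) \<open>m > 0\<close> by (auto simp: nat_pow_pow[symmetric])
      then have "y \<in> torsion G" using \<open>y \<in> carrier G\<close> unfolding torsion_def by blast
      then show "x \<in> (\<lambda>x. x [^] m) ` ?B" using y B(2) by blast
    qed
    then show "?B \<subseteq> (\<lambda>x. x [^] m) ` ?B" by (rule B(3)[OF dsub_pow_image[OF abel]])
  qed
  then have "\<exists>y\<in>?B. y [^] m = x" if "x \<in> ?B" "m > 0" for x and m :: nat
    using that by (metis imageE)
  then show "divisible_set ?B" unfolding divisible_set_def by simp
qed

text \<open>The quotient of two \<open>m\<close>-th roots of the same element is a torsion element.\<close>

lemma root_mem_of_torsion:
  assumes A: "abelian A" and D: "dsub D" "D \<subseteq> A" and T: "torsion G \<inter> A \<subseteq> D"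
    and "x \<in> A" "d \<in> D" "m > 0" "x [^] m = d [^] (m :: nat)"
  shows "x \<in> D"
proof -
  note S = dsub_subgroup[OF abelian_dsub[OF A]]
  have carr: "x \<in> carrier G" "d \<in> carrier G"
    using assms dsub_subset[OF abelian_dsub[OF A]] by blast+
  have inA: "d \<in> A" "inv d \<in> A" using assms subgroup.m_inv_closed[OF S] by blast+
  then have "(x \<otimes> inv d) [^] m = x [^] m \<otimes> (inv d) [^] m"
    using A \<open>x \<in> A\<close> carr by (intro pow_mult_distrib) (auto simp: abelian_def)
  also have "\<dots> = \<one>" using assms(8) carr by (simp add: nat_pow_inv)
  finally have "x \<otimes> inv d \<in> torsion G \<inter> A"
    using carr \<open>m > 0\<close> subgroup.m_closed[OF S \<open>x \<in> A\<close> inA(2)] unfolding torsion_def by auto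
  then have "x \<otimes> inv d \<otimes> d \<in> D" using T subgroup.m_closed[OF dsub_subgroup[OF D(1)]] assms(6) by blast
  then show ?thesis using carr by (simp add: m_assoc)
qed

text \<open>A power subgroup \<open>D\<close> of \<open>C\<close> is divisible.  It still contains the hull of the torsion, which is
  divisible, so an \<open>m\<close>-th root in \<open>C\<close> of an element of \<open>D\<close> lies in \<open>D\<close>: hence \<open>D = C\<close>.\<close>

lemma divisible_if_torsion_subset:
  assumes A: "abelian A" and "divisible_set A"
    and C: "dsub C" "C \<subseteq> A" "dhull (torsion G \<inter> A) \<subseteq> C"
  shows "divisible_set C"
proof -
  let ?B = "dhull (torsion G \<inter> A)"
  have T: "torsion G \<inter> A \<subseteq> ?B" by (rule definable_hull_least) (auto simp: torsion_def)
  have abel: "abelian C" by (rule abelian_subset[OF A C(1,2)])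
  obtain m :: nat where m: "m > 0" "divisible_set ((\<lambda>x. x [^] m) ` C)"
    by (rule divisible_part[OF abel])
  let ?D = "(\<lambda>x. x [^] m) ` C"
  note D = dsub_pow_image[OF abel, of m] pow_image_subset[OF C(1), of m]
  have "?B \<subseteq> ?D"
  proof
    fix x assume "x \<in> ?B"
    then obtain y where "y \<in> ?B" "y [^] m = x"
      using torsion_hull_divisible(1)[OF A assms(2)] m(1) unfolding divisible_set_def by blast
    then show "x \<in> ?D" using C(3) by blast
  qed
  then have TD: "torsion G \<inter> A \<subseteq> ?D" using T by blast
  have "x \<in> ?D" if x: "x \<in> C" for x
  proof -
    have "x [^] m \<in> ?D" using x by blast
    then obtain d where "d \<in> ?D" "d [^] m = x [^] m"
      using m unfolding divisible_set_def by meson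
    then show ?thesis
      using root_mem_of_torsion[OF A D(1) _ TD, of x d m] D(2) C(2) x m(1) by auto
  qed
  then have "?D = C" using D(2) by blast
  then show ?thesis using m(2) by simp
qed

text \<open>The hull of the torsion is divisible, thus connected, and so it lies in the radical; the radical is
  therefore divisible and contains all torsion, whence the quotient is torsion-free.\<close>

lemma divisible_indecomposable_atom:
  assumes A: "abelian A" and div: "divisible_set A" and ind: "indec A"
    and "dhull (torsion G \<inter> A) \<noteq> A"
  shows "A \<noteq> {\<one>}" and "torsion_free (radical_quotient M k G A)"
proof -
  let ?B = "dhull (torsion G \<inter> A)"
  have carr: "torsion G \<inter> A \<subseteq> carrier G" by (auto simp: torsion_def)
  note B = definable_hull_least[OF carr] and BA = torsion_hull_divisible(2)[OF A div]
  show ne: "A \<noteq> {\<one>}"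
    using assms(4) BA dsub_nonempty[OF B(1)] by blast
  obtain J where J: "conn J" "J \<subset> A"
    "\<And>C. conn C \<Longrightarrow> C \<subset> A \<Longrightarrow> C \<subseteq> J"
    using greatest_connected_subgroup[OF A ind ne] by blast
  have rad: "rad A = J" by (rule radical_eqI[OF A ind J])
  have "conn ?B"
    by (rule divisible_connected[OF B(1) torsion_hull_divisible(1)[OF A div] abelian_subset[OF A B(1) BA]])
  then have BJ: "?B \<subseteq> J" using J(3) BA assms(4) by blast
  note dJ = connected_dsub[OF J(1)]
  have "divisible_set J"
    by (rule divisible_if_torsion_subset[OF A div dJ _ BJ]) (use J(2) in blast)
  then have "a \<in> J" if a: "a \<in> A" "m > 0" "a [^] (m :: nat) \<in> J" for a m
  proof -
    obtain d where "d \<in> J" "d [^] m = a [^] m"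
      using \<open>divisible_set J\<close> a(2,3) unfolding divisible_set_def by meson
    then show ?thesis
      using root_mem_of_torsion[OF A dJ _ _ a(1) _ a(2), of d] B(2) BJ J(2) by auto
  qed
  then show "torsion_free (radical_quotient M k G A)"
    unfolding radical_quotient_def rad using torsion_free_quotient_iff[OF A dJ] J(2) by blast
qed

lemma subset_U0:
  assumes A: "abelian A" and "A \<noteq> {\<one>}" and "indec A"
    and "torsion_free (radical_quotient M k G A)"
  obtains r where "1 \<le> r" "r \<le> n" "A \<subseteq> U0 M N h k G r"
proof -
  obtain r where r: "1 \<le> r" "r \<le> n" "rrank A = enat r"
    by (rule reduced_rank_atom[OF atom_radical[OF assms]])
  have "A \<subseteq> U0 M N h k G r"
    unfolding U0_def using assms r(3) definable_abelian_iff by (blast intro: generate.incl)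
  then show ?thesis by (rule that[OF r(1,2)])
qed

text \<open>Definable subgroups \<open>A1\<close> and \<open>A2\<close> that decompose a divisible group may be replaced by divisible subgroups of
  powers, since every element of \<open>A\<close> is itself an arbitrarily high power.\<close>

lemma divisible_abelian_subset:
  assumes W: "subgroup W G" and T: "dhull (torsion G) \<subseteq> W"
    and U: "\<And>r. 1 \<le> r \<Longrightarrow> r \<le> n \<Longrightarrow> U0 M N h k G r \<subseteq> W"
    and "abelian A" "divisible_set A"
  shows "A \<subseteq> W"
  using assms(4,5)
proof (induction A rule: wf_induct_rule[OF wf_dsub])
  case (1 A)
  note A = 1(2) and div = 1(3)
  have carr: "x \<in> carrier G" if "x \<in> A" for x
    using that dsub_subset[OF abelian_dsub[OF A]] by blast
  show ?case
  proof (cases "indec A")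
    case ind: True
    show ?thesis
    proof (cases "dhull (torsion G \<inter> A) = A")
      case True
      have carr: "torsion G \<subseteq> carrier G" "torsion G \<inter> A \<subseteq> carrier G" by (auto simp: torsion_def)
      have "dhull (torsion G \<inter> A) \<subseteq> dhull (torsion G)"
        using definable_hull_least(3)[OF carr(2) definable_hull_least(1)[OF carr(1)]]
          definable_hull_least(2)[OF carr(1)] by blast
      then show ?thesis using True T by blast
    next
      case False
      show ?thesis
        by (rule subset_U0[OF A divisible_indecomposable_atom(1)[OF A div ind False] ind
              divisible_indecomposable_atom(2)[OF A div ind False]]) (use U in blast)
    qed
  next
    case False
    then obtain A1 A2 where A12: "dsub A1" "A1 \<subset> A" "dsub A2" "A2 \<subset> A" "A1 <#> A2 = A"
      unfolding indecomposable_def by blast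
    have abel: "abelian A1" "abelian A2" using A12 abelian_subset[OF A] by blast+
    obtain m1 :: nat where m1: "m1 > 0" "divisible_set ((\<lambda>x. x [^] m1) ` A1)"
      by (rule divisible_part[OF abel(1)])
    obtain m2 :: nat where m2: "m2 > 0" "divisible_set ((\<lambda>x. x [^] m2) ` A2)"
      by (rule divisible_part[OF abel(2)])
    have small: "(\<lambda>x. x [^] m) ` C \<subseteq> W" if "abelian C" "C \<subset> A" "divisible_set ((\<lambda>x. x [^] m) ` C)"
      for C and m :: nat
    proof (rule 1(1))
      have sub: "(\<lambda>x. x [^] m) ` C \<subseteq> C" by (rule pow_image_subset[OF abelian_dsub[OF that(1)]])
      show "((\<lambda>x. x [^] m) ` C, A) \<in> {(H, K). dsub H \<and> dsub K \<and> H \<subset> K}"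
        using dsub_pow_image[OF that(1)] sub that(2) abelian_dsub[OF A] by blast
      show "abelian ((\<lambda>x. x [^] m) ` C)"
        by (rule abelian_subset[OF that(1) dsub_pow_image[OF that(1)] sub])
    qed fact
    show ?thesis
    proof
      fix x assume "x \<in> A"
      then obtain y where y: "y \<in> A" "y [^] (m1 * m2) = x"
        using div m1(1) m2(1) unfolding divisible_set_def by (meson nat_0_less_mult_iff)
      then obtain a b where ab: "a \<in> A1" "b \<in> A2" "y = a \<otimes> b"
        using A12(5) unfolding set_mult_def by blast
      have inA: "a \<in> A" "b \<in> A" using ab A12 by blast+
      have "x = a [^] (m1 * m2) \<otimes> b [^] (m1 * m2)"
        unfolding y(2)[symmetric] ab(3)
        by (rule pow_mult_distrib) (use A inA carr in \<open>auto simp: abelian_def\<close>)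
      also have "\<dots> = (a [^] m2) [^] m1 \<otimes> (b [^] m1) [^] m2"
        using carr inA by (simp add: nat_pow_pow mult.commute)
      also have "\<dots> \<in> W"
        using small[OF abel(1) A12(2) m1(2)] small[OF abel(2) A12(4) m2(2)]
          dsub_pow[OF A12(1) ab(1), of m2] dsub_pow[OF A12(3) ab(2), of m1]
        by (intro subgroup.m_closed[OF W]) blast+
      finally show "x \<in> W" .
    qed
  qed
qed

end

section \<open>Commutators modulo a normal subgroup\<close>

definition comm :: "('c, 'd) monoid_scheme \<Rightarrow> 'c \<Rightarrow> 'c \<Rightarrow> 'c" where
  "comm G x y = x \<otimes>\<^bsub>G\<^esub> y \<otimes>\<^bsub>G\<^esub> inv\<^bsub>G\<^esub> x \<otimes>\<^bsub>G\<^esub> inv\<^bsub>G\<^esub> y"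

context group
begin

lemma comm_closed [simp]: "x \<in> carrier G \<Longrightarrow> y \<in> carrier G \<Longrightarrow> comm G x y \<in> carrier G"
  by (simp add: comm_def)

lemma comm_mult:
  assumes "x \<in> carrier G" "y \<in> carrier G"
  shows "comm G x y \<otimes> (y \<otimes> x) = x \<otimes> y"
proof -
  have "comm G x y \<otimes> (y \<otimes> x) = x \<otimes> y \<otimes> (inv x \<otimes> ((inv y \<otimes> y) \<otimes> x))"
    unfolding comm_def using assms by (simp only: m_assoc m_closed inv_closed)
  then show ?thesis using assms by simp
qed

lemma comm_one_iff:
  assumes "x \<in> carrier G" "y \<in> carrier G"
  shows "comm G x y = \<one> \<longleftrightarrow> x \<otimes> y = y \<otimes> x"
  using comm_mult[OF assms] assms by (metis comm_closed l_one m_closed r_cancel_one)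

lemma commute_mult:
  assumes "x \<otimes> y = y \<otimes> x" "x \<otimes> z = z \<otimes> x" "x \<in> carrier G" "y \<in> carrier G" "z \<in> carrier G"
  shows "x \<otimes> (y \<otimes> z) = (y \<otimes> z) \<otimes> x"
  using assms by (metis m_assoc)

lemma commute_inv:
  assumes "x \<otimes> y = y \<otimes> x" "x \<in> carrier G" "y \<in> carrier G"
  shows "x \<otimes> inv y = inv y \<otimes> x"
  using assms by (metis inv_closed inv_solve_left inv_solve_right m_assoc m_closed)

lemma subgroup_centralizer:
  assumes T: "T \<subseteq> carrier G"
  shows "subgroup {y \<in> carrier G. \<forall>x\<in>T. x \<otimes> y = y \<otimes> x} G" (is "subgroup ?C G")
proof (rule subgroupI)
  show "inv y \<in> ?C" if "y \<in> ?C" for y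
    using that commute_inv[OF _ subsetD[OF T]] by simp
  show "y \<otimes> z \<in> ?C" if "y \<in> ?C" "z \<in> ?C" for y z
    using that commute_mult[OF _ _ subsetD[OF T]] by simp
  have "x \<otimes> \<one> = \<one> \<otimes> x" if "x \<in> T" for x using that T by (simp add: subset_iff)
  then have "\<one> \<in> ?C" by blast
  then show "?C \<noteq> {}" by blast
qed blast

lemma generate_commutes:
  assumes S: "S \<subseteq> carrier G" and S': "S' \<subseteq> carrier G"
    and comm: "\<And>x y. x \<in> S \<Longrightarrow> y \<in> S' \<Longrightarrow> x \<otimes> y = y \<otimes> x"
    and x: "x \<in> generate G S" and y: "y \<in> generate G S'"
  shows "x \<otimes> y = y \<otimes> x"
proof -
  have "generate G S' \<subseteq> {y \<in> carrier G. \<forall>x\<in>S. x \<otimes> y = y \<otimes> x}"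
    by (rule generate_subgroup_incl[OF _ subgroup_centralizer[OF S]]) (use S' comm in blast)
  then have "S \<subseteq> {x \<in> carrier G. \<forall>y\<in>generate G S'. y \<otimes> x = x \<otimes> y}"
    using S by (auto simp: subset_iff)
  then have "generate G S \<subseteq> {x \<in> carrier G. \<forall>y\<in>generate G S'. y \<otimes> x = x \<otimes> y}"
    by (rule generate_subgroup_incl[OF _ subgroup_centralizer[OF generate_incl[OF S']]])
  then have "y \<otimes> x = x \<otimes> y" using x y by blast
  then show ?thesis by simp
qed

lemma inv_comm_eq:
  assumes "x \<in> carrier G" "y \<in> carrier G"
  shows "inv (comm G x y) = comm G y x"
  using assms by (simp add: comm_def inv_mult_group m_assoc)

text \<open>Commutators are multiplicative in each argument as far as they are central; these identities are applied
  in quotients of \<open>G\<close>.\<close>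

lemma comm_mult_right:
  assumes "a \<in> carrier G" "b \<in> carrier G" "b' \<in> carrier G"
    and central: "\<And>z. z \<in> carrier G \<Longrightarrow> comm G a b' \<otimes> z = z \<otimes> comm G a b'"
  shows "comm G a (b \<otimes> b') = comm G a b \<otimes> comm G a b'"
proof -
  let ?z = "comm G a b'"
  have z: "a \<otimes> b' = ?z \<otimes> (b' \<otimes> a)" "?z \<in> carrier G" using comm_mult assms by auto
  have "comm G a b \<otimes> ?z \<otimes> ((b \<otimes> b') \<otimes> a) = comm G a b \<otimes> (b \<otimes> (?z \<otimes> (b' \<otimes> a)))"
    using assms z(2) central[of b] by (simp add: m_assoc[symmetric]) (simp add: m_assoc)
  also have "\<dots> = comm G a b \<otimes> (b \<otimes> a) \<otimes> b'"
    using assms unfolding z(1)[symmetric] by (simp add: m_assoc)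
  also have "\<dots> = a \<otimes> (b \<otimes> b')" using comm_mult[OF assms(1,2)] assms by (simp add: m_assoc)
  also have "\<dots> = comm G a (b \<otimes> b') \<otimes> ((b \<otimes> b') \<otimes> a)" using comm_mult assms by simp
  finally show ?thesis using assms by simp
qed

lemma comm_mult_left:
  assumes "a \<in> carrier G" "a' \<in> carrier G" "b \<in> carrier G"
    and central: "\<And>z. z \<in> carrier G \<Longrightarrow> comm G a' b \<otimes> z = z \<otimes> comm G a' b"
  shows "comm G (a \<otimes> a') b = comm G a b \<otimes> comm G a' b"
proof -
  have "comm G b a' \<otimes> z = z \<otimes> comm G b a'" if "z \<in> carrier G" for z
    using central[OF inv_closed[OF that]] that assms(2,3)
    by (metis comm_closed inv_closed inv_comm_eq inv_inv inv_mult_group)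
  then have "comm G b (a \<otimes> a') = comm G b a \<otimes> comm G b a'"
    by (rule comm_mult_right[OF assms(3,1,2)])
  then have "comm G (a \<otimes> a') b = comm G a' b \<otimes> comm G a b"
    using assms by (metis comm_closed inv_comm_eq inv_mult_group m_closed)
  then show ?thesis using central[of "comm G a b"] assms by simp
qed

end

context normal
begin

lemma Mod_mem: "x \<in> carrier G \<Longrightarrow> H #> x \<in> carrier (G Mod H)"
  by (auto simp: carrier_FactGroup)

lemma Mod_mult: "x \<in> carrier G \<Longrightarrow> y \<in> carrier G \<Longrightarrow> H #> (x \<otimes> y) = (H #> x) \<otimes>\<^bsub>G Mod H\<^esub> (H #> y)"
  by (simp add: rcos_sum)

lemma Mod_inv: "x \<in> carrier G \<Longrightarrow> H #> (inv x) = inv\<^bsub>G Mod H\<^esub> (H #> x)"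
  using inv_FactGroup[of "H #> x"] rcos_inv[of x] Mod_mem[of x] by simp

lemma Mod_comm:
  assumes "x \<in> carrier G" "y \<in> carrier G"
  shows "H #> comm G x y = comm (G Mod H) (H #> x) (H #> y)"
  using assms by (simp add: comm_def Mod_mult Mod_inv del: mult_FactGroup)

lemma Mod_eq_one_iff: "x \<in> carrier G \<Longrightarrow> H #> x = \<one>\<^bsub>G Mod H\<^esub> \<longleftrightarrow> x \<in> H"
  using coset_join1[OF _ _ subgroup_axioms] coset_join2[OF _ subgroup_axioms] by auto

lemma Mod_eq_iff:
  assumes "x \<in> carrier G" "y \<in> carrier G"
  shows "H #> x = H #> y \<longleftrightarrow> x \<otimes> inv y \<in> H"
  by (rule rcos_eq_iff[OF subgroup_axioms assms])

lemma comm_mem_iff: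
  assumes "x \<in> carrier G" "y \<in> carrier G"
  shows "comm G x y \<in> H \<longleftrightarrow> (H #> x) \<otimes>\<^bsub>G Mod H\<^esub> (H #> y) = (H #> y) \<otimes>\<^bsub>G Mod H\<^esub> (H #> x)"
  using Mod_eq_one_iff[of "comm G x y"] Mod_comm[OF assms] assms
    group.comm_one_iff[OF factorgroup_is_group Mod_mem Mod_mem] by simp

lemma comm_sym: "x \<in> carrier G \<Longrightarrow> y \<in> carrier G \<Longrightarrow> comm G x y \<in> H \<longleftrightarrow> comm G y x \<in> H"
  using comm_mem_iff by metis

text \<open>The preimage of the center of \<open>G Mod H\<close>.\<close>

definition central_mod :: "'a set" where
  "central_mod = {z \<in> carrier G. \<forall>y\<in>carrier G. comm G z y \<in> H}"

lemma central_mod_commutes: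
  assumes "z \<in> central_mod" and "q \<in> carrier (G Mod H)"
  shows "(H #> z) \<otimes>\<^bsub>G Mod H\<^esub> q = q \<otimes>\<^bsub>G Mod H\<^esub> (H #> z)"
  using assms comm_mem_iff by (auto simp: central_mod_def carrier_FactGroup)

lemma Mod_comm_mult_right:
  assumes "a \<in> carrier G" "b \<in> carrier G" "b' \<in> carrier G" "comm G a b' \<in> central_mod"
  shows "H #> comm G a (b \<otimes> b') = (H #> comm G a b) \<otimes>\<^bsub>G Mod H\<^esub> (H #> comm G a b')"
proof -
  interpret Q: group "G Mod H" by (rule factorgroup_is_group)
  show ?thesis
    using Q.comm_mult_right[of "H #> a" "H #> b" "H #> b'"] central_mod_commutes[OF assms(4)] assms(1-3)
    by (simp add: Mod_comm Mod_mult Mod_mem del: mult_FactGroup)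
qed

lemma Mod_comm_mult_left:
  assumes "a \<in> carrier G" "a' \<in> carrier G" "b \<in> carrier G" "comm G a' b \<in> central_mod"
  shows "H #> comm G (a \<otimes> a') b = (H #> comm G a b) \<otimes>\<^bsub>G Mod H\<^esub> (H #> comm G a' b)"
proof -
  interpret Q: group "G Mod H" by (rule factorgroup_is_group)
  show ?thesis
    using Q.comm_mult_left[of "H #> a" "H #> a'" "H #> b"] central_mod_commutes[OF assms(4)] assms(1-3)
    by (simp add: Mod_comm Mod_mult Mod_mem del: mult_FactGroup)
qed

lemma comm_one_right: "a \<in> carrier G \<Longrightarrow> comm G a \<one> = \<one>"
  by (simp add: comm_one_iff)

lemma comm_one_left: "b \<in> carrier G \<Longrightarrow> comm G \<one> b = \<one>"
  by (simp add: comm_one_iff)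

lemma Mod_one: "H #> \<one> = \<one>\<^bsub>G Mod H\<^esub>"
  using Mod_eq_one_iff[of \<one>] one_closed by simp

lemma Mod_comm_pow_right:
  assumes "a \<in> carrier G" "b \<in> carrier G" "comm G a b \<in> central_mod"
  shows "H #> comm G a (b [^] (p :: nat)) = (H #> comm G a b) [^]\<^bsub>G Mod H\<^esub> p"
proof (induction p)
  case 0
  show ?case using assms(1) by (simp add: comm_one_right Mod_one del: one_FactGroup)
next
  case (Suc p)
  then show ?case
    using Mod_comm_mult_right[OF assms(1) _ assms(2,3), of "b [^] p"] assms(2)
    by (simp del: mult_FactGroup)
qed

lemma Mod_comm_pow_left:
  assumes "a \<in> carrier G" "b \<in> carrier G" "comm G a b \<in> central_mod"
  shows "H #> comm G (a [^] (p :: nat)) b = (H #> comm G a b) [^]\<^bsub>G Mod H\<^esub> p"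
proof (induction p)
  case 0
  show ?case using assms(2) by (simp add: comm_one_left Mod_one del: one_FactGroup)
next
  case (Suc p)
  then show ?case
    using Mod_comm_mult_left[OF _ assms(1,2,3), of "a [^] p"] assms(1)
    by (simp del: mult_FactGroup)
qed

lemma subgroup_centralizer_mod:
  assumes g: "g \<in> carrier G"
  shows "subgroup {y \<in> carrier G. comm G g y \<in> H} G"
proof -
  interpret Q: group "G Mod H" by (rule factorgroup_is_group)
  have mult: "comm G g (x \<otimes> y) \<in> H"
    if "x \<in> carrier G" "y \<in> carrier G" "comm G g x \<in> H" "comm G g y \<in> H" for x y
  proof -
    let ?g = "H #> g" and ?x = "H #> x" and ?y = "H #> y"
    have m: "?g \<in> carrier (G Mod H)" "?x \<in> carrier (G Mod H)" "?y \<in> carrier (G Mod H)"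
      using that g Mod_mem by auto
    have "?g \<otimes>\<^bsub>G Mod H\<^esub> (?x \<otimes>\<^bsub>G Mod H\<^esub> ?y) = (?x \<otimes>\<^bsub>G Mod H\<^esub> ?y) \<otimes>\<^bsub>G Mod H\<^esub> ?g"
      by (rule Q.commute_mult[OF _ _ m]) (use that comm_mem_iff g in blast)+
    then show ?thesis using comm_mem_iff[of g "x \<otimes> y"] that g by (simp add: Mod_mult del: mult_FactGroup)
  qed
  have inv: "comm G g (inv x) \<in> H" if "x \<in> carrier G" "comm G g x \<in> H" for x
  proof -
    let ?g = "H #> g" and ?x = "H #> x"
    have m: "?g \<in> carrier (G Mod H)" "?x \<in> carrier (G Mod H)" using that g Mod_mem by auto
    have "?g \<otimes>\<^bsub>G Mod H\<^esub> ?x = ?x \<otimes>\<^bsub>G Mod H\<^esub> ?g" using that comm_mem_iff g by blast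
    then have "?g \<otimes>\<^bsub>G Mod H\<^esub> inv\<^bsub>G Mod H\<^esub> ?x = inv\<^bsub>G Mod H\<^esub> ?x \<otimes>\<^bsub>G Mod H\<^esub> ?g"
      by (rule Q.commute_inv[OF _ m])
    then show ?thesis using comm_mem_iff[of g "inv x"] that g by (simp add: Mod_inv del: mult_FactGroup)
  qed
  show ?thesis
    by (rule subgroupI) (use mult inv g one_closed in \<open>auto simp: comm_one_right intro!: exI[of _ \<one>]\<close>)
qed

lemma between_central_normal:
  assumes X: "subgroup X G" and "H \<subseteq> X" "X \<subseteq> central_mod"
  shows "X \<lhd> G"
proof -
  have "g \<otimes> x \<otimes> inv g \<in> X" if g: "g \<in> carrier G" and x: "x \<in> X" for g x
  proof -
    have xc: "x \<in> carrier G" "comm G x g \<in> H" using x g assms(3) by (auto simp: central_mod_def)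
    then have "comm G g x \<in> X" using comm_sym g assms(2) by blast
    moreover have "g \<otimes> x \<otimes> inv g = comm G g x \<otimes> x"
      using g xc by (simp add: comm_def m_assoc)
    ultimately show ?thesis using subgroup.m_closed[OF X] x by simp
  qed
  then show ?thesis using X normal_inv_iff by blast
qed

lemma subgroup_central_mod: "subgroup central_mod G"
proof -
  have eq: "central_mod = carrier G \<inter> (\<Inter>g\<in>carrier G. {y \<in> carrier G. comm G g y \<in> H})"
    using comm_sym by (auto simp: central_mod_def)
  have "subgroup (\<Inter>g\<in>carrier G. {y \<in> carrier G. comm G g y \<in> H}) G"
    by (rule subgroups_Inter) (use subgroup_centralizer_mod in auto)
  then show ?thesis unfolding eq using subgroup_self subgroups_Inter_pair by blast
qed

lemma subset_central_mod: "H \<subseteq> central_mod"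
proof
  fix x assume x: "x \<in> H"
  then have xc: "x \<in> carrier G" using subset by blast
  have "comm G x y \<in> H" if "y \<in> carrier G" for y
  proof -
    have "comm G x y = x \<otimes> (y \<otimes> inv x \<otimes> inv y)" using xc that by (simp add: comm_def m_assoc)
    moreover have "y \<otimes> inv x \<otimes> inv y \<in> H" using x that inv_op_closed2 m_inv_closed by blast
    ultimately show ?thesis using x m_closed by simp
  qed
  then show "x \<in> central_mod" using xc by (simp add: central_mod_def)
qed

lemma central_mod_normal: "central_mod \<lhd> G"
  by (rule between_central_normal[OF subgroup_central_mod subset_central_mod]) simp

end

section \<open>The upper central series\<close>

primrec upper_central :: "('c, 'd) monoid_scheme \<Rightarrow> nat \<Rightarrow> 'c set" where
  "upper_central G 0 = {\<one>\<^bsub>G\<^esub>}"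
| "upper_central G (Suc i) = {x \<in> carrier G. \<forall>y\<in>carrier G. comm G x y \<in> upper_central G i}"

context group
begin

lemma upper_central_normal: "upper_central G i \<lhd> G"
proof (induction i)
  case 0
  show ?case using one_is_normal by simp
next
  case (Suc i)
  then show ?case using normal.central_mod_normal[OF Suc] by (simp add: normal.central_mod_def)
qed

lemma upper_central_Suc: "upper_central G (Suc i) = normal.central_mod (upper_central G i) G"
  by (simp add: normal.central_mod_def[OF upper_central_normal])

lemma lower_central_subset: "lower_central G i \<subseteq> carrier G"
proof (induction i)
  case (Suc i)
  have "{x \<otimes> y \<otimes> inv x \<otimes> inv y | x y. x \<in> lower_central G i \<and> y \<in> carrier G} \<subseteq> carrier G"
    using Suc by auto
  then show ?case by (simp add: generate_incl)
qed simp

lemma lower_central_subset_upper_central: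
  assumes "lower_central G c = {\<one>}" and "j \<le> c"
  shows "lower_central G (c - j) \<subseteq> upper_central G j"
  using assms(2)
proof (induction j)
  case 0
  then show ?case using assms(1) by simp
next
  case (Suc j)
  show ?case
  proof
    fix x assume x: "x \<in> lower_central G (c - Suc j)"
    have "comm G x y \<in> upper_central G j" if "y \<in> carrier G" for y
    proof -
      have "comm G x y \<in> lower_central G (Suc (c - Suc j))"
        using x that by (auto simp: comm_def intro!: generate.incl)
      moreover have "Suc (c - Suc j) = c - j" using Suc.prems by simp
      ultimately show ?thesis using Suc by auto
    qed
    then show "x \<in> upper_central G (Suc j)" using x lower_central_subset by auto
  qed
qed

lemma nilpotent_upper_central:
  assumes "nilpotent_group G"
  obtains c where "upper_central G c = carrier G"
proof -
  obtain c where c: "lower_central G c = {\<one>}" using assms by (auto simp: nilpotent_group_def)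
  have "carrier G \<subseteq> upper_central G c"
    using lower_central_subset_upper_central[OF c, of c] by simp
  then show ?thesis
    using that normal_imp_subgroup[OF upper_central_normal] subgroup.subset by blast
qed

end

context group_fmr
begin

lemma dfn_term_comm: "dfn_term s \<Longrightarrow> dfn_term t \<Longrightarrow> dfn_term (\<lambda>\<sigma>. comm G (s \<sigma>) (t \<sigma>))"
  unfolding comm_def by (intro dfn_term_mult dfn_term_inv)

lemma dsub_upper_central: "dsub (upper_central G i)"
proof (induction i)
  case 0
  show ?case using dsub_one by simp
next
  case (Suc i)
  show ?case
  proof (rule dsubI)
    show "subgroup (upper_central G (Suc i)) G"
      by (rule normal_imp_subgroup[OF upper_central_normal])
    have "dfn (\<lambda>\<sigma>. \<sigma> 0 \<in> carrier G \<and> (\<forall>y\<in>carrier G. comm G (\<sigma> 0) y \<in> upper_central G i))"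
      by (intro dfn_intros dfn_term_comm dsub_definable Suc definable_carrier)
    then show "dfn (\<lambda>\<sigma>. \<sigma> 0 \<in> upper_central G (Suc i))" by simp
  qed
qed

lemma dsub_centralizer_mod:
  assumes "X \<lhd> G" "dsub X" "g \<in> carrier G"
  shows "dsub {y \<in> carrier G. comm G g y \<in> X}"
proof (rule dsubI)
  show "subgroup {y \<in> carrier G. comm G g y \<in> X} G"
    by (rule normal.subgroup_centralizer_mod) fact+
  have "dfn (\<lambda>\<sigma>. \<sigma> 0 \<in> carrier G \<and> comm G g (\<sigma> 0) \<in> X)"
    by (intro dfn_intros dfn_term_comm dsub_definable definable_carrier assms)
  then show "dfn (\<lambda>\<sigma>. \<sigma> 0 \<in> {y \<in> carrier G. comm G g y \<in> X})" by simp
qed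

section \<open>Centralizers in divisible nilpotent groups\<close>

text \<open>Let \<open>t\<^sub>u = [x,u]\<close> for \<open>u\<close> an iterated \<open>m\<close>-th root of \<open>g\<close>.  By the hypothesis for the next term of the
  series these commutators are central modulo \<open>K\<close>, the \<open>i\<close>-th term, so they multiply in both arguments, and
  \<open>t\<^sub>u\<close> has finite order \<open>p\<close> modulo \<open>K\<close>.  Thus \<open>x\<^sup>p\<close> centralizes \<open>u\<close> modulo \<open>K\<close>.  If the centralizer of
  \<open>u\<close> is minimal, then \<open>x\<^sup>p\<close> also centralizes a \<open>p\<close>-th root \<open>v\<close> of \<open>u\<close>, and
  \<open>t\<^sub>u = t\<^sub>v\<^sup>p = [x\<^sup>p,v]\<close> vanishes modulo \<open>K\<close>, and with it \<open>[x,g]\<close>, which is a power of \<open>t\<^sub>u\<close>.\<close>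

lemma comm_root_step:
  assumes div: "divisible_group G"
    and IH: "\<And>x g m. x \<in> carrier G \<Longrightarrow> g \<in> carrier G \<Longrightarrow> (m :: nat) > 0 \<Longrightarrow>
      comm G (x [^] m) g \<in> upper_central G (Suc i) \<Longrightarrow> comm G x g \<in> upper_central G (Suc i)"
    and x: "x \<in> carrier G" and g: "g \<in> carrier G" and m: "(m :: nat) > 0"
    and comm: "comm G (x [^] m) g \<in> upper_central G i"
  shows "comm G x g \<in> upper_central G i"
proof -
  note upper_central.simps(2) [simp del]
  let ?K = "upper_central G i" and ?Z = "upper_central G (Suc i)"
  interpret K: normal ?K G by (rule upper_central_normal)
  interpret Z: normal ?Z G by (rule upper_central_normal)
  interpret Q: group "G Mod ?K" by (rule K.factorgroup_is_group)
  have Z: "?Z = K.central_mod" by (rule upper_central_Suc)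
  have IH': "comm G x u \<in> ?Z" if u: "u \<in> carrier G" "(l :: nat) > 0" "comm G x (u [^] l) \<in> ?Z" for u l
  proof -
    have "comm G (u [^] l) x \<in> ?Z" using Z.comm_sym[OF x nat_pow_closed[OF u(1)]] u(3) by blast
    then have "comm G u x \<in> ?Z" by (rule IH[OF u(1) x u(2)])
    then show ?thesis using Z.comm_sym[OF u(1) x] by blast
  qed
  define C where "C u = {y \<in> carrier G. comm G u y \<in> ?K}" for u
  have dsub_C: "dsub (C u)" if "u \<in> carrier G" for u
    unfolding C_def by (rule dsub_centralizer_mod[OF upper_central_normal dsub_upper_central that])
  have C_pow: "C u \<subseteq> C (u [^] l)" if u: "u \<in> carrier G" for u and l :: nat
  proof
    fix y assume y: "y \<in> C u"
    then have "u \<in> {v \<in> carrier G. comm G y v \<in> ?K}" "y \<in> carrier G"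
      using u K.comm_sym by (auto simp: C_def)
    then have "u [^] l \<in> {v \<in> carrier G. comm G y v \<in> ?K}"
      using dsub_pow[OF dsub_centralizer_mod[OF upper_central_normal dsub_upper_central]] by blast
    then show "y \<in> C (u [^] l)" using \<open>y \<in> carrier G\<close> K.comm_sym by (auto simp: C_def)
  qed
  \<comment> \<open>Among the iterated m-th roots of g choose one whose centralizer modulo the i-th term is minimal;
    taking further roots no longer changes that centralizer.\<close>
  define roots where "roots = {u \<in> carrier G. \<exists>j :: nat. u [^] (m ^ j) = g}"
  have "g [^] (m ^ 0) = g" using g by simp
  then have "g \<in> roots" using g unfolding roots_def by blast
  then have "\<exists>u\<in>roots. C g = C u" by blast
  then have "\<exists>H. dsub H \<and> (\<exists>u\<in>roots. H = C u) \<and> (\<forall>L. dsub L \<longrightarrow> (\<exists>u\<in>roots. L = C u) \<longrightarrow> L \<subseteq> H \<longrightarrow> L = H)"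
    by (rule minimal_dsub[OF dsub_C[OF g]]) (intro exI conjI allI impI)
  then obtain H u where H: "u \<in> roots" "H = C u"
    and min: "\<forall>L. dsub L \<longrightarrow> (\<exists>u\<in>roots. L = C u) \<longrightarrow> L \<subseteq> H \<longrightarrow> L = H" by (elim exE conjE bexE) (rule that)
  obtain j :: nat where u: "u \<in> carrier G" "u [^] (m ^ j) = g" using H(1) by (auto simp: roots_def)
  define p where "p = m ^ j * m"
  have p: "p > 0" using m by (simp add: p_def)
  obtain v where v: "v \<in> carrier G" "v [^] p = u"
    using div u(1) p unfolding divisible_group_def by blast
  have "m ^ Suc (2 * j) = p * m ^ j" by (simp add: p_def mult_2 power_add)
  then have "v [^] (m ^ Suc (2 * j)) = (v [^] p) [^] (m ^ j)"
    using v(1) by (simp only: nat_pow_pow)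
  then have "v \<in> roots" using v u(2) unfolding roots_def by blast
  then have C_v: "C v = C u"
    using min dsub_C[OF v(1)] C_pow[OF v(1), of p] H(2) v(2) by blast
  have xg: "comm G x g \<in> ?Z"
    using IH[OF x g m] comm K.subset_central_mod Z by blast
  have xu: "comm G x u \<in> ?Z" using IH'[OF u(1), of "m ^ j"] xg u(2) m by simp
  have xv: "comm G x v \<in> ?Z" using IH'[OF v(1) p] xu v(2) by simp
  let ?c = "?K #> comm G x u"
  have c: "?c \<in> carrier (G Mod ?K)" using x u(1) by (simp add: K.Mod_mem)
  have c_g: "?K #> comm G x g = ?c [^]\<^bsub>G Mod ?K\<^esub> (m ^ j)"
    using K.Mod_comm_pow_right[OF x u(1), of "m ^ j"] xu Z u(2) by simp
  have "?K #> comm G (x [^] m) g = (?K #> comm G x g) [^]\<^bsub>G Mod ?K\<^esub> m"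
    using K.Mod_comm_pow_left[OF x g, of m] xg Z by simp
  also have "\<dots> = ?c [^]\<^bsub>G Mod ?K\<^esub> p"
    unfolding c_g p_def by (rule Q.nat_pow_pow[OF c])
  finally have "?c [^]\<^bsub>G Mod ?K\<^esub> p = \<one>\<^bsub>G Mod ?K\<^esub>"
    using K.Mod_eq_one_iff[of "comm G (x [^] m) g"] comm x g by simp
  moreover have "?K #> comm G (x [^] p) u = ?c [^]\<^bsub>G Mod ?K\<^esub> p"
    using K.Mod_comm_pow_left[OF x u(1), of p] xu Z by simp
  ultimately have "comm G (x [^] p) u \<in> ?K"
    using K.Mod_eq_one_iff[of "comm G (x [^] p) u"] x u(1) by simp
  then have "x [^] p \<in> C u"
    using K.comm_sym x u(1) by (auto simp: C_def)
  then have "x [^] p \<in> C v" unfolding C_v .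
  then have "comm G (x [^] p) v \<in> ?K" using K.comm_sym x v(1) by (auto simp: C_def)
  then have "\<one>\<^bsub>G Mod ?K\<^esub> = (?K #> comm G x v) [^]\<^bsub>G Mod ?K\<^esub> p"
    using K.Mod_comm_pow_left[OF x v(1), of p] K.Mod_eq_one_iff[of "comm G (x [^] p) v"] xv Z x v(1) by simp
  also have "\<dots> = ?c"
    using K.Mod_comm_pow_right[OF x v(1), of p] xv Z v(2) by simp
  finally have "?K #> comm G x g = \<one>\<^bsub>G Mod ?K\<^esub>"
    unfolding c_g by (metis Q.nat_pow_one)
  then show ?thesis using K.Mod_eq_one_iff x g by simp
qed

lemma commute_of_pow_commute:
  assumes div: "divisible_group G" and nil: "nilpotent_group G"
    and x: "x \<in> carrier G" and g: "g \<in> carrier G" and m: "(m :: nat) > 0"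
    and comm: "x [^] m \<otimes> g = g \<otimes> x [^] m"
  shows "x \<otimes> g = g \<otimes> x"
proof -
  obtain c where c: "upper_central G c = carrier G" by (rule nilpotent_upper_central[OF nil])
  define S where "S i \<longleftrightarrow> (\<forall>x\<in>carrier G. \<forall>g\<in>carrier G. \<forall>m>0.
    comm G (x [^] (m :: nat)) g \<in> upper_central G i \<longrightarrow> comm G x g \<in> upper_central G i)" for i
  have step: "S i" if "S (Suc i)" for i
    unfolding S_def
  proof (intro ballI allI impI)
    fix x g and m :: nat
    assume "x \<in> carrier G" "g \<in> carrier G" "m > 0" "comm G (x [^] m) g \<in> upper_central G i"
    then show "comm G x g \<in> upper_central G i"
      using comm_root_step[OF div, of i] that unfolding S_def by blast
  qed
  have "S c" using c by (simp add: S_def)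
  have "S (c - j)" for j
  proof (induction j)
    case (Suc j)
    then show ?case using step[of "c - Suc j"] by (cases "j < c") (simp_all add: Suc_diff_Suc)
  qed (simp add: \<open>S c\<close>)
  from this[of c] have "S 0" by simp
  have "comm G (x [^] m) g \<in> upper_central G 0"
    using comm_one_iff[of "x [^] m" g] comm x g by simp
  then have "comm G x g \<in> upper_central G 0"
    using \<open>S 0\<close> x g m unfolding S_def by blast
  then show ?thesis using comm_one_iff[OF x g] by simp
qed

text \<open>The double centralizer of \<open>g\<close> is abelian because \<open>g\<close> centralizes itself, and divisible because every
  root of an element commutes with whatever that element commutes with.\<close>

lemma divisible_abelian_cover:
  assumes div: "divisible_group G" and nil: "nilpotent_group G" and g: "g \<in> carrier G"
  obtains A where "abelian A" "divisible_set A" "g \<in> A"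
proof -
  define A where "A = {x \<in> carrier G. \<forall>y\<in>carrier G. y \<otimes> g = g \<otimes> y \<longrightarrow> x \<otimes> y = y \<otimes> x}"
  have "dsub A"
  proof (rule dsubI)
    have "A = {x \<in> carrier G. \<forall>y\<in>{y \<in> carrier G. y \<otimes> g = g \<otimes> y}. y \<otimes> x = x \<otimes> y}"
      by (auto simp: A_def)
    then show "subgroup A G" using subgroup_centralizer[of "{y \<in> carrier G. y \<otimes> g = g \<otimes> y}"] by auto
    have "dfn (\<lambda>\<sigma>. \<sigma> 0 \<in> carrier G \<and>
        (\<forall>y\<in>carrier G. y \<otimes> g = g \<otimes> y \<longrightarrow> \<sigma> 0 \<otimes> y = y \<otimes> \<sigma> 0))"
      by (intro dfn_intros definable_carrier g)
    then show "dfn (\<lambda>\<sigma>. \<sigma> 0 \<in> A)" by (simp add: A_def)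
  qed
  moreover have "x \<otimes> y = y \<otimes> x" if x: "x \<in> A" and y: "y \<in> A" for x y
  proof -
    have A_commutes: "u \<otimes> v = v \<otimes> u" if "u \<in> A" "v \<in> carrier G" "v \<otimes> g = g \<otimes> v" for u v
      using that unfolding A_def by blast
    have "y \<in> carrier G" using y unfolding A_def by blast
    then show ?thesis by (rule A_commutes[OF x _ A_commutes[OF y g refl]])
  qed
  ultimately have "abelian A" by (simp add: abelian_def)
  moreover have "divisible_set A"
    unfolding divisible_set_def
  proof (intro ballI allI impI)
    fix x and m :: nat assume x: "x \<in> A" and m: "m > 0"
    then obtain y where y: "y \<in> carrier G" "y [^] m = x"
      using div unfolding divisible_group_def A_def by blast
    have "y \<otimes> z = z \<otimes> y" if "z \<in> carrier G" "z \<otimes> g = g \<otimes> z" for z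
      by (rule commute_of_pow_commute[OF div nil y(1) that(1) m]) (use x y(2) that in \<open>simp add: A_def\<close>)
    then have "y \<in> A" using y(1) by (simp add: A_def)
    then show "\<exists>y\<in>A. y [^] m = x" using y(2) by blast
  qed
  moreover have "g \<in> A" using g by (simp add: A_def)
  ultimately show ?thesis by (rule that)
qed

section \<open>Commutation of subgroups of different reduced ranks\<close>

text \<open>\<open>Y\<close> is the preimage in \<open>G\<close> of the image of \<open>B\<close> under a homomorphism to \<open>G Mod X\<close> that is given by
  representatives \<open>f\<close>.\<close>

lemma dsub_span_mod:
  assumes X: "X \<lhd> G" "dsub X" and B: "dsub B"
    and f: "dfn_term (\<lambda>\<sigma>. f (\<sigma> 0))"
    and hom: "\<And>b b'. b \<in> B \<Longrightarrow> b' \<in> B \<Longrightarrow>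
      X #> f (b \<otimes> b') = (X #> f b) \<otimes>\<^bsub>G Mod X\<^esub> (X #> f b')"
  defines "Y \<equiv> {y \<in> carrier G. \<exists>b\<in>B. y \<otimes> inv (f b) \<in> X}"
  shows "dsub Y" and "X \<subseteq> Y" and "\<And>y. y \<in> Y \<longleftrightarrow> y \<in> carrier G \<and> (\<exists>b\<in>B. X #> y = X #> f b)"
    and "\<And>Z. dsub Z \<Longrightarrow> X \<subseteq> Z \<Longrightarrow> (\<And>b. b \<in> B \<Longrightarrow> f b \<in> Z) \<Longrightarrow> Y \<subseteq> Z"
proof -
  note mult_FactGroup [simp del] one_FactGroup [simp del]
  interpret X: normal X G by fact
  interpret Q: group "G Mod X" by (rule X.factorgroup_is_group)
  note S = dsub_subgroup[OF B]
  have fc: "f b \<in> carrier G" if "b \<in> B" for b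
    using dfn_term_closed[OF f, of "\<lambda>_. b"] that dsub_subset[OF B] by blast
  have fm: "X #> f b \<in> carrier (G Mod X)" if "b \<in> B" for b using fc[OF that] by (rule X.Mod_mem)
  note one_B = subgroup.one_closed[OF S]
  have "(X #> f \<one>) \<otimes>\<^bsub>G Mod X\<^esub> (X #> f \<one>) = X #> f \<one>"
    using hom[OF one_B one_B] by simp
  then have one: "X #> f \<one> = \<one>\<^bsub>G Mod X\<^esub>"
    using Q.l_cancel_one[OF fm[OF one_B] fm[OF one_B]] by blast
  have inv_f: "X #> f (inv b) = inv\<^bsub>G Mod X\<^esub> (X #> f b)" if b: "b \<in> B" for b
  proof -
    have b': "inv b \<in> B" "b \<in> carrier G" using b subgroup.m_inv_closed[OF S] dsub_subset[OF B] by blast+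
    have "(X #> f (inv b)) \<otimes>\<^bsub>G Mod X\<^esub> (X #> f b) = \<one>\<^bsub>G Mod X\<^esub>"
      using hom[OF b'(1) b] b'(2) one by simp
    then show ?thesis using Q.inv_equality fm b b'(1) by metis
  qed
  show Y_iff: "y \<in> Y \<longleftrightarrow> y \<in> carrier G \<and> (\<exists>b\<in>B. X #> y = X #> f b)" for y
    unfolding Y_def using X.Mod_eq_iff fc by blast
  show "X \<subseteq> Y"
  proof
    fix x assume x: "x \<in> X"
    then have "x \<in> carrier G" using X.subset by blast
    then show "x \<in> Y" unfolding Y_iff using x X.Mod_eq_one_iff one one_B by metis
  qed
  show "Y \<subseteq> Z" if Z: "dsub Z" "X \<subseteq> Z" "\<And>b. b \<in> B \<Longrightarrow> f b \<in> Z" for Z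
  proof
    fix y assume "y \<in> Y"
    then obtain b where b: "y \<in> carrier G" "b \<in> B" "y \<otimes> inv (f b) \<in> X" unfolding Y_def by blast
    have "y \<otimes> inv (f b) \<otimes> f b \<in> Z"
      by (rule subgroup.m_closed[OF dsub_subgroup[OF Z(1)]]) (use b Z(2,3) in auto)
    then show "y \<in> Z" using b fc[OF b(2)] by (simp add: m_assoc)
  qed
  have "subgroup Y G"
  proof (rule subgroupI)
    show "Y \<subseteq> carrier G" unfolding Y_def by blast
    have "X #> \<one> = X #> f \<one>" using one X.Mod_one by simp
    then have "\<one> \<in> Y" unfolding Y_iff using one_B one_closed by blast
    then show "Y \<noteq> {}" by blast
    show "inv y \<in> Y" if y: "y \<in> Y" for y
    proof -
      obtain b where "y \<in> carrier G" "b \<in> B" "X #> y = X #> f b" using y unfolding Y_iff by blast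
      then have "X #> inv y = X #> f (inv b)" "inv b \<in> B" "inv y \<in> carrier G"
        using X.Mod_inv inv_f subgroup.m_inv_closed[OF S] by auto
      then show ?thesis unfolding Y_iff by blast
    qed
    show "y \<otimes> z \<in> Y" if y: "y \<in> Y" and z: "z \<in> Y" for y z
    proof -
      obtain b where b: "y \<in> carrier G" "b \<in> B" "X #> y = X #> f b" using y unfolding Y_iff by blast
      obtain c where c: "z \<in> carrier G" "c \<in> B" "X #> z = X #> f c" using z unfolding Y_iff by blast
      have "X #> (y \<otimes> z) = X #> f (b \<otimes> c)"
        unfolding X.Mod_mult[OF b(1) c(1)] b(3) c(3) hom[OF b(2) c(2)] ..
      then show ?thesis unfolding Y_iff using b c subgroup.m_closed[OF S] by blast
    qed
  qed
  moreover have "dfn (\<lambda>\<sigma>. \<sigma> 0 \<in> carrier G \<and> (\<exists>b\<in>B. \<sigma> 0 \<otimes> inv (f b) \<in> X))"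
    by (intro dfn_intros dsub_definable definable_carrier dsub_subset assms)
  then have "dfn (\<lambda>\<sigma>. \<sigma> 0 \<in> Y)" by (simp add: Y_def)
  ultimately show "dsub Y" by (rule dsubI)
qed

text \<open>The argument runs modulo a definable group \<open>X\<close> of maximal rank among those between two consecutive
  terms of the series that miss some commutator \<open>[a0,b0]\<close>.  For fixed arguments the maps \<open>[a,-]\<close> and \<open>[-,b]\<close>
  are homomorphisms modulo \<open>X\<close>, and a kernel that is proper lies in the radical.  Consequently \<open>[a0,b1]\<close> is
  nontrivial modulo \<open>X\<close> for every \<open>b1\<close> outside the radical of \<open>B\<close>, and the maps \<open>[a0,-]\<close> and \<open>[-,b1]\<close>
  have the same image.\<close>

lemma atoms_commute_step:
  assumes A: "atom A (rad A)" and B: "atom B (rad B)"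
    and ranks: "rrank A \<noteq> rrank B"
    and central: "\<And>a b. a \<in> A \<Longrightarrow> b \<in> B \<Longrightarrow> comm G a b \<in> upper_central G (Suc i)"
    and "a \<in> A" "b \<in> B"
  shows "comm G a b \<in> upper_central G i"
proof (rule ccontr)
  note upper_central.simps(2) [simp del] mult_FactGroup [simp del] one_FactGroup [simp del]
  let ?K = "upper_central G i" and ?Z = "upper_central G (Suc i)"
  let ?JA = "rad A" and ?JB = "rad B"
  assume nontrivial: "comm G a b \<notin> ?K"
  interpret K: normal ?K G by (rule upper_central_normal)
  note Z = upper_central_Suc[of i] and dZ = dsub_upper_central[of "Suc i"]
  note A' = atomD[OF A] and B' = atomD[OF B]
  have Ac: "a \<in> carrier G" if "a \<in> A" for a using that dsub_subset[OF A'(2)] by blast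
  have Bc: "b \<in> carrier G" if "b \<in> B" for b using that dsub_subset[OF B'(2)] by blast
  define good where "good X \<longleftrightarrow> dsub X \<and> ?K \<subseteq> X \<and> X \<subseteq> ?Z \<and> (\<exists>a\<in>A. \<exists>b\<in>B. comm G a b \<notin> X)" for X
  have "good ?K"
    using nontrivial \<open>a \<in> A\<close> \<open>b \<in> B\<close> dsub_upper_central K.subset_central_mod Z unfolding good_def by blast
  then have start: "case (?K, 0) of (X, m) \<Rightarrow> good X \<and> rk_ge m X"
    using rk_ge_0[OF dsub_definable dsub_nonempty] unfolding good_def by simp
  have bound: "\<forall>p. (case p of (X, m) \<Rightarrow> good X \<and> rk_ge m X) \<longrightarrow> snd p < Suc n"
    using rk_ge_bound[OF dsub_definable dsub_subset] unfolding good_def by (auto simp: less_Suc_eq_le)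
  obtain p where p: "case p of (X, m) \<Rightarrow> good X \<and> rk_ge m X"
    and pmax: "\<forall>q. (case q of (X, m) \<Rightarrow> good X \<and> rk_ge m X) \<longrightarrow> snd q \<le> snd p"
    using ex_has_greatest_nat[OF start bound] by blast
  obtain X m where "p = (X, m)" by (cases p)
  with p pmax have good_X: "good X" and "rk_ge m X"
    and max: "\<And>Y l. good Y \<Longrightarrow> rk_ge l Y \<Longrightarrow> l \<le> m" by force+
  have X: "dsub X" "?K \<subseteq> X" "X \<subseteq> ?Z" using good_X unfolding good_def by blast+
  obtain a0 b0 where ab0: "a0 \<in> A" "b0 \<in> B" "comm G a0 b0 \<notin> X" using good_X unfolding good_def by blast
  have normal_X: "X \<lhd> G"
    by (rule K.between_central_normal[OF dsub_subgroup[OF X(1)] X(2)]) (use X(3) Z in blast)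
  interpret X: normal X G by (rule normal_X)
  interpret Q: group "G Mod X" by (rule X.factorgroup_is_group)
  have cen: "comm G a b \<in> X.central_mod" if "a \<in> A" "b \<in> B" for a b
    using central[OF that] X(2) unfolding X.central_mod_def Z K.central_mod_def by blast
  have hom_B: "X #> comm G a (b \<otimes> b') = (X #> comm G a b) \<otimes>\<^bsub>G Mod X\<^esub> (X #> comm G a b')"
    if "a \<in> A" "b \<in> B" "b' \<in> B" for a b b'
    using X.Mod_comm_mult_right[OF Ac Bc Bc cen] that by blast
  have hom_A: "X #> comm G (a \<otimes> a') b = (X #> comm G a b) \<otimes>\<^bsub>G Mod X\<^esub> (X #> comm G a' b)"
    if "a \<in> A" "a' \<in> A" "b \<in> B" for a a' b
    using X.Mod_comm_mult_left[OF Ac Ac Bc cen] that by blast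
  have kernel_B: "b \<in> ?JB" if a: "a \<in> A" "b' \<in> B" "comm G a b' \<notin> X" and b: "b \<in> B" "comm G a b \<in> X" for a b b'
  proof -
    let ?C = "B \<inter> {y \<in> carrier G. comm G a y \<in> X}"
    have "dsub ?C" by (rule dsub_Int[OF B'(2) dsub_centralizer_mod[OF normal_X X(1) Ac[OF a(1)]]])
    then have "?C \<subseteq> ?JB" using B'(5)[of ?C] a(2,3) by blast
    then show ?thesis using b Bc by blast
  qed
  have kernel_A: "a \<in> ?JA" if b: "b \<in> B" "a' \<in> A" "comm G a' b \<notin> X" and a: "a \<in> A" "comm G a b \<in> X" for a a' b
  proof -
    let ?C = "A \<inter> {y \<in> carrier G. comm G b y \<in> X}"
    have "dsub ?C" by (rule dsub_Int[OF A'(2) dsub_centralizer_mod[OF normal_X X(1) Bc[OF b(1)]]])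
    moreover have "a' \<notin> ?C" using X.comm_sym[OF Bc[OF b(1)] Ac[OF b(2)]] b(3) by blast
    ultimately have "?C \<subseteq> ?JA" using A'(5)[of ?C] b(2) by blast
    moreover have "comm G b a \<in> X" using X.comm_sym[OF Bc[OF b(1)] Ac[OF a(1)]] a(2) by blast
    ultimately show ?thesis using a(1) Ac[OF a(1)] by blast
  qed
  obtain b1 where b1: "b1 \<in> B" "b1 \<notin> ?JB" using B'(4) by blast
  have ab1: "comm G a0 b1 \<notin> X" using kernel_B[OF ab0 b1(1)] b1(2) by blast
  have term_B: "dfn_term (\<lambda>\<sigma>. comm G a0 (\<sigma> 0))"
    by (intro dfn_term_comm dfn_intros Ac ab0(1))
  have term_A: "dfn_term (\<lambda>\<sigma>. comm G (\<sigma> 0) b1)"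
    by (intro dfn_term_comm dfn_intros Bc b1(1))
  \<comment> \<open>Y = X [a0, B] is larger than X in rank, since [a0, B] modulo X is infinite.\<close>
  define Y where "Y = {y \<in> carrier G. \<exists>b\<in>B. y \<otimes> inv (comm G a0 b) \<in> X}"
  note span_B = dsub_span_mod[OF normal_X X(1) B'(2) term_B, folded Y_def]
  have dY: "dsub Y" by (rule span_B(1)) (rule hom_B[OF ab0(1)])
  have XY: "X \<subseteq> Y" by (rule span_B(2)) (rule hom_B[OF ab0(1)])
  have Y_iff: "y \<in> Y \<longleftrightarrow> y \<in> carrier G \<and> (\<exists>b\<in>B. X #> y = X #> comm G a0 b)" for y
    by (rule span_B(3)) (rule hom_B[OF ab0(1)])
  have YZ: "Y \<subseteq> ?Z" by (rule span_B(4)[OF _ dZ X(3)]) (use hom_B central ab0(1) in blast)+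
  have "infinite_index X Y"
    unfolding infinite_index_def
  proof (intro exI[of _ "\<lambda>i. comm G a0 (b1 [^] i)"] conjI allI impI)
    note pow = dsub_pow[OF B'(2) b1(1)]
    fix i j :: nat
    show "comm G a0 (b1 [^] i) \<in> Y"
      unfolding Y_iff using Ac[OF ab0(1)] Bc[OF pow] pow by auto
    have key: "X #> comm G a0 (b1 [^] i) \<noteq> X #> comm G a0 (b1 [^] j)" if "j < i" for i j :: nat
    proof
      assume eq: "X #> comm G a0 (b1 [^] i) = X #> comm G a0 (b1 [^] j)"
      have "b1 [^] i = b1 [^] (i - j) \<otimes> b1 [^] j" using that Bc[OF b1(1)] by (simp add: nat_pow_mult)
      then have "(X #> comm G a0 (b1 [^] (i - j))) \<otimes>\<^bsub>G Mod X\<^esub> (X #> comm G a0 (b1 [^] j))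
          = X #> comm G a0 (b1 [^] j)"
        using hom_B[OF ab0(1) pow pow] eq by simp
      then have "X #> comm G a0 (b1 [^] (i - j)) = \<one>\<^bsub>G Mod X\<^esub>"
        using Q.r_cancel_one X.Mod_mem comm_closed[OF Ac[OF ab0(1)] Bc[OF pow]] by blast
      then have "comm G a0 (b1 [^] (i - j)) \<in> X"
        using X.Mod_eq_one_iff comm_closed[OF Ac[OF ab0(1)] Bc[OF pow]] by blast
      then have "b1 [^] (i - j) \<in> ?JB" by (rule kernel_B[OF ab0 pow])
      then show False using B'(6)[OF b1(1), of "i - j"] that b1(2) by simp
    qed
    assume "i \<noteq> j"
    then have "X #> comm G a0 (b1 [^] i) \<noteq> X #> comm G a0 (b1 [^] j)"
      using key[of i j] key[of j i] by (cases "j < i") auto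
    then show "comm G a0 (b1 [^] i) \<otimes> inv (comm G a0 (b1 [^] j)) \<notin> X"
      using X.Mod_eq_iff comm_closed[OF Ac[OF ab0(1)] Bc[OF pow]] by blast
  qed
  then have "rk_ge (Suc m) Y" by (rule rk_ge_infinite_index[OF dY X(1) XY _ \<open>rk_ge m X\<close>])
  then have "\<not> good Y" using max[of Y "Suc m"] by auto
  then have all_in_Y: "comm G a b \<in> Y" if "a \<in> A" "b \<in> B" for a b
    using dY XY X(2) YZ that unfolding good_def by blast
  \<comment> \<open>The correspondence sends a to b when [a, b1] = [a0, b] modulo X.\<close>
  define R where "R = {(a, b). a \<in> A \<and> b \<in> B \<and> comm G a b1 \<otimes> inv (comm G a0 b) \<in> X}"
  have R_iff: "(a, b) \<in> R \<longleftrightarrow> a \<in> A \<and> b \<in> B \<and> X #> comm G a b1 = X #> comm G a0 b" for a b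
    unfolding R_def
    using X.Mod_eq_iff[OF comm_closed[OF Ac Bc[OF b1(1)]] comm_closed[OF Ac[OF ab0(1)] Bc]] by blast
  note SA = dsub_subgroup[OF A'(2)] and SB = dsub_subgroup[OF B'(2)]
  have "rrank A = rrank B"
  proof (rule reduced_rank_cong[OF A B, where R = R])
    show "R \<subseteq> A \<times> B" by (auto simp: R_def)
    have "dfn (\<lambda>\<sigma>. \<sigma> 0 \<in> A \<and> \<sigma> 1 \<in> B \<and> comm G (\<sigma> 0) b1 \<otimes> inv (comm G a0 (\<sigma> 1)) \<in> X)"
      by (intro dfn_term_comm dfn_intros dsub_definable A'(2) B'(2) X(1) Ac Bc ab0(1) b1(1))
    then show "dfn (\<lambda>\<sigma>. (\<sigma> 0, \<sigma> 1) \<in> R)" by (simp add: R_def)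
    show "(\<one>, \<one>) \<in> R"
      unfolding R_iff using subgroup.one_closed[OF SA] subgroup.one_closed[OF SB]
        X.comm_one_right[OF Ac[OF ab0(1)]] X.comm_one_left[OF Bc[OF b1(1)]] by simp
    show "(a \<otimes> inv a', b \<otimes> inv b') \<in> R" if "(a, b) \<in> R" "(a', b') \<in> R" for a b a' b'
    proof -
      have ab: "a \<in> A" "b \<in> B" "X #> comm G a b1 = X #> comm G a0 b" using that(1) unfolding R_iff by auto
      have ab': "a' \<in> A" "b' \<in> B" "X #> comm G a' b1 = X #> comm G a0 b'" using that(2) unfolding R_iff by auto
      let ?a = "a \<otimes> inv a'" and ?b = "b \<otimes> inv b'"
      have mem: "?a \<in> A" "?b \<in> B"
        using ab ab' subgroup.m_closed[OF SA] subgroup.m_inv_closed[OF SA]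
          subgroup.m_closed[OF SB] subgroup.m_inv_closed[OF SB] by blast+
      have "?a \<otimes> a' = a" "?b \<otimes> b' = b" using Ac[OF ab(1)] Ac[OF ab'(1)] Bc[OF ab(2)] Bc[OF ab'(2)]
        by (simp_all add: m_assoc)
      then have "(X #> comm G ?a b1) \<otimes>\<^bsub>G Mod X\<^esub> (X #> comm G a' b1)
          = (X #> comm G a0 ?b) \<otimes>\<^bsub>G Mod X\<^esub> (X #> comm G a0 b')"
        using hom_A[OF mem(1) ab'(1) b1(1)] hom_B[OF ab0(1) mem(2) ab'(2)] ab(3) by simp
      moreover have "X #> comm G ?a b1 \<in> carrier (G Mod X)" "X #> comm G a0 ?b \<in> carrier (G Mod X)"
        "X #> comm G a0 b' \<in> carrier (G Mod X)"
        by (rule X.Mod_mem, rule comm_closed, (rule Ac Bc, fact)+)+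
      ultimately have "X #> comm G ?a b1 = X #> comm G a0 ?b"
        unfolding ab'(3) using Q.right_cancel by blast
      then show ?thesis unfolding R_iff using mem by blast
    qed
    show "\<exists>b. (a, b) \<in> R" if "a \<in> A" for a
      using all_in_Y[OF that b1(1)] that unfolding R_iff Y_iff by blast
    show "\<exists>a. (a, b) \<in> R" if b: "b \<in> B" for b
    proof -
      \<comment> \<open>Y' = X [A, b1] contains [a0, b1], so the subgroup of all b with [a0, b] in Y' is not inside
        the radical of B and hence is B.\<close>
      define Y' where "Y' = {y \<in> carrier G. \<exists>a\<in>A. y \<otimes> inv (comm G a b1) \<in> X}"
      note span_A = dsub_span_mod[OF normal_X X(1) A'(2) term_A, folded Y'_def]
      have dY': "dsub Y'" by (rule span_A(1)) (rule hom_A[OF _ _ b1(1)])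
      have Y'_iff: "y \<in> Y' \<longleftrightarrow> y \<in> carrier G \<and> (\<exists>a\<in>A. X #> y = X #> comm G a b1)" for y
        by (rule span_A(3)) (rule hom_A[OF _ _ b1(1)])
      have "X \<subseteq> Y'" by (rule span_A(2)) (rule hom_A[OF _ _ b1(1)])
      moreover have "Y' \<subseteq> ?Z"
        by (rule span_A(4)[OF _ dZ X(3)]) (use hom_A central b1(1) in blast)+
      ultimately have "Y' \<lhd> G"
        using K.between_central_normal[OF dsub_subgroup[OF dY']] X(2) Z by blast
      then have "dsub (B \<inter> {y \<in> carrier G. comm G a0 y \<in> Y'})" (is "dsub ?I")
        by (intro dsub_Int B'(2) dsub_centralizer_mod dY' Ac ab0(1))
      moreover have "b1 \<in> ?I"
        unfolding Y'_iff using Ac[OF ab0(1)] Bc[OF b1(1)] b1(1) ab0(1) by auto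
      ultimately have "?I = B" using B'(5)[of ?I] b1(2) by blast
      then have "comm G a0 b \<in> Y'" using b by blast
      then show ?thesis using b unfolding R_iff Y'_iff by metis
    qed
    show "a \<in> ?JA" if "(a, \<one>) \<in> R" for a
    proof -
      have a: "a \<in> A" "X #> comm G a b1 = X #> \<one>"
        using that X.comm_one_right[OF Ac[OF ab0(1)]] unfolding R_iff by auto
      then have "comm G a b1 \<in> X"
        using X.Mod_eq_one_iff X.Mod_one comm_closed[OF Ac[OF a(1)] Bc[OF b1(1)]] by metis
      then show ?thesis by (rule kernel_A[OF b1(1) ab0(1) ab1 a(1)])
    qed
    show "b \<in> ?JB" if "(\<one>, b) \<in> R" for b
    proof -
      have b: "b \<in> B" "X #> \<one> = X #> comm G a0 b"
        using that X.comm_one_left[OF Bc[OF b1(1)]] unfolding R_iff by auto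
      then have "comm G a0 b \<in> X"
        using X.Mod_eq_one_iff X.Mod_one comm_closed[OF Ac[OF ab0(1)] Bc[OF b(1)]] by metis
      then show ?thesis by (rule kernel_B[OF ab0 b(1)])
    qed
  qed
  then show False using ranks by simp
qed

lemma atoms_commute:
  assumes nil: "nilpotent_group G"
    and A: "atom A (rad A)" and B: "atom B (rad B)"
    and ranks: "rrank A \<noteq> rrank B"
    and a: "a \<in> A" and b: "b \<in> B"
  shows "a \<otimes> b = b \<otimes> a"
proof -
  note A' = dsub_subset[OF atomD(2)[OF A]] and B' = dsub_subset[OF atomD(2)[OF B]]
  obtain c where c: "upper_central G c = carrier G" by (rule nilpotent_upper_central[OF nil])
  have "\<forall>a\<in>A. \<forall>b\<in>B. comm G a b \<in> upper_central G (c - j)" for j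
  proof (induction j)
    case 0
    show ?case using c comm_closed[OF subsetD[OF A'] subsetD[OF B']] by simp
  next
    case (Suc j)
    show ?case
    proof (cases "j < c")
      case True
      then have "c - j = Suc (c - Suc j)" by simp
      then show ?thesis using Suc atoms_commute_step[OF A B ranks, of "c - Suc j"] by metis
    qed (use Suc in simp)
  qed
  from this[of c] have "comm G a b = \<one>" using a b by simp
  then show ?thesis using comm_one_iff a b A' B' by blast
qed

section \<open>The decomposition\<close>

lemma torsion_hull_central:
  assumes div: "divisible_group G" and nil: "nilpotent_group G"
    and x: "x \<in> dhull (torsion G)" and g: "g \<in> carrier G"
  shows "x \<otimes> g = g \<otimes> x"
proof -
  let ?C = "{y \<in> carrier G. comm G g y \<in> {\<one>}}"
  have carr: "torsion G \<subseteq> carrier G" by (auto simp: torsion_def)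
  have C: "dsub ?C" by (rule dsub_centralizer_mod[OF one_is_normal dsub_one g])
  have "torsion G \<subseteq> ?C"
  proof
    fix t assume "t \<in> torsion G"
    then obtain m :: nat where t: "t \<in> carrier G" "m > 0" "t [^] m = \<one>" by (auto simp: torsion_def)
    then have "t \<otimes> g = g \<otimes> t" using commute_of_pow_commute[OF div nil t(1) g t(2)] g by simp
    then show "t \<in> ?C" using comm_one_iff[OF g t(1)] t(1) by simp
  qed
  then have "x \<in> ?C" using definable_hull_least(3)[OF carr C] x by blast
  then show ?thesis using comm_one_iff[OF g] by auto
qed

lemma U0_commute:
  assumes nil: "nilpotent_group G" and "r \<noteq> s" and "x \<in> U0 M N h k G r" "y \<in> U0 M N h k G s"
  shows "x \<otimes> y = y \<otimes> x"
proof -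
  define gens where "gens r = {A. definable_abelian M k G A \<and> A \<noteq> {\<one>} \<and> indec A \<and>
    rrank A = enat r \<and> torsion_free (radical_quotient M k G A)}" for r
  have at: "atom A (rad A)" "rrank A = enat r" if "A \<in> gens r" for A r
    using that atom_radical definable_abelian_iff by (auto simp: gens_def)
  have carr: "\<Union>(gens r) \<subseteq> carrier G" for r
    using at(1) atomD(2) dsub_subset by blast
  show ?thesis
  proof (rule generate_commutes[OF carr carr])
    show "x \<in> generate G (\<Union>(gens r))" "y \<in> generate G (\<Union>(gens s))"
      using assms(3,4) by (simp_all add: U0_def gens_def)
    fix a b assume "a \<in> \<Union>(gens r)" "b \<in> \<Union>(gens s)"
    then obtain A B where AB: "A \<in> gens r" "a \<in> A" "B \<in> gens s" "b \<in> B" by blast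
    show "a \<otimes> b = b \<otimes> a"
      by (rule atoms_commute[OF nil at(1)[OF AB(1)] at(1)[OF AB(3)] _ AB(2,4)])
        (use at(2)[OF AB(1)] at(2)[OF AB(3)] \<open>r \<noteq> s\<close> in simp)
  qed
qed

lemma subgroup_U0: "subgroup (U0 M N h k G r) G"
  unfolding U0_def
  by (rule generate_is_subgroup) (use dsub_subset definable_abelian_iff abelian_dsub in blast)

end

theorem theorem3p5:
  fixes M :: "('f, 'r, 'a) struct" and N :: "('f, 'r, 'b) struct" and h :: "'a \<Rightarrow> 'b"
    and k n :: nat and G :: "'a list monoid"
  assumes "elementary_embedding M N h" and "omega_saturated N"
    and "definable_group M k G"
    and "morley_rank M N h k (carrier G) = enat n"
    and "divisible_group G" and "nilpotent_group G"
  shows "central_product G {0..n}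
    (\<lambda>i. if i = 0 then definable_hull M k G (torsion G) else U0 M N h k G i)"
proof -
  interpret group_fmr M k G N h n
    by unfold_locales fact+
  let ?A = "\<lambda>i. if i = 0 then definable_hull M k G (torsion G) else U0 M N h k G i"
  have carr: "torsion G \<subseteq> carrier G" by (auto simp: torsion_def)
  have sub: "subgroup (?A i) G" for i
    using dsub_subgroup[OF definable_hull_least(1)[OF carr]] subgroup_U0 by simp
  then have subset: "?A i \<subseteq> carrier G" for i by (rule subgroup.subset)
  have comm: "x \<otimes>\<^bsub>G\<^esub> y = y \<otimes>\<^bsub>G\<^esub> x" if "i \<noteq> j" "x \<in> ?A i" "y \<in> ?A j" for i j x y
  proof -
    have xy: "x \<in> carrier G" "y \<in> carrier G" using that(2,3) subset by blast+
    consider "i = 0" | "j = 0" | "i \<noteq> 0" "j \<noteq> 0" by blast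
    then show ?thesis
    proof cases
      case 1
      then show ?thesis using torsion_hull_central[OF assms(5,6) _ xy(2)] that(2) by simp
    next
      case 2
      then show ?thesis using torsion_hull_central[OF assms(5,6) _ xy(1), of y] that(3) by simp
    next
      case 3
      then show ?thesis using U0_commute[OF assms(6) \<open>i \<noteq> j\<close>] that(2,3) by simp
    qed
  qed
  define W where "W = generate G (\<Union>i\<in>{0..n}. ?A i)"
  have gens: "(\<Union>i\<in>{0..n}. ?A i) \<subseteq> carrier G" using subset by blast
  have W: "subgroup W G" unfolding W_def by (rule generate_is_subgroup[OF gens])
  have incl: "?A i \<subseteq> W" if "i \<le> n" for i
    using that unfolding W_def by (intro subsetI generate.incl UN_I[of i]) auto
  have "g \<in> W" if "g \<in> carrier G" for g
  proof (rule divisible_abelian_cover[OF assms(5,6) that])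
    fix A assume "abelian A" "divisible_set A" "g \<in> A"
    moreover have "U0 M N h k G r \<subseteq> W" if "1 \<le> r" "r \<le> n" for r
      using incl[OF that(2)] that(1) by simp
    moreover have "definable_hull M k G (torsion G) \<subseteq> W" using incl[of 0] by simp
    ultimately show "g \<in> W" using divisible_abelian_subset[OF W, of A] by blast
  qed
  then have "W = carrier G" using subgroup.subset[OF W] by blast
  then show ?thesis
    unfolding central_product_def W_def using sub comm by blast
qed

end
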